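(* Let $K/\mathbb{Q}$ be a finite Galois extension with group $G$, let $p$ be a rational prime, let $\omega$ be a place of $K$ over $p$, and let $\mathcal{D}=\mathcal{D}_{\omega/p}\subset G$ and $\mathcal{I}=\mathcal{I}_{\omega/p}$ be the decomposition and inertia groups of $\omega$ over $p$. Let $c\in\mathcal{D}$ be a preimage of a generator of $\mathfrak{g}=\mathfrak{g}_{\omega/p}$ under the canonical projection $\mathcal{D}\to\mathfrak{g}$. Let $F$ be a subfield of $K$, let $G_F\subset G$ be the subgroup fixing $F$ pointwise, and let $\nu$ be the place of $F$ under $\omega$. Then: 1. The kernel of the natural map $\mathcal{D}\to\mathfrak{g}_{\nu/p}$ (the composition $\mathcal{D}\to\mathfrak{g}_{\omega/p}\to\mathfrak{g}_{\nu/p}$) is $\mathcal{I}\mathcal{D}_{\omega/\nu}$. 2. If $m$ is a positive integer, there is $g\in G$ such that $g\,\mathcal{I}c^m g^{-1}\cap G_F\neq\emptyset$ if and only if there is $f\in S_F(p)$ such that $f\mid m$. 3. In particular, if $p$ is unramified in $K$ and $m$ is a positive integer, then $\chi_F(F_p^m)\neq 0$ if and only if there is $f\in S_F(p)$ such that $f\mid m$, where $\chi_F=\operatorname{Ind}_{G_F}^G(1_{G_F})$ and $F_p\subset G$ is the Frobenius conjugacy class of $p$.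
   Context: For a finite extension $E/L$ of number fields (not necessarily Galois), a place $\nu$ of $L$ and a place $\omega$ of $E$ over $\nu$, $\kappa(\nu)$ and $\kappa(\omega)$ denote the residue fields, and $\mathfrak{g}_{\omega/\nu}$ denotes the Galois group of the cyclic extension $\kappa(\omega)/\kappa(\nu)$. If $E/L$ is Galois, $\mathcal{D}_{\omega/\nu}$ is the decomposition group and $\mathcal{I}_{\omega/\nu}$ is the kernel of the canonical epimorphism $\mathcal{D}_{\omega/\nu}\to\mathfrak{g}_{\omega/\nu}$; for $L\subset L'\subset E$ and the place $\eta$ of $L'$ under $\omega$, $\mathcal{D}_{\omega/\eta}=\mathcal{D}_{\omega/\nu}\cap\operatorname{Gal}(E/L')$. For a number field $F$ and a rational prime $p$, the splitting type $S_F(p)$ is the multiset of residual degrees $[\mathcal{O}_F/\mathfrak{p}:\mathbb{Z}/p\mathbb{Z}]$ as $\mathfrak p$ ranges over the distinct primes of $F$ above $p$. $\mathcal{I}c^m$ denotes the coset $\{ic^m: i\in\mathcal{I}\}$. $\operatorname{Ind}_{G_F}^G(1_{G_F})$ is the character of $G$ induced from the trivial character of $G_F$; $F_p^m$ is the set of $m$-th powers of elements of $F_p$ (a conjugacy class), and $\chi_F(F_p^m)$ is the value of $\chi_F$ on it. *)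

theory Defs
  imports
    Complex_Main
    "HOL-Library.Multiset"
    "HOL-Algebra.Algebra"
    "HOL-Algebra.Algebraic_Closure_Type"
begin

text \<open>
  The big number field \<open>K\<close> is a whole type \<open>'a :: field_char_0\<close>, finite over \<open>\<rat>\<close>; its subfields are
  sets. The library's \<^const>\<open>ring_of_type_algebra\<close> turns the type into a record of HOL-Algebra,
  where ideals, quotient rings, subfields, dimensions and groups are available. A finite place
  is represented by the corresponding prime ideal, and the prime \<open>p\<close> of \<open>\<rat>\<close> by the place
  under a given place of the big field.
\<close>

section \<open>Galois groups\<close>

definition galois_group :: "('a, 'b) ring_scheme \<Rightarrow> 'a set \<Rightarrow> ('a \<Rightarrow> 'a) monoid" where
  "galois_group E L = (BijGroup (carrier E))
     \<lparr>carrier := {\<sigma> \<in> Bij (carrier E). \<sigma> \<in> ring_hom E E \<and> (\<forall>x\<in>L. \<sigma> x = x)}\<rparr>"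

text \<open>A finite extension is Galois if its base field is the fixed field of its automorphism group.\<close>

definition finite_galois_extension :: "('a, 'b) ring_scheme \<Rightarrow> 'a set \<Rightarrow> bool" where
  "finite_galois_extension E L \<longleftrightarrow>
     field E \<and> subfield L E \<and> ring.finite_dimension E L (carrier E) \<and>
     {x \<in> carrier E. \<forall>\<sigma>\<in>carrier (galois_group E L). \<sigma> x = x} = L"

abbreviation Gal :: "'a::field_char_0 set \<Rightarrow> ('a \<Rightarrow> 'a) monoid" where
  "Gal L \<equiv> galois_group ring_of_type_algebra L"

section \<open>Integers, places and residue fields\<close>

definition ring_of_integers :: "'a::field_char_0 set \<Rightarrow> 'a ring" where
  "ring_of_integers E = ring_of_type_algebra\<lparr>carrier := {x \<in> E. algebraic_int x}\<rparr>"

definition places_above :: "'a::field_char_0 set \<Rightarrow> nat \<Rightarrow> 'a set set" where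
  "places_above E p = {P. primeideal P (ring_of_integers E) \<and> of_nat p \<in> P}"

definition place_under :: "'a::field_char_0 set \<Rightarrow> 'a set \<Rightarrow> 'a set" where
  "place_under L P = P \<inter> carrier (ring_of_integers L)"

definition residue_field :: "'a::field_char_0 set \<Rightarrow> 'a set \<Rightarrow> 'a set ring" where
  "residue_field E P = ring_of_integers E Quot P"

text \<open>
  For subfields \<open>L \<subseteq> E\<close>, \<open>P\<close> a place of \<open>E\<close> and \<open>Q\<close> the place of \<open>L\<close> under it, the inclusion
  of the residue field of \<open>Q\<close> in that of \<open>P\<close> sends \<open>Q + x\<close> to \<open>P + x = P + (Q + x)\<close>.
\<close>

definition residue_embedding :: "'a::field_char_0 set \<Rightarrow> 'a set \<Rightarrow> 'a set \<Rightarrow> 'a set" where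
  "residue_embedding E P C = P <+>\<^bsub>ring_of_integers E\<^esub> C"

definition residue_base :: "'a::field_char_0 set \<Rightarrow> 'a set \<Rightarrow> 'a set \<Rightarrow> 'a set set" where
  "residue_base L E P = residue_embedding E P ` carrier (residue_field L (place_under L P))"

definition residue_galois_group ::
    "'a::field_char_0 set \<Rightarrow> 'a set \<Rightarrow> 'a set \<Rightarrow> ('a set \<Rightarrow> 'a set) monoid" where
  "residue_galois_group L E P = galois_group (residue_field E P) (residue_base L E P)"

definition residue_degree :: "'a::field_char_0 set \<Rightarrow> 'a set \<Rightarrow> 'a set \<Rightarrow> nat" where
  "residue_degree L E P =
     ring.dim (residue_field E P) (residue_base L E P) (carrier (residue_field E P))"

text \<open>
  Only finitely many primes of a number field lie above \<open>p\<close>, so \<^const>\<open>mset_set\<close> does not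
  collapse. The integers of \<open>\<rat>\<close> are \<open>\<int>\<close>, so the degrees are taken over \<open>\<int>/p\<int>\<close>.
\<close>

definition splitting_type :: "'a::field_char_0 set \<Rightarrow> nat \<Rightarrow> nat multiset" where
  "splitting_type F p = image_mset (residue_degree \<rat> F) (mset_set (places_above F p))"

text \<open>The exponent of \<open>P\<close> in the factorization of \<open>p\<close>, i.e. the largest \<open>e\<close> such that \<open>P^e\<close> contains \<open>p\<close>.\<close>

definition ramification_index :: "'a::field_char_0 set \<Rightarrow> 'a set \<Rightarrow> nat \<Rightarrow> nat" where
  "ramification_index E P p = (GREATEST e.
     PIdl\<^bsub>ring_of_integers E\<^esub> (of_nat p) \<subseteq> P [^]\<^bsub>ideals_set (ring_of_integers E)\<^esub> e)"

definition unramified :: "'a::field_char_0 set \<Rightarrow> nat \<Rightarrow> bool" where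
  "unramified E p \<longleftrightarrow> (\<forall>P \<in> places_above E p. ramification_index E P p = 1)"

section \<open>Decomposition, inertia and Frobenius\<close>

definition decomposition_group :: "'a::field_char_0 set \<Rightarrow> 'a set \<Rightarrow> ('a \<Rightarrow> 'a) set" where
  "decomposition_group L P = {\<sigma> \<in> carrier (Gal L). \<sigma> ` P = P}"

text \<open>If \<open>\<sigma>\<close> stabilizes \<open>P\<close>, it maps the coset \<open>P + x\<close> onto the coset \<open>P + \<sigma> x\<close>.\<close>

definition reduction :: "'a::field_char_0 set \<Rightarrow> ('a \<Rightarrow> 'a) \<Rightarrow> 'a set \<Rightarrow> 'a set" where
  "reduction P \<sigma> = (\<lambda>C \<in> carrier (residue_field UNIV P). \<sigma> ` C)"

definition inertia_group :: "'a::field_char_0 set \<Rightarrow> 'a set \<Rightarrow> ('a \<Rightarrow> 'a) set" where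
  "inertia_group L P =
     kernel (Gal L\<lparr>carrier := decomposition_group L P\<rparr>) (residue_galois_group L UNIV P) (reduction P)"

text \<open>
  Restriction of an automorphism of the residue field of \<open>P\<close> to the residue field of the place
  of \<open>F\<close> under \<open>P\<close>, the latter being viewed as a subfield through the embedding above.
\<close>

definition residue_restriction ::
    "'a::field_char_0 set \<Rightarrow> 'a set \<Rightarrow> ('a set \<Rightarrow> 'a set) \<Rightarrow> 'a set \<Rightarrow> 'a set" where
  "residue_restriction F P \<tau> = (\<lambda>C \<in> carrier (residue_field F (place_under F P)).
     inv_into (carrier (residue_field F (place_under F P))) (residue_embedding UNIV P)
       (\<tau> (residue_embedding UNIV P C)))"

definition frobenius_class :: "nat \<Rightarrow> ('a::field_char_0 \<Rightarrow> 'a) set" where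
  "frobenius_class p = {\<sigma>. \<exists>P \<in> places_above UNIV p. \<sigma> \<in> decomposition_group \<rat> P \<and>
     (\<forall>C \<in> carrier (residue_field UNIV P). reduction P \<sigma> C = C [^]\<^bsub>residue_field UNIV P\<^esub> p)}"

section \<open>Induced characters\<close>

definition induced_character ::
    "('g, 'b) monoid_scheme \<Rightarrow> 'g set \<Rightarrow> ('g \<Rightarrow> complex) \<Rightarrow> 'g \<Rightarrow> complex" where
  "induced_character G H \<psi> g = (\<Sum>x\<in>carrier G.
     if inv\<^bsub>G\<^esub> x \<otimes>\<^bsub>G\<^esub> g \<otimes>\<^bsub>G\<^esub> x \<in> H then \<psi> (inv\<^bsub>G\<^esub> x \<otimes>\<^bsub>G\<^esub> g \<otimes>\<^bsub>G\<^esub> x) else 0) / of_nat (card H)"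

text \<open>The common value of \<open>\<chi>\<close> on a set where it is constant, such as a conjugacy class.\<close>

definition class_value :: "('g \<Rightarrow> complex) \<Rightarrow> 'g set \<Rightarrow> complex" where
  "class_value \<chi> C = the_elem (\<chi> ` C)"

end

theory Submission
  imports Defs
begin

text \<open>
  Write \<open>P\<close> for a place of the Galois number field \<open>K\<close> above \<open>p\<close>. Everything rests on the surjectivity of the
  decomposition group onto the Galois group of the residue fields, in a form that covers all its uses
  (\<open>residue_endomorphism_lifts\<close>): if \<open>H\<close> is a group of automorphisms of \<open>K\<close> and \<open>t\<close> induces an endomorphism
  of the residue field of \<open>P\<close> that is trivial on the integers fixed by \<open>H\<close>, then some \<open>d \<in> H\<close> with \<open>d P = P\<close>
  induces the same endomorphism.

  For \<open>H = Gal F\<close>, whose fixed field is \<open>F\<close> (\<open>fixed_by_Gal_imp_mem\<close>), and \<open>t\<close> in the decomposition group, this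
  says that an automorphism that is trivial on the residue field of \<open>F\<close> differs from an element of
  \<open>Gal F\<close> that stabilizes \<open>P\<close> by an element of the inertia group: this is the formula for the kernel. For
  \<open>H = Gal \<rat>\<close> and \<open>t x = x\<^sup>p\<close> it gives Frobenius elements. For \<open>H\<close> generated by a Frobenius element it shows that
  every element of the decomposition group acts on the residue field as a power of the Frobenius map.

  Now let \<open>c\<close> act as a generator. The coset \<open>I c\<^sup>m\<close> meets \<open>Gal F\<close> if and only if \<open>c\<^sup>m\<close>, or equivalently the
  \<open>m\<close>-th power of the Frobenius map, is trivial on the residue field of \<open>F\<close>, that is, if and only if the
  degree of this residue field divides \<open>m\<close> (\<open>Gal_meets_coset_iff\<close>). Conjugating by \<open>g\<close> replaces \<open>P\<close> by \<open>g P\<close>,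
  and the places under the \<open>g P\<close> are all the places of \<open>F\<close> above \<open>p\<close> (\<open>places_above_subfield\<close>).

  If \<open>p\<close> is unramified, the inertia group is trivial (\<open>unramified_imp_trivial_inertia\<close>). Here \<open>P\<close> is generated
  by \<open>p\<close> up to units at \<open>P\<close>, and as \<open>p\<close> is fixed by an automorphism \<open>\<sigma>\<close> in the inertia group, an induction
  shows that \<open>\<sigma> x - x\<close> is divisible by every power of \<open>p\<close> at \<open>P\<close>. Hence the Frobenius elements form one
  conjugacy class, and the value of the permutation character at \<open>\<Phi>\<^sup>m\<close> is non-zero if and only if a
  conjugate of \<open>\<Phi>\<^sup>m\<close> lies in \<open>Gal F\<close>.
\<close>

section \<open>Automorphism groups\<close>

lemma type_algebra_simps [simp]:
  "carrier (ring_of_type_algebra :: 'a::comm_ring_1 ring) = UNIV"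
  "monoid.mult (ring_of_type_algebra :: 'a ring) = (*)"
  "monoid.one (ring_of_type_algebra :: 'a ring) = 1"
  "ring.zero (ring_of_type_algebra :: 'a ring) = 0"
  "ring.add (ring_of_type_algebra :: 'a ring) = (+)"
  by (auto simp: ring_of_type_algebra_def)

lemma galois_group_subgroup:
  assumes "ring E" "L \<subseteq> carrier E"
  shows "subgroup (carrier (galois_group E L)) (BijGroup (carrier E))"
proof -
  interpret E: ring E by fact
  let ?A = "{\<sigma> \<in> Bij (carrier E). \<sigma> \<in> ring_hom E E \<and> (\<forall>x\<in>L. \<sigma> x = x)}"
  have "subgroup ?A (BijGroup (carrier E))"
  proof (rule group.subgroupI[OF group_BijGroup])
    have "(\<lambda>x\<in>carrier E. x) \<in> ?A"
      using assms(2) by (auto simp: id_Bij ring_hom_def)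
    then show "?A \<noteq> {}" by blast
    fix f g assume f: "f \<in> ?A" and g: "g \<in> ?A"
    then have fc: "\<And>x. x \<in> carrier E \<Longrightarrow> f x \<in> carrier E"
      and gc: "\<And>x. x \<in> carrier E \<Longrightarrow> g x \<in> carrier E"
      by (auto simp: ring_hom_def)
    have "compose (carrier E) f g \<in> ring_hom E E \<and> (\<forall>x\<in>L. compose (carrier E) f g x = x)"
      using f g assms(2) fc gc by (auto simp: ring_hom_def compose_def subset_iff)
    moreover have "compose (carrier E) f g \<in> Bij (carrier E)"
      using f g by (intro compose_Bij) auto
    ultimately have "compose (carrier E) f g \<in> ?A" by simp
    then show "f \<otimes>\<^bsub>BijGroup (carrier E)\<^esub> g \<in> ?A"
      using f g by (simp add: BijGroup_def)
    let ?g = "\<lambda>x\<in>carrier E. inv_into (carrier E) f x"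
    have bij: "bij_betw f (carrier E) (carrier E)" using f by (simp add: Bij_def)
    have inv1: "inv_into (carrier E) f (f x) = x" if "x \<in> carrier E" for x
      using bij that by (simp add: bij_betw_inv_into_left)
    have "?g \<in> ring_hom E E"
    proof (rule ring_hom_memI)
      fix x y assume x: "x \<in> carrier E" and y: "y \<in> carrier E"
      show "?g x \<in> carrier E" using f x by (simp add: Bij_inv_into_mem)
      have "inv_into (carrier E) f (x \<otimes>\<^bsub>E\<^esub> y)
          = inv_into (carrier E) f x \<otimes>\<^bsub>E\<^esub> inv_into (carrier E) f y"
        by (rule Bij_inv_into_lemma) (use f x y in \<open>auto simp: ring_hom_def\<close>)
      then show "?g (x \<otimes>\<^bsub>E\<^esub> y) = ?g x \<otimes>\<^bsub>E\<^esub> ?g y" using x y by simp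
      have "inv_into (carrier E) f (x \<oplus>\<^bsub>E\<^esub> y)
          = inv_into (carrier E) f x \<oplus>\<^bsub>E\<^esub> inv_into (carrier E) f y"
        by (rule Bij_inv_into_lemma) (use f x y in \<open>auto simp: ring_hom_def\<close>)
      then show "?g (x \<oplus>\<^bsub>E\<^esub> y) = ?g x \<oplus>\<^bsub>E\<^esub> ?g y" using x y by simp
    next
      have "f \<one>\<^bsub>E\<^esub> = \<one>\<^bsub>E\<^esub>" using f by (auto simp: ring_hom_def)
      then show "?g \<one>\<^bsub>E\<^esub> = \<one>\<^bsub>E\<^esub>" using inv1[of "\<one>\<^bsub>E\<^esub>"] by simp
    qed
    moreover have "\<forall>x\<in>L. ?g x = x"
    proof
      fix x assume "x \<in> L"
      then show "?g x = x" using f assms(2) inv1[of x] by auto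
    qed
    moreover have "?g \<in> Bij (carrier E)" using f by (intro restrict_inv_into_Bij) auto
    ultimately show "inv\<^bsub>BijGroup (carrier E)\<^esub> f \<in> ?A"
      using f by (simp add: inv_BijGroup)
  qed (auto simp: BijGroup_def)
  then show ?thesis by (simp add: galois_group_def)
qed

lemma group_galois_group:
  assumes "ring E" "L \<subseteq> carrier E"
  shows "group (galois_group E L)"
  using subgroup.subgroup_is_group[OF galois_group_subgroup[OF assms] group_BijGroup]
  by (simp add: galois_group_def)

lemma group_Gal [simp, intro]: "group (Gal L)"
  by (rule group_galois_group) (auto intro: ring_from_type_algebra)

lemma Gal_iff:
  "\<sigma> \<in> carrier (Gal L) \<longleftrightarrow> bij \<sigma> \<and> (\<forall>x y. \<sigma> (x + y) = \<sigma> x + \<sigma> y) \<and>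
     (\<forall>x y. \<sigma> (x * y) = \<sigma> x * \<sigma> y) \<and> \<sigma> 1 = 1 \<and> (\<forall>x\<in>L. \<sigma> x = x)"
  by (auto simp: galois_group_def Bij_def ring_hom_def)

lemma Gal_mult:
  assumes "\<sigma> \<in> carrier (Gal L)" "\<tau> \<in> carrier (Gal L)"
  shows "\<sigma> \<otimes>\<^bsub>Gal L'\<^esub> \<tau> = \<sigma> \<circ> \<tau>"
  using assms by (auto simp: galois_group_def BijGroup_def compose_def fun_eq_iff)

lemma Gal_one: "\<one>\<^bsub>Gal L\<^esub> = id"
  by (auto simp: galois_group_def BijGroup_def fun_eq_iff)

lemma Gal_comp: "\<sigma> \<in> carrier (Gal L) \<Longrightarrow> \<tau> \<in> carrier (Gal L) \<Longrightarrow> \<sigma> \<circ> \<tau> \<in> carrier (Gal L)"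
  using group.is_monoid[OF group_Gal, THEN monoid.m_closed] Gal_mult by metis

lemma Gal_inv:
  assumes "\<sigma> \<in> carrier (Gal L)"
  shows "inv\<^bsub>Gal L\<^esub> \<sigma> = inv_into UNIV \<sigma>"
proof -
  interpret G: group "Gal L" by simp
  have "inv\<^bsub>Gal L\<^esub> \<sigma> \<circ> \<sigma> = id"
    using assms G.l_inv[OF assms] Gal_mult[of "inv\<^bsub>Gal L\<^esub> \<sigma>" L \<sigma> L] by (simp add: Gal_one)
  then have *: "(inv\<^bsub>Gal L\<^esub> \<sigma>) (\<sigma> x) = x" for x by (simp add: fun_eq_iff)
  have "\<sigma> (inv_into UNIV \<sigma> y) = y" for y
    using assms by (simp add: Gal_iff bij_is_surj surj_f_inv_f)
  then show ?thesis using * by (metis ext)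
qed

lemma Gal_inv_closed: "\<sigma> \<in> carrier (Gal L) \<Longrightarrow> inv_into UNIV \<sigma> \<in> carrier (Gal L)"
  using group.inv_closed[OF group_Gal] Gal_inv by metis

lemma Gal_pow:
  assumes "\<sigma> \<in> carrier (Gal L)"
  shows "\<sigma> [^]\<^bsub>Gal L\<^esub> (m::nat) = \<sigma> ^^ m"
proof -
  interpret G: group "Gal L" by simp
  show ?thesis
  proof (induction m)
    case (Suc m)
    have "\<sigma> [^]\<^bsub>Gal L\<^esub> Suc m = \<sigma> [^]\<^bsub>Gal L\<^esub> m \<circ> \<sigma>"
      using assms by (simp add: Gal_mult[where L = L])
    then show ?case using Suc by (simp only: funpow_Suc_right)
  qed (simp add: Gal_one)
qed

lemma Gal_pow_closed: "\<sigma> \<in> carrier (Gal L) \<Longrightarrow> \<sigma> ^^ m \<in> carrier (Gal L)"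
  using Gal_pow group.is_monoid[OF group_Gal, THEN monoid.nat_pow_closed] by metis

context
  fixes \<sigma> :: "'a::field_char_0 \<Rightarrow> 'a" and L
  assumes \<sigma>: "\<sigma> \<in> carrier (Gal L)"
begin

lemma Gal_add: "\<sigma> (x + y) = \<sigma> x + \<sigma> y" and Gal_times: "\<sigma> (x * y) = \<sigma> x * \<sigma> y"
  and Gal_1: "\<sigma> 1 = 1" and Gal_bij: "bij \<sigma>"
  using \<sigma> by (auto simp: Gal_iff)

lemma Gal_apply_inv: "\<sigma> (inv_into UNIV \<sigma> x) = x" and Gal_inv_apply: "inv_into UNIV \<sigma> (\<sigma> x) = x"
  using Gal_bij by (simp_all add: bij_is_inj bij_is_surj surj_f_inv_f)

lemma Gal_0: "\<sigma> 0 = 0"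
  using Gal_add[of 0 0] by simp

lemma Gal_uminus: "\<sigma> (- x) = - \<sigma> x"
  using Gal_add[of x "- x"] Gal_0 by (simp add: minus_unique)

lemma Gal_diff: "\<sigma> (x - y) = \<sigma> x - \<sigma> y"
  using Gal_add[of x "- y"] Gal_uminus by simp

lemma Gal_power: "\<sigma> (x ^ n) = \<sigma> x ^ n"
  by (induction n) (simp_all add: Gal_1 Gal_times)

lemma Gal_of_nat: "\<sigma> (of_nat n) = of_nat n"
  by (induction n) (simp_all add: Gal_0 Gal_1 Gal_add)

lemma Gal_of_int: "\<sigma> (of_int n) = of_int n"
  by (cases n rule: int_cases2) (simp_all add: Gal_of_nat Gal_uminus)

lemma Gal_eq_0_iff: "\<sigma> x = 0 \<longleftrightarrow> x = 0"
  using Gal_bij Gal_0 by (metis bij_pointE)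

lemma Gal_divide: "\<sigma> (x / y) = \<sigma> x / \<sigma> y"
proof (cases "y = 0")
  case False
  then have "\<sigma> (x / y) * \<sigma> y = \<sigma> x" by (simp flip: Gal_times)
  then show ?thesis using False Gal_eq_0_iff by (simp add: field_simps)
qed (simp add: Gal_0)

lemma Gal_Rats: "x \<in> \<rat> \<Longrightarrow> \<sigma> x = x"
  by (auto elim!: Rats_cases' simp: Gal_divide Gal_of_int)

lemma Gal_sum: "\<sigma> (sum f A) = (\<Sum>i\<in>A. \<sigma> (f i))"
  by (induction A rule: infinite_finite_induct) (simp_all add: Gal_0 Gal_add)

lemma Gal_prod: "\<sigma> (prod f A) = (\<Prod>i\<in>A. \<sigma> (f i))"
  by (induction A rule: infinite_finite_induct) (simp_all add: Gal_1 Gal_times)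

lemma Gal_poly: "\<sigma> (poly q x) = poly (map_poly \<sigma> q) (\<sigma> x)"
  by (induction q) (simp_all add: map_poly_pCons Gal_0 Gal_add Gal_times)

lemma Gal_map_poly_mult: "map_poly \<sigma> (q * r) = map_poly \<sigma> q * map_poly \<sigma> r"
  by (rule poly_eqI) (simp add: coeff_map_poly Gal_0 coeff_mult Gal_sum Gal_times)

lemma Gal_map_poly_1: "map_poly \<sigma> 1 = 1"
  by (rule poly_eqI) (simp add: coeff_map_poly Gal_0 Gal_1)

lemma Gal_map_poly_prod: "map_poly \<sigma> (prod f A) = (\<Prod>i\<in>A. map_poly \<sigma> (f i))"
  by (induction A rule: infinite_finite_induct)
     (simp_all add: Gal_map_poly_1 Gal_map_poly_mult)

lemma Gal_map_poly_linear: "map_poly \<sigma> [:- a, 1:] = [:- \<sigma> a, 1:]"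
  by (simp add: map_poly_pCons Gal_0 Gal_1 Gal_uminus)

lemma Gal_algebraic_int: "algebraic_int x \<Longrightarrow> algebraic_int (\<sigma> x)"
proof (elim algebraic_int.cases)
  fix q y
  assume x: "x = y" and q: "lead_coeff q = 1" "\<forall>i. poly.coeff q i \<in> \<int>" "poly q y = 0"
  have "map_poly \<sigma> q = q"
    using q(2) by (intro poly_eqI) (auto simp: coeff_map_poly Gal_0 intro!: Gal_Rats subsetD[OF Ints_subset_Rats])
  then have "poly q (\<sigma> x) = 0" using Gal_poly[of q x] q(3) x Gal_0 by simp
  then show "algebraic_int (\<sigma> x)" using q by (intro algebraic_int.intros)
qed

end

text \<open>The polynomial \<open>\<Prod>\<^sub>\<sigma> (X - \<sigma> x)\<close> turns invariance under a group into a
  relation with invariant coefficients; almost every argument below runs through it.\<close>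

definition orbit_poly :: "('a::field_char_0 \<Rightarrow> 'a) set \<Rightarrow> 'a \<Rightarrow> 'a poly" where
  "orbit_poly H x = (\<Prod>\<sigma>\<in>H. [:- \<sigma> x, 1:])"

lemma poly_orbit_poly: "poly (orbit_poly H x) y = (\<Prod>\<sigma>\<in>H. y - \<sigma> x)"
  by (simp add: orbit_poly_def poly_prod)

lemma subgroup_comp_image:
  assumes "subgroup H (Gal L)" "\<tau> \<in> H"
  shows "(\<lambda>\<sigma>. \<tau> \<circ> \<sigma>) ` H = H" "inj_on (\<lambda>\<sigma>. \<tau> \<circ> \<sigma>) H"
proof -
  interpret H: subgroup H "Gal L" by fact
  interpret G: group "Gal L" by simp
  have inv: "inv_into UNIV \<tau> \<in> H" "bij \<tau>" and c: "\<And>f g. f \<in> H \<Longrightarrow> g \<in> H \<Longrightarrow> f \<circ> g \<in> H"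
    using assms(2) H.m_inv_closed[OF assms(2)] H.subset H.m_closed Gal_bij[of \<tau> L]
    by (auto simp: Gal_inv subset_iff Gal_mult[of _ L])
  have "\<tau> \<circ> (inv_into UNIV \<tau> \<circ> \<sigma>) = \<sigma>" "inv_into UNIV \<tau> \<circ> (\<tau> \<circ> \<sigma>) = \<sigma>" for \<sigma>
    using inv(2) by (auto simp: fun_eq_iff bij_is_inj bij_is_surj surj_f_inv_f)
  note e = this
  show "(\<lambda>\<sigma>. \<tau> \<circ> \<sigma>) ` H = H"
  proof
    show "H \<subseteq> (\<lambda>\<sigma>. \<tau> \<circ> \<sigma>) ` H"
    proof
      fix \<sigma> assume "\<sigma> \<in> H"
      then have "inv_into UNIV \<tau> \<circ> \<sigma> \<in> H" using c inv by blast
      then show "\<sigma> \<in> (\<lambda>\<sigma>. \<tau> \<circ> \<sigma>) ` H" using e(1)[of \<sigma>] by (metis imageI)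
    qed
  qed (use c assms(2) in auto)
  show "inj_on (\<lambda>\<sigma>. \<tau> \<circ> \<sigma>) H"
    by (rule inj_on_inverseI[where g = "\<lambda>\<sigma>. inv_into UNIV \<tau> \<circ> \<sigma>"]) (use e(2) in auto)
qed

lemma map_orbit_poly:
  assumes "subgroup H (Gal L)" "\<tau> \<in> H"
  shows "map_poly \<tau> (orbit_poly H x) = orbit_poly H x"
proof -
  interpret H: subgroup H "Gal L" by fact
  have \<tau>: "\<tau> \<in> carrier (Gal L)" using assms(2) H.subset by auto
  have "map_poly \<tau> (orbit_poly H x) = (\<Prod>\<sigma>\<in>H. [:- (\<tau> \<circ> \<sigma>) x, 1:])"
    by (simp add: orbit_poly_def Gal_map_poly_prod[OF \<tau>] Gal_map_poly_linear[OF \<tau>])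
  also have "\<dots> = (\<Prod>\<sigma>\<in>(\<lambda>\<sigma>. \<tau> \<circ> \<sigma>) ` H. [:- \<sigma> x, 1:])"
    by (simp add: prod.reindex[OF subgroup_comp_image(2)[OF assms]])
  finally show ?thesis by (simp add: subgroup_comp_image(1)[OF assms] orbit_poly_def)
qed

lemma coeff_orbit_poly_fixed:
  assumes "subgroup H (Gal L)" "\<tau> \<in> H"
  shows "\<tau> (poly.coeff (orbit_poly H x) i) = poly.coeff (orbit_poly H x) i"
proof -
  interpret H: subgroup H "Gal L" by fact
  have \<tau>: "\<tau> \<in> carrier (Gal L)" using assms(2) H.subset by auto
  show ?thesis
    using arg_cong[OF map_orbit_poly[OF assms, of x], of "\<lambda>q. poly.coeff q i"]
    by (simp add: coeff_map_poly Gal_0[OF \<tau>])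
qed

section \<open>Rational linear relations\<close>

interpretation ratspace: vector_space "\<lambda>(q::rat) (x::'a::field_char_0). of_rat q * x"
  by unfold_locales (simp_all add: algebra_simps of_rat_add of_rat_mult)

lemma finite_dimension_spanning_set:
  assumes "ring.finite_dimension (ring_of_type_algebra :: 'a::field_char_0 ring) \<rat> UNIV"
  obtains B :: "'a::field_char_0 set" where "finite B" "ratspace.span B = UNIV"
proof -
  interpret R: ring "ring_of_type_algebra :: 'a ring" by (rule ring_from_type_algebra)
  obtain n where "R.dimension n \<rat> UNIV" using assms unfolding R.finite_dimension_def by blast
  moreover have "\<exists>B. finite B \<and> E \<subseteq> ratspace.span B" if "R.dimension n \<rat> E" for n E
    using that
  proof (induction n "\<rat> :: 'a set" E rule: R.dimension.induct)
    case zero_dim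
    show ?case by (intro exI[of _ "{}"]) (auto simp: ratspace.span_zero)
  next
    case (Suc_dim v E n)
    then obtain B where B: "finite B" "E \<subseteq> ratspace.span B" by blast
    have "R.line_extension \<rat> v E \<subseteq> ratspace.span (insert v B)"
    proof
      fix x assume "x \<in> R.line_extension \<rat> v E"
      then obtain k e where x: "x = k * v + e" "k \<in> \<rat>" "e \<in> E"
        by (auto simp: R.line_extension_mem_iff)
      obtain q where "k = of_rat q" using x(2) by (auto elim: Rats_cases)
      moreover have "e \<in> ratspace.span (insert v B)"
        using x(3) B(2) ratspace.span_mono[of B "insert v B"] by auto
      ultimately show "x \<in> ratspace.span (insert v B)"
        using x(1) ratspace.span_add ratspace.span_scale ratspace.span_base insertI1 by metis
    qed
    then show ?case using B(1) by (intro exI[of _ "insert v B"] conjI) simp_all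
  qed
  ultimately show ?thesis using that by blast
qed

text \<open>A relation between more vectors than the dimension can be cleared of denominators and then
  divided by the greatest common divisor of its coefficients, which makes it non-trivial modulo \<open>p\<close>.\<close>

lemma integer_relation:
  fixes B :: "'a::field_char_0 set"
  assumes "finite B" "ratspace.span B = UNIV"
    and "p > 1" and "card B < d"
  obtains a :: "nat \<Rightarrow> int" where "(\<Sum>i<d. of_int (a i) * f i) = (0 :: 'a)" "\<exists>i<d. \<not> int p dvd a i"
proof -
  have "\<exists>r::nat \<Rightarrow> rat. (\<Sum>i<d. of_rat (r i) * f i) = 0 \<and> (\<exists>i<d. r i \<noteq> 0)"
  proof (cases "inj_on f {..<d}")
    case True
    have "ratspace.dependent (f ` {..<d})"
    proof (rule ccontr)
      assume "\<not> ?thesis"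
      from ratspace.independent_span_bound[OF assms(1) this] assms(2)
      have "card (f ` {..<d}) \<le> card B" by auto
      then show False using card_image[OF True] assms(4) by simp
    qed
    then obtain u where u: "\<exists>v\<in>f ` {..<d}. u v \<noteq> 0" "(\<Sum>v\<in>f ` {..<d}. of_rat (u v) * v) = 0"
      by (auto simp: ratspace.dependent_finite)
    show ?thesis
      by (intro exI[of _ "\<lambda>i. u (f i)"]) (use u True in \<open>auto simp: sum.reindex\<close>)
  next
    case False
    then obtain i j where ij: "i < d" "j < d" "i \<noteq> j" "f i = f j" by (auto simp: inj_on_def)
    define r where "r = (\<lambda>k. if k = i then 1 else if k = j then - 1 else 0 :: rat)"
    have "(\<Sum>k<d. of_rat (r k) * f k) = (\<Sum>k\<in>{i, j}. of_rat (r k) * f k)"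
      by (rule sum.mono_neutral_right) (use ij in \<open>auto simp: r_def\<close>)
    also have "\<dots> = 0" using ij by (simp add: r_def of_rat_minus)
    finally show ?thesis using ij by (intro exI[of _ r]) (auto simp: r_def)
  qed
  then obtain r :: "nat \<Rightarrow> rat" where r: "(\<Sum>i<d. of_rat (r i) * f i) = 0" "\<exists>i<d. r i \<noteq> 0" by blast
  define D where "D = (\<Prod>i<d. snd (quotient_of (r i)))"
  have D: "\<exists>b. of_int D * r i = of_int b" if "i < d" for i
  proof -
    obtain x y where xy: "quotient_of (r i) = (x, y)" by fastforce
    then have y: "y > 0" "r i = of_int x / of_int y"
      using quotient_of_denom_pos quotient_of_div by auto
    have "D = y * (\<Prod>k\<in>{..<d} - {i}. snd (quotient_of (r k)))"
      unfolding D_def using that xy by (subst prod.remove[of _ i]) auto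
    then show ?thesis using y by (intro exI[of _ "x * (\<Prod>k\<in>{..<d} - {i}. snd (quotient_of (r k)))"])
      (simp add: field_simps)
  qed
  then obtain b where b: "\<And>i. i < d \<Longrightarrow> of_int D * r i = of_int (b i)" by metis
  have D0: "D \<noteq> 0" using quotient_of_denom_pos'[of "r _"] by (auto simp: D_def less_le)
  have rel: "(\<Sum>i<d. of_int (b i) * f i) = 0"
  proof -
    have "(\<Sum>i<d. of_int (b i) * f i) = (\<Sum>i<d. of_rat (of_int D * r i) * f i)"
      by (intro sum.cong) (simp_all add: b)
    also have "\<dots> = of_int D * (\<Sum>i<d. of_rat (r i) * f i)"
      by (simp add: sum_distrib_left of_rat_mult mult.assoc)
    finally show ?thesis using r(1) by simp
  qed
  obtain i0 where i0: "i0 < d" "b i0 \<noteq> 0" using r(2) b D0 by (metis mult_eq_0_iff of_int_0 of_int_0_eq_iff)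
  define h where "h = Gcd (b ` {..<d})"
  have h: "h dvd b i" if "i < d" for i unfolding h_def using that by (intro Gcd_dvd) auto
  have h0: "h \<noteq> 0" using h[OF i0(1)] i0(2) by auto
  show ?thesis
  proof (rule that)
    have "of_int h * (\<Sum>i<d. of_int (b i div h) * f i) = (\<Sum>i<d. of_int (b i) * f i)"
      unfolding sum_distrib_left
    proof (rule sum.cong)
      fix i assume "i \<in> {..<d}"
      then have "of_int (b i) = of_int h * (of_int (b i div h) :: 'a)"
        using h[of i] by (metis dvd_mult_div_cancel lessThan_iff of_int_mult)
      then show "of_int h * (of_int (b i div h) * f i) = of_int (b i) * f i" by (simp add: mult.assoc)
    qed simp
    then show "(\<Sum>i<d. of_int (b i div h) * f i) = 0" using rel h0 by simp
    show "\<exists>i<d. \<not> int p dvd b i div h"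
    proof (rule ccontr)
      assume "\<not> ?thesis"
      then have "h * int p dvd b i" if "i < d" for i
        using that h[OF that] by (metis dvd_mult_div_cancel mult_dvd_mono dvd_refl)
      then have "h * int p dvd Gcd (b ` {..<d})" by (intro Gcd_greatest) auto
      then have "h * int p dvd h * 1" unfolding h_def[symmetric] by simp
      then have "int p dvd 1" using h0 by (metis dvd_mult_cancel_left)
      then show False using assms(3) by simp
    qed
  qed
qed

lemma algebraic_of_spanning_set:
  fixes B :: "'a::field_char_0 set"
  assumes "finite B" "ratspace.span B = UNIV"
  shows "\<exists>q::'a poly. q \<noteq> 0 \<and> (\<forall>i. poly.coeff q i \<in> \<int>) \<and> poly q x = 0"
proof -
  have two: "(2::nat) > 1" by simp
  obtain a where a: "(\<Sum>i<Suc (card B). of_int (a i) * x ^ i) = 0"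
      "\<exists>i<Suc (card B). \<not> int 2 dvd a i"
    using integer_relation[OF assms two lessI, of "\<lambda>i. x ^ i"] by blast
  define q :: "'a poly" where "q = (\<Sum>i<Suc (card B). Polynomial.monom (of_int (a i)) i)"
  have c: "poly.coeff q i = (if i < Suc (card B) then of_int (a i) else 0)" for i
    by (auto simp: q_def coeff_sum simp del: sum.lessThan_Suc)
  obtain i where "i < Suc (card B)" "a i \<noteq> 0" using a(2) by (metis dvd_0_right)
  then have "poly.coeff q i \<noteq> 0" by (simp add: c)
  then have "q \<noteq> 0" by auto
  moreover have "poly q x = 0" using a(1) by (simp add: q_def poly_sum poly_monom del: sum.lessThan_Suc)
  ultimately show ?thesis using c by (intro exI[of _ q]) auto
qed

text \<open>An automorphism is determined by its values on a spanning set, and these values are roots of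
  fixed polynomials.\<close>

lemma finite_Gal:
  fixes B L :: "'a::field_char_0 set"
  assumes "finite B" "ratspace.span B = UNIV"
  shows "finite (carrier (Gal L))"
proof -
  have "\<forall>x. \<exists>q::'a poly. q \<noteq> 0 \<and> (\<forall>i. poly.coeff q i \<in> \<int>) \<and> poly q x = 0"
    using algebraic_of_spanning_set[OF assms] by blast
  from choice[OF this] obtain q :: "'a \<Rightarrow> 'a poly"
    where q: "\<And>x. q x \<noteq> 0" "\<And>x i. poly.coeff (q x) i \<in> \<int>" "\<And>x. poly (q x) x = 0"
    by blast
  let ?r = "\<lambda>\<sigma>. restrict \<sigma> B"
  have "inj_on ?r (carrier (Gal L))"
  proof (rule inj_onI)
    fix \<sigma> \<tau> :: "'a \<Rightarrow> 'a" assume \<sigma>: "\<sigma> \<in> carrier (Gal L)" and \<tau>: "\<tau> \<in> carrier (Gal L)"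
      and eq: "?r \<sigma> = ?r \<tau>"
    show "\<sigma> = \<tau>"
    proof
      fix x
      have "x \<in> ratspace.span B" using assms(2) by simp
      then show "\<sigma> x = \<tau> x"
      proof (induction rule: ratspace.span_induct_alt)
        case (step c x y)
        then show ?case using fun_cong[OF eq, of x]
          by (simp add: Gal_add[OF \<sigma>] Gal_add[OF \<tau>] Gal_times[OF \<sigma>] Gal_times[OF \<tau>]
               Gal_Rats[OF \<sigma>] Gal_Rats[OF \<tau>])
      qed (simp add: Gal_0[OF \<sigma>] Gal_0[OF \<tau>])
    qed
  qed
  moreover have "?r ` carrier (Gal L) \<subseteq> (\<Pi>\<^sub>E b\<in>B. {y. poly (q b) y = 0})"
  proof -
    have "poly (q b) (\<sigma> b) = 0" if \<sigma>: "\<sigma> \<in> carrier (Gal L)" for \<sigma> b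
    proof -
      have "map_poly \<sigma> (q b) = q b"
        using q(2) by (intro poly_eqI)
          (auto simp: coeff_map_poly Gal_0[OF \<sigma>] intro!: Gal_Rats[OF \<sigma>] subsetD[OF Ints_subset_Rats])
      then show ?thesis using Gal_poly[OF \<sigma>, of "q b" b] q(3) Gal_0[OF \<sigma>] by simp
    qed
    then show ?thesis by auto
  qed
  moreover have "finite (\<Pi>\<^sub>E b\<in>B. {y. poly (q b) y = 0})"
    using assms(1) q(1) by (intro finite_PiE) (auto intro: poly_roots_finite)
  ultimately show ?thesis using finite_subset finite_imageD by metis
qed

section \<open>The Galois correspondence\<close>

lemma subfield_closed:
  fixes F :: "'a::field_char_0 set"
  assumes "subfield F ring_of_type_algebra"
  shows subfield_add: "x \<in> F \<Longrightarrow> y \<in> F \<Longrightarrow> x + y \<in> F"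
    and subfield_mult: "x \<in> F \<Longrightarrow> y \<in> F \<Longrightarrow> x * y \<in> F"
    and subfield_uminus: "x \<in> F \<Longrightarrow> - x \<in> F"
    and subfield_0: "0 \<in> F" and subfield_1: "1 \<in> F"
    and subfield_inverse: "x \<in> F \<Longrightarrow> inverse x \<in> F"
proof -
  interpret K: Ring.field "ring_of_type_algebra :: 'a ring" by (rule field_from_type_algebra)
  have sr: "subring F (ring_of_type_algebra :: 'a ring)"
    using subfieldE(1)[OF assms] subcring.axioms(1) by blast
  note s = subringE[OF sr, simplified]
  show "x \<in> F \<Longrightarrow> y \<in> F \<Longrightarrow> x + y \<in> F" for x y using s by auto
  show "x \<in> F \<Longrightarrow> y \<in> F \<Longrightarrow> x * y \<in> F" for x y using s by auto
  show "0 \<in> F" "1 \<in> F" using s by auto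
  have "\<ominus>\<^bsub>ring_of_type_algebra\<^esub> x = - x" for x :: 'a
    by (rule K.minus_equality) auto
  then show "x \<in> F \<Longrightarrow> - x \<in> F" for x using s by auto
  show "x \<in> F \<Longrightarrow> inverse x \<in> F" for x
  proof (cases "x = 0")
    case False
    assume "x \<in> F"
    have "inv\<^bsub>ring_of_type_algebra\<^esub> x = inverse x"
      using False by (intro K.inv_char) auto
    then show ?thesis using K.subfield_m_inv(1)[OF assms, of x] False \<open>x \<in> F\<close> by auto
  qed auto
qed

context
  fixes F :: "'a::field_char_0 set"
  assumes F: "subfield F ring_of_type_algebra"
begin

lemma subfield_power: "x \<in> F \<Longrightarrow> x ^ n \<in> F"
  by (induction n) (auto intro: subfield_closed[OF F])

lemma subfield_sum: "(\<And>i. i \<in> A \<Longrightarrow> f i \<in> F) \<Longrightarrow> sum f A \<in> F"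
  by (induction A rule: infinite_finite_induct) (auto intro: subfield_closed[OF F])

lemma subfield_prod: "(\<And>i. i \<in> A \<Longrightarrow> f i \<in> F) \<Longrightarrow> prod f A \<in> F"
  by (induction A rule: infinite_finite_induct) (auto intro: subfield_closed[OF F])

lemma subfield_diff: "x \<in> F \<Longrightarrow> y \<in> F \<Longrightarrow> x - y \<in> F"
  using subfield_add[OF F, of x "- y"] subfield_uminus[OF F, of y] by simp

lemma subfield_of_nat: "of_nat n \<in> F"
  by (induction n) (auto intro: subfield_closed[OF F])

lemma subfield_of_int: "of_int n \<in> F"
  by (cases n rule: int_cases2) (auto intro: subfield_of_nat subfield_uminus[OF F])

lemma subfield_divide: "x \<in> F \<Longrightarrow> y \<in> F \<Longrightarrow> x / y \<in> F"
  by (simp add: divide_inverse subfield_mult[OF F] subfield_inverse[OF F])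

lemma Rats_subset_subfield: "\<rat> \<subseteq> F"
  by (auto elim!: Rats_cases' intro!: subfield_divide subfield_of_int)

end

lemma UNIV_subfield: "subfield (UNIV :: 'a::field_char_0 set) ring_of_type_algebra"
proof -
  interpret K: Ring.field "ring_of_type_algebra :: 'a ring" by (rule field_from_type_algebra)
  show ?thesis using K.carrier_is_subfield by simp
qed

lemma finite_galois_extensionD:
  assumes "finite_galois_extension (ring_of_type_algebra :: 'a::field_char_0 ring) \<rat>"
  shows "\<exists>B::'a set. finite B \<and> ratspace.span B = UNIV"
    and "finite (carrier (Gal (L :: 'a set)))"
    and "(\<And>\<sigma>. \<sigma> \<in> carrier (Gal \<rat>) \<Longrightarrow> \<sigma> x = x) \<Longrightarrow> (x :: 'a) \<in> \<rat>"
proof -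
  have fd: "ring.finite_dimension (ring_of_type_algebra :: 'a ring) \<rat> UNIV"
    and fixed: "{x :: 'a. \<forall>\<sigma>\<in>carrier (Gal \<rat>). \<sigma> x = x} = \<rat>"
    using assms by (auto simp: finite_galois_extension_def)
  obtain B :: "'a set" where "finite B" "ratspace.span B = UNIV"
    using finite_dimension_spanning_set[OF fd] .
  then show "\<exists>B::'a set. finite B \<and> ratspace.span B = UNIV" "finite (carrier (Gal L))"
    using finite_Gal by auto
  show "x \<in> \<rat>" if "\<And>\<sigma>. \<sigma> \<in> carrier (Gal \<rat>) \<Longrightarrow> \<sigma> x = x"
    using fixed that by blast
qed

text \<open>An element of \<open>F\<close> with the smallest stabilizer is stabilized by \<open>Gal F\<close> only: if \<open>\<sigma>\<close> fixes
  \<open>y\<close> but moves \<open>z\<close>, then all but finitely many of the elements \<open>y + n z\<close> have a smaller stabilizer.\<close>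

lemma exists_element_with_stabilizer_Gal:
  fixes F :: "'a::field_char_0 set"
  assumes gal: "finite_galois_extension (ring_of_type_algebra :: 'a ring) \<rat>"
    and F: "subfield F ring_of_type_algebra"
  obtains y where "y \<in> F" "\<And>\<sigma>. \<sigma> \<in> carrier (Gal \<rat>) \<Longrightarrow> \<sigma> y = y \<Longrightarrow> \<sigma> \<in> carrier (Gal F)"
proof -
  let ?G = "carrier (Gal \<rat>) :: ('a \<Rightarrow> 'a) set"
  define stab where "stab = (\<lambda>y. {\<sigma> \<in> ?G. \<sigma> y = y})"
  have finG: "finite ?G" by (rule finite_galois_extensionD(2)[OF gal])
  obtain y where y: "y \<in> F" and min: "\<And>y'. y' \<in> F \<Longrightarrow> card (stab y) \<le> card (stab y')"
    using ex_has_least_nat[of "\<lambda>y. y \<in> F" 0 "\<lambda>y. card (stab y)"] subfield_0[OF F] by blast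
  show ?thesis
  proof (rule that[OF y], rule ccontr)
    fix \<sigma> assume \<sigma>: "\<sigma> \<in> ?G" "\<sigma> y = y" "\<sigma> \<notin> carrier (Gal F)"
    then obtain z where z: "z \<in> F" "\<sigma> z \<noteq> z" by (auto simp: Gal_iff)
    have "finite {n. of_nat n * (\<tau> z - z) = y - \<tau> y \<and> \<tau> z \<noteq> z}" for \<tau> :: "'a \<Rightarrow> 'a"
    proof (rule finite_subset)
      show "{n. of_nat n * (\<tau> z - z) = y - \<tau> y \<and> \<tau> z \<noteq> z}
          \<subseteq> {n. of_nat n = (y - \<tau> y) / (\<tau> z - z)}" by (auto simp: field_simps)
      show "finite {n. of_nat n = (y - \<tau> y) / (\<tau> z - z)}"
        using finite_vimageI[OF _ inj_of_nat, of "{(y - \<tau> y) / (\<tau> z - z)}"] by (simp add: vimage_def)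
    qed
    then have "finite (\<Union>\<tau>\<in>?G. {n. of_nat n * (\<tau> z - z) = y - \<tau> y \<and> \<tau> z \<noteq> z})"
      using finG by blast
    from ex_new_if_finite[OF infinite_UNIV_nat this] obtain n
      where n: "\<And>\<tau>. \<tau> \<in> ?G \<Longrightarrow> of_nat n * (\<tau> z - z) = y - \<tau> y \<Longrightarrow> \<tau> z = z" by auto
    let ?y = "y + of_nat n * z"
    have im: "\<tau> z = z \<and> \<tau> y = y" if "\<tau> \<in> stab ?y" for \<tau>
    proof -
      have \<tau>: "\<tau> \<in> ?G" and e: "\<tau> y + of_nat n * \<tau> z = y + of_nat n * z"
        using that by (auto simp: stab_def Gal_add Gal_times Gal_of_nat)
      have "of_nat n * (\<tau> z - z) = (\<tau> y + of_nat n * \<tau> z) - \<tau> y - of_nat n * z"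
        by (simp add: algebra_simps)
      also have "\<dots> = y - \<tau> y" unfolding e by simp
      finally have "\<tau> z = z" using n \<tau> by blast
      then show ?thesis using e by simp
    qed
    then have "stab ?y \<subset> stab y" using \<sigma> z by (auto simp: stab_def)
    then have "card (stab ?y) < card (stab y)"
      using finG by (intro psubset_card_mono) (auto simp: stab_def)
    moreover have "?y \<in> F" using y z by (intro subfield_closed[OF F] subfield_of_nat[OF F])
    ultimately show False using min by (meson leD)
  qed
qed

text \<open>For \<open>y\<close> as above and \<open>x\<close> fixed by \<open>Gal F\<close>, the polynomial of least degree that sends every
  conjugate \<open>\<sigma> y\<close> to \<open>\<sigma> x\<close> is unique, hence invariant and so rational; its value at \<open>y\<close> is \<open>x\<close>.\<close>

theorem fixed_by_Gal_imp_mem: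
  fixes F :: "'a::field_char_0 set"
  assumes gal: "finite_galois_extension (ring_of_type_algebra :: 'a ring) \<rat>"
    and F: "subfield F ring_of_type_algebra"
    and x: "\<And>\<sigma>. \<sigma> \<in> carrier (Gal F) \<Longrightarrow> \<sigma> x = x"
  shows "x \<in> F"
proof -
  let ?G = "carrier (Gal \<rat>) :: ('a \<Rightarrow> 'a) set"
  obtain y where y: "y \<in> F" "\<And>\<sigma>. \<sigma> \<in> ?G \<Longrightarrow> \<sigma> y = y \<Longrightarrow> \<sigma> \<in> carrier (Gal F)"
    using exists_element_with_stabilizer_Gal[OF gal F] by metis
  define Y where "Y = (\<lambda>\<sigma>. \<sigma> y) ` ?G"
  have finY: "finite Y" unfolding Y_def by (intro finite_imageI finite_galois_extensionD(2)[OF gal])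
  define v where "v = (\<lambda>w. (SOME \<sigma>. \<sigma> \<in> ?G \<and> \<sigma> y = w) x)"
  have v: "v (\<sigma> y) = \<sigma> x" if \<sigma>: "\<sigma> \<in> ?G" for \<sigma>
  proof -
    define \<tau> where "\<tau> = (SOME \<tau>. \<tau> \<in> ?G \<and> \<tau> y = \<sigma> y)"
    have \<tau>: "\<tau> \<in> ?G \<and> \<tau> y = \<sigma> y" unfolding \<tau>_def by (rule someI[of _ \<sigma>]) (use \<sigma> in auto)
    have "inv_into UNIV \<sigma> \<circ> \<tau> \<in> ?G" using \<sigma> \<tau> Gal_comp Gal_inv_closed by blast
    moreover have "(inv_into UNIV \<sigma> \<circ> \<tau>) y = y"
      using \<tau> Gal_bij[OF \<sigma>] by (simp add: bij_is_inj)
    ultimately have "inv_into UNIV \<sigma> (\<tau> x) = x" using x y(2) by fastforce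
    then have "\<tau> x = \<sigma> x" using Gal_bij[OF \<sigma>] by (metis bij_inv_eq_iff)
    then show ?thesis by (simp add: v_def \<tau>_def)
  qed
  define h where "h = (\<Sum>w\<in>Y. Polynomial.smult (v w / (\<Prod>u\<in>Y - {w}. w - u)) (\<Prod>u\<in>Y - {w}. [:- u, 1:]))"
  have hw: "poly h w = v w" if w: "w \<in> Y" for w
  proof -
    have "poly h w = (\<Sum>w'\<in>Y. v w' / (\<Prod>u\<in>Y - {w'}. w' - u) * (\<Prod>u\<in>Y - {w'}. w - u))"
      by (simp add: h_def poly_sum poly_prod)
    also have "\<dots> = (\<Sum>w'\<in>{w}. v w' / (\<Prod>u\<in>Y - {w'}. w' - u) * (\<Prod>u\<in>Y - {w'}. w - u))"
      using finY w by (intro sum.mono_neutral_right) auto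
    also have "\<dots> = v w" using finY by simp
    finally show ?thesis .
  qed
  have "card Y > 0" using finY Gal_one group.is_monoid[OF group_Gal, THEN monoid.one_closed]
    by (auto simp: card_gt_0_iff Y_def)
  have deg: "Polynomial.degree h < card Y"
    unfolding h_def
  proof (rule degree_sum_less[OF _ \<open>card Y > 0\<close>])
    fix w assume w: "w \<in> Y"
    have "Polynomial.degree (\<Prod>u\<in>Y - {w}. [:- u, 1:]) \<le> (\<Sum>u\<in>Y - {w}. 1)"
      using degree_prod_sum_le[of "Y - {w}" "\<lambda>u. [:- u, 1:]"] finY by simp
    also have "\<dots> < card Y" using w finY \<open>card Y > 0\<close> by simp
    finally show "Polynomial.degree (Polynomial.smult (v w / (\<Prod>u\<in>Y - {w}. w - u)) (\<Prod>u\<in>Y - {w}. [:- u, 1:])) < card Y"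
      using degree_smult_le le_less_trans by blast
  qed
  have "poly.coeff h i \<in> \<rat>" for i
  proof (rule finite_galois_extensionD(3)[OF gal])
    fix \<tau> assume \<tau>: "\<tau> \<in> ?G"
    have "map_poly \<tau> h = h"
    proof (rule poly_eqI_degree)
      fix w assume "w \<in> Y"
      then obtain \<sigma> where \<sigma>: "\<sigma> \<in> ?G" "w = \<sigma> y" by (auto simp: Y_def)
      let ?\<rho> = "inv_into UNIV \<tau> \<circ> \<sigma>"
      have \<rho>: "?\<rho> \<in> ?G" using \<sigma> \<tau> Gal_comp Gal_inv_closed by blast
      have e: "\<tau> (?\<rho> t) = \<sigma> t" for t by (simp add: Gal_apply_inv[OF \<tau>])
      have "poly (map_poly \<tau> h) w = \<tau> (poly h (?\<rho> y))"
        using Gal_poly[OF \<tau>, of h "?\<rho> y"] e[of y] \<sigma>(2) by simp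
      also have "\<dots> = \<tau> (?\<rho> x)" using hw[of "?\<rho> y"] v[OF \<rho>] imageI[OF \<rho>, of "\<lambda>\<sigma>. \<sigma> y"]
        by (simp add: Y_def)
      also have "\<dots> = poly h w" using e[of x] v[OF \<sigma>(1)] hw[OF \<open>w \<in> Y\<close>] \<sigma>(2) by simp
      finally show "poly (map_poly \<tau> h) w = poly h w" .
    qed (use deg map_poly_degree_leq[of \<tau> h] Gal_0[OF \<tau>] in auto)
    then show "\<tau> (poly.coeff h i) = poly.coeff h i"
      using coeff_map_poly[of \<tau> h i] Gal_0[OF \<tau>] by simp
  qed
  then have "poly h y \<in> F"
    unfolding poly_altdef using y(1) Rats_subset_subfield[OF F]
    by (intro subfield_sum[OF F] subfield_mult[OF F] subfield_power[OF F]) auto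
  moreover have "poly h y = x"
  proof -
    have id: "id \<in> ?G" by (simp add: Gal_iff)
    have "y \<in> Y" using imageI[OF id, of "\<lambda>\<sigma>. \<sigma> y"] by (simp add: Y_def)
    then show ?thesis using hw[of y] v[OF id] by simp
  qed
  ultimately show ?thesis by simp
qed

section \<open>A place of a Galois number field\<close>

lemma ring_of_integers_simps [simp]:
  "carrier (ring_of_integers E) = {x \<in> E. algebraic_int x}"
  "monoid.mult (ring_of_integers E) = (*)"
  "monoid.one (ring_of_integers E) = 1"
  "ring.zero (ring_of_integers E) = 0"
  "ring.add (ring_of_integers E) = (+)"
  by (simp_all add: ring_of_integers_def)

text \<open>The integers of the field are the \<open>x\<close> with \<^term>\<open>algebraic_int x\<close>. They are closed under sums and products
  because \<open>P\<close> is an ideal of a commutative ring formed by them. That \<open>p\<close> divides the integer \<open>x\<close> is expressed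
  by \<open>algebraic_int (x / of_nat p)\<close>.\<close>

locale galois_place =
  fixes p :: nat and P :: "'a::field_char_0 set"
  assumes galois: "finite_galois_extension (ring_of_type_algebra :: 'a ring) \<rat>"
    and prime_p: "Factorial_Ring.prime p"
    and place: "P \<in> places_above UNIV p"
begin

abbreviation G :: "('a \<Rightarrow> 'a) set" where "G \<equiv> carrier (Gal \<rat>)"

abbreviation cong_P :: "'a \<Rightarrow> 'a \<Rightarrow> bool" (infix \<open>\<doteq>\<close> 50) where "x \<doteq> y \<equiv> x - y \<in> P"

lemma p_pos: "p > 0" and p_gt_1: "p > 1"
  using prime_p prime_gt_0_nat prime_gt_1_nat by auto

lemma finite_G: "finite (carrier (Gal (L :: 'a set)))"
  by (rule finite_galois_extensionD(2)[OF galois])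

lemma primeideal_P: "primeideal P (ring_of_integers UNIV)" and p_in_P: "of_nat p \<in> P"
  using place by (auto simp: places_above_def)

lemma alg_add: "algebraic_int x \<Longrightarrow> algebraic_int y \<Longrightarrow> algebraic_int (x + y)"
  and alg_mult: "algebraic_int x \<Longrightarrow> algebraic_int y \<Longrightarrow> algebraic_int (x * y)"
  for x y :: 'a
proof -
  interpret I: primeideal P "ring_of_integers UNIV" by (rule primeideal_P)
  show "algebraic_int x \<Longrightarrow> algebraic_int y \<Longrightarrow> algebraic_int (x + y)"
    using I.a_closed[of x y] by simp
  show "algebraic_int x \<Longrightarrow> algebraic_int y \<Longrightarrow> algebraic_int (x * y)"
    using I.m_closed[of x y] by simp
qed

lemma alg_diff: "algebraic_int x \<Longrightarrow> algebraic_int y \<Longrightarrow> algebraic_int (x - y)"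
  for x y :: 'a
  using alg_add[of x "- y"] by simp

lemma alg_power: "algebraic_int x \<Longrightarrow> algebraic_int (x ^ n)" for x :: 'a
  by (induction n) (auto intro: alg_mult)

lemma alg_sum: "(\<And>i. i \<in> A \<Longrightarrow> algebraic_int (f i)) \<Longrightarrow> algebraic_int (sum f A)"
  for f :: "'b \<Rightarrow> 'a"
  by (induction A rule: infinite_finite_induct) (auto intro: alg_add)

lemma alg_prod: "(\<And>i. i \<in> A \<Longrightarrow> algebraic_int (f i)) \<Longrightarrow> algebraic_int (prod f A)"
  for f :: "'b \<Rightarrow> 'a"
  by (induction A rule: infinite_finite_induct) (auto intro: alg_mult)

lemma P_alg: "x \<in> P \<Longrightarrow> algebraic_int x"
  and P_add: "x \<in> P \<Longrightarrow> y \<in> P \<Longrightarrow> x + y \<in> P"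
  and P_mult: "x \<in> P \<Longrightarrow> algebraic_int y \<Longrightarrow> y * x \<in> P"
  and P_prime: "algebraic_int x \<Longrightarrow> algebraic_int y \<Longrightarrow> x * y \<in> P \<Longrightarrow> x \<in> P \<or> y \<in> P"
  and P_0: "0 \<in> P"
  and P_1: "1 \<notin> P"
proof -
  interpret I: primeideal P "ring_of_integers UNIV" by (rule primeideal_P)
  show alg: "x \<in> P \<Longrightarrow> algebraic_int x" for x using I.Icarr by simp
  show "x \<in> P \<Longrightarrow> y \<in> P \<Longrightarrow> x + y \<in> P" for x y
    using additive_subgroup.a_closed[OF I.additive_subgroup_axioms] by simp
  show mult: "x \<in> P \<Longrightarrow> algebraic_int y \<Longrightarrow> y * x \<in> P" for x y using I.I_l_closed by simp
  show "algebraic_int x \<Longrightarrow> algebraic_int y \<Longrightarrow> x * y \<in> P \<Longrightarrow> x \<in> P \<or> y \<in> P" for x y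
    using I.I_prime by simp
  show "0 \<in> P" using additive_subgroup.zero_closed[OF I.additive_subgroup_axioms] by simp
  show "1 \<notin> P" using I.I_notcarr mult[of 1] alg by (metis (mono_tags) Collect_cong UNIV_I
    mem_Collect_eq mult.right_neutral ring_of_integers_simps(1) Collect_mem_eq)
qed

lemma P_mult': "x \<in> P \<Longrightarrow> algebraic_int y \<Longrightarrow> x * y \<in> P"
  using P_mult[of x y] by (simp add: mult.commute)

lemma P_uminus: "x \<in> P \<Longrightarrow> - x \<in> P"
  using P_mult[of x "-1"] by simp

lemma P_diff: "x \<in> P \<Longrightarrow> y \<in> P \<Longrightarrow> x - y \<in> P"
  using P_add[of x "- y"] P_uminus[of y] by simp

lemma P_sum: "(\<And>i. i \<in> A \<Longrightarrow> f i \<in> P) \<Longrightarrow> sum f A \<in> P"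
  by (induction A rule: infinite_finite_induct) (auto intro: P_add P_0)

lemma P_power: "algebraic_int x \<Longrightarrow> x ^ n \<in> P \<Longrightarrow> x \<in> P"
  by (induction n) (auto simp: P_1 dest: P_prime[OF _ alg_power])

lemma P_prod: "finite A \<Longrightarrow> (\<And>i. i \<in> A \<Longrightarrow> algebraic_int (f i)) \<Longrightarrow> prod f A \<in> P \<Longrightarrow> \<exists>i\<in>A. f i \<in> P"
proof (induction A rule: finite_induct)
  case (insert i A)
  then have "f i * prod f A \<in> P" "algebraic_int (f i)" "algebraic_int (prod f A)"
    by (auto intro: alg_prod)
  then show ?case using insert P_prime by (meson insertCI)
qed (simp add: P_1)

lemma cong_refl: "x \<doteq> x" by (simp add: P_0)

lemma cong_sym: "x \<doteq> y \<Longrightarrow> y \<doteq> x" using P_uminus[of "x - y"] by simp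

lemma cong_trans: "x \<doteq> y \<Longrightarrow> y \<doteq> z \<Longrightarrow> x \<doteq> z" using P_add[of "x - y" "y - z"] by simp

lemma cong_add: "x \<doteq> y \<Longrightarrow> x' \<doteq> y' \<Longrightarrow> x + x' \<doteq> y + y'"
  using P_add[of "x - y" "x' - y'"] by (simp add: algebra_simps)

lemma cong_mult:
  assumes "x \<doteq> y" "x' \<doteq> y'" "algebraic_int y" "algebraic_int x'"
  shows "x * x' \<doteq> y * y'"
proof -
  have "x * x' - y * y' = x' * (x - y) + y * (x' - y')" by (simp add: algebra_simps)
  then show ?thesis using assms P_mult P_add by auto
qed

lemma cong_alg: "x \<doteq> y \<Longrightarrow> algebraic_int y \<Longrightarrow> algebraic_int x"
  using alg_add[of "x - y" y] P_alg by simp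

lemma cong_power: "x \<doteq> y \<Longrightarrow> algebraic_int y \<Longrightarrow> x ^ n \<doteq> y ^ n"
  by (induction n) (auto intro!: cong_mult alg_power cong_alg[of x y] simp: P_0)

lemma cong_mem: "x \<doteq> y \<Longrightarrow> x \<in> P \<longleftrightarrow> y \<in> P"
  using P_add[of "x - y" y] P_diff[of x "x - y"] by auto

lemma cong_cancel:
  assumes "z * x \<doteq> z * y" "algebraic_int x" "algebraic_int y" "algebraic_int z" "z \<notin> P"
  shows "x \<doteq> y"
  using P_prime[of z "x - y"] assms by (auto simp: algebra_simps intro: alg_diff)

lemma of_int_mem_P: "of_int n \<in> P \<longleftrightarrow> int p dvd n"
proof
  assume n: "of_int n \<in> P"
  show "int p dvd n"
  proof (rule ccontr)
    assume "\<not> int p dvd n"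
    then have "Rings.coprime (int p) n" using prime_p by (intro prime_imp_coprime) auto
    then obtain u v where "u * int p + v * n = 1" using bezout_int[of "int p" n] by auto
    then have "(1 :: 'a) = of_int u * of_nat p + of_int v * of_int n"
      by (metis of_int_1 of_int_add of_int_mult of_int_of_nat_eq)
    also have "\<dots> \<in> P" using n p_in_P by (intro P_add P_mult) auto
    finally show False using P_1 by simp
  qed
next
  assume "int p dvd n"
  then obtain k where "n = int p * k" by blast
  then show "of_int n \<in> P" using P_mult'[OF p_in_P, of "of_int k"] by simp
qed

lemma of_int_cong_nat: "(of_int n :: 'a) \<doteq> of_nat (nat (n mod int p))"
proof -
  have "(of_int n :: 'a) \<doteq> of_int (n mod int p)" by (metis dvd_minus_mod of_int_diff of_int_mem_P)
  then show ?thesis using p_pos by simp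
qed

lemma p_multiple_in_P: "algebraic_int (x / of_nat p) \<Longrightarrow> x \<in> P"
  using P_mult'[OF p_in_P, of "x / of_nat p"] p_pos by simp

lemma algebraic_int_fixed:
  assumes "algebraic_int x" "\<And>\<sigma>. \<sigma> \<in> G \<Longrightarrow> \<sigma> x = (x::'a)"
  obtains n where "x = of_int n"
  using rational_algebraic_int_is_int[OF assms(1) finite_galois_extensionD(3)[OF galois]] assms(2)
  by (auto elim: Ints_cases)

lemma coeff_orbit_poly_alg:
  fixes x :: 'a
  assumes "H \<subseteq> G" "algebraic_int x"
  shows "algebraic_int (poly.coeff (orbit_poly H x) i)"
proof -
  have "\<forall>i. algebraic_int (poly.coeff (\<Prod>\<sigma>\<in>H. [:- \<sigma> x, 1:]) i)"
    using finite_subset[OF assms(1) finite_G] assms(1)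
  proof (induction H rule: finite_induct)
    case (insert \<sigma> H)
    have "algebraic_int (\<sigma> x)" using insert assms(2) by (auto intro: Gal_algebraic_int)
    then have "algebraic_int (poly.coeff [:- \<sigma> x, 1:] k)" for k
      by (auto simp: coeff_pCons split: nat.split)
    moreover have "\<forall>i. algebraic_int (poly.coeff (\<Prod>\<sigma>\<in>H. [:- \<sigma> x, 1:]) i)" using insert by auto
    ultimately show ?case
      unfolding prod.insert[OF insert(1,2)] coeff_mult by (intro allI alg_sum alg_mult) auto
  qed simp
  then show ?thesis by (simp add: orbit_poly_def)
qed

text \<open>A maximal family of integers that is independent modulo \<open>p\<close> spans modulo \<open>p\<close>; it exists
  because integer relations exist among more integers than the dimension.\<close>

lemma finite_representatives_mod_p:
  obtains R :: "'a set"
    where "finite R" "\<And>x. algebraic_int x \<Longrightarrow> \<exists>r\<in>R. algebraic_int ((x - r) / of_nat p)"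
proof -
  obtain B :: "'a set" where B: "finite B" "ratspace.span B = UNIV"
    using finite_galois_extensionD(1)[OF galois] by blast
  define indep where "indep = (\<lambda>k. \<exists>f::nat \<Rightarrow> 'a. (\<forall>i<k. algebraic_int (f i)) \<and>
    (\<forall>a::nat \<Rightarrow> int. algebraic_int ((\<Sum>i<k. of_int (a i) * f i) / of_nat p) \<longrightarrow> (\<forall>i<k. int p dvd a i)))"
  have bound: "k \<le> card B" if "indep k" for k
  proof (rule ccontr)
    assume "\<not> k \<le> card B"
    then have k: "card B < k" by simp
    obtain f :: "nat \<Rightarrow> 'a" where f: "\<And>a. algebraic_int ((\<Sum>i<k. of_int (a i) * f i) / of_nat p)
        \<Longrightarrow> (\<forall>i<k. int p dvd a i)"
      using \<open>indep k\<close> unfolding indep_def by blast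
    obtain a where "(\<Sum>i<k. of_int (a i) * f i) = 0" "\<exists>i<k. \<not> int p dvd a i"
      using integer_relation[OF B p_gt_1 k, of f] by blast
    then show False using f[of a] by auto
  qed
  have "indep 0" by (simp add: indep_def)
  then obtain k where k: "indep k" and max: "\<not> indep (Suc k)"
    using ex_has_greatest_nat[of indep 0 id "Suc (card B)"] bound
    by (metis Suc_n_not_le_n id_apply le_imp_less_Suc)
  obtain f :: "nat \<Rightarrow> 'a" where f: "\<And>i. i < k \<Longrightarrow> algebraic_int (f i)"
      "\<And>a. algebraic_int ((\<Sum>i<k. of_int (a i) * f i) / of_nat p) \<Longrightarrow> (\<forall>i<k. int p dvd a i)"
    using k unfolding indep_def by blast
  define R where "R = (\<lambda>b. \<Sum>i<k. of_int (b i) * f i) ` ({..<k} \<rightarrow>\<^sub>E {0..<int p})"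
  have div_of_int: "algebraic_int (of_int n * z / of_nat p :: 'a)" if "int p dvd n" "algebraic_int z" for n z
  proof -
    obtain m where "n = int p * m" using \<open>int p dvd n\<close> by blast
    then have "of_int n * z / of_nat p = of_int m * z" using p_pos by simp
    then show ?thesis using that(2) alg_mult by simp
  qed
  have "\<exists>r\<in>R. algebraic_int ((x - r) / of_nat p)" if x: "algebraic_int x" for x
  proof -
    let ?f = "f(k := x)"
    have "\<forall>i<Suc k. algebraic_int (?f i)" using f(1) x by (auto simp: less_Suc_eq)
    then obtain a where a: "algebraic_int ((\<Sum>i<Suc k. of_int (a i) * ?f i) / of_nat p)"
        "\<exists>i<Suc k. \<not> int p dvd a i"
      using max unfolding indep_def by blast
    define S where "S = (\<Sum>i<k. of_int (a i) * f i)"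
    have a1: "algebraic_int ((S + of_int (a k) * x) / of_nat p)"
      using a(1) by (simp add: S_def)
    have "\<not> int p dvd a k"
    proof
      assume ak: "int p dvd a k"
      then have "algebraic_int (S / of_nat p)"
        using alg_diff[OF a1 div_of_int[OF ak x]] by (simp add: add_divide_distrib)
      then have "\<forall>i<k. int p dvd a i" using f(2) by (simp add: S_def)
      then show False using a(2) ak by (auto simp: less_Suc_eq)
    qed
    then have "Rings.coprime (int p) (a k)" using prime_p by (intro prime_imp_coprime) auto
    then obtain u v where uv: "u * int p + v * a k = 1" using bezout_int[of "int p" "a k"] by auto
    define b where "b = (\<lambda>i\<in>{..<k}. (- v * a i) mod int p)"
    define r where "r = (\<Sum>i<k. of_int (b i) * f i)"
    have bE: "b \<in> {..<k} \<rightarrow>\<^sub>E {0..<int p}" using p_pos by (auto simp: b_def)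
    have "algebraic_int ((- of_int v * S - r) / of_nat p)"
    proof -
      have "(- of_int v * S - r) / of_nat p = (\<Sum>i<k. of_int (- v * a i - b i) * f i / of_nat p)"
        by (simp add: S_def r_def sum_distrib_left flip: sum_divide_distrib sum_negf sum_subtractf)
           (simp add: algebra_simps)
      also have "algebraic_int \<dots>"
      proof (rule alg_sum, rule div_of_int)
        fix i assume "i \<in> {..<k}"
        then show "int p dvd - v * a i - b i" "algebraic_int (f i)"
          using f(1) by (auto simp: b_def minus_mod_eq_mult_div)
      qed
      finally show ?thesis .
    qed
    moreover have "algebraic_int (of_int v * ((S + of_int (a k) * x) / of_nat p))"
      by (rule alg_mult[OF algebraic_int_of_int a1])
    moreover have "algebraic_int (of_int u * x)" using x alg_mult by simp
    moreover have "(x - r) / of_nat p = of_int u * x + of_int v * ((S + of_int (a k) * x) / of_nat p)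
        + (- of_int v * S - r) / of_nat p"
    proof -
      have "x = (of_int u * of_nat p + of_int v * of_int (a k)) * x"
        using arg_cong[OF uv, of "of_int :: int \<Rightarrow> 'a"] by simp
      then have "x - r = of_nat p * (of_int u * x) + of_int v * (S + of_int (a k) * x) + (- of_int v * S - r)"
        by (simp add: algebra_simps)
      moreover have "w = of_nat p * s + t + t' \<Longrightarrow> w / of_nat p = s + t / of_nat p + t' / of_nat p"
        for w s t t' :: 'a using p_pos by (simp add: field_simps)
      ultimately show ?thesis unfolding times_divide_eq_right by blast
    qed
    ultimately have "algebraic_int ((x - r) / of_nat p)" using alg_add by metis
    moreover have "r \<in> R" unfolding r_def R_def using bE by blast
    ultimately show ?thesis by blast
  qed
  moreover have "finite R" unfolding R_def by (intro finite_imageI finite_PiE) auto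
  ultimately show ?thesis using that by blast
qed

text \<open>The source of inverses modulo \<open>P\<close>, and later of a monic equation.\<close>

lemma repeated_residue:
  fixes f :: "nat \<Rightarrow> 'a"
  assumes "\<And>i. algebraic_int (f i)"
  obtains i j where "i < j" "algebraic_int ((f j - f i) / of_nat p)"
proof -
  obtain R :: "'a set" where R: "finite R" "\<And>x. algebraic_int x \<Longrightarrow> \<exists>r\<in>R. algebraic_int ((x - r) / of_nat p)"
    using finite_representatives_mod_p by blast
  define r where "r = (\<lambda>i. SOME r. r \<in> R \<and> algebraic_int ((f i - r) / of_nat p))"
  have r: "r i \<in> R \<and> algebraic_int ((f i - r i) / of_nat p)" for i
    unfolding r_def by (rule someI_ex) (use R(2)[OF assms] in blast)
  then have "finite (range r)" using R(1) by (meson finite_subset image_subsetI)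
  then have "\<not> inj r" using finite_imageD infinite_UNIV_nat by blast
  then obtain i j where "r i = r j" "i \<noteq> j" by (auto simp: inj_on_def)
  then obtain i j where ij: "r i = r j" "i < j" by (metis linorder_neq_iff)
  have "algebraic_int ((f j - r j) / of_nat p - (f i - r i) / of_nat p)"
    using r by (intro alg_diff) auto
  then show ?thesis using that[OF ij(2)] ij(1) by (simp flip: diff_divide_distrib)
qed

lemma power_cong_1:
  assumes x: "algebraic_int x" "x \<notin> P"
  obtains N where "N > 0" "x ^ N \<doteq> 1"
proof -
  obtain i j where ij: "i < j" "algebraic_int ((x ^ j - x ^ i) / of_nat p)"
    using repeated_residue[of "\<lambda>i. x ^ i"] alg_power[OF x(1)] by blast
  have "x ^ j = x ^ i * x ^ (j - i)" using ij(1) by (simp flip: power_add)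
  then have "x ^ i * x ^ (j - i) \<doteq> x ^ i * 1" using p_multiple_in_P[OF ij(2)] by simp
  then have "x ^ (j - i) \<doteq> 1"
    by (rule cong_cancel) (use x P_power[of x i] in \<open>auto intro: alg_power\<close>)
  then show ?thesis using that[of "j - i"] ij(1) by simp
qed

subsection \<open>The places in one orbit\<close>

lemma Gal_subset_G: "carrier (Gal L) \<subseteq> G"
  using Gal_Rats by (fastforce simp: Gal_iff)

lemma galois_place_image:
  assumes g: "g \<in> G"
  shows "galois_place p (g ` P)"
proof
  have bij: "bij g" using g by (rule Gal_bij)
  have surj: "\<exists>x. algebraic_int x \<and> y = g x" if "algebraic_int y" for y
    using Gal_algebraic_int[OF Gal_inv_closed[OF g] that] bij
    by (intro exI[of _ "inv_into UNIV g y"]) (simp add: bij_is_surj surj_f_inv_f)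
  have mem: "g x \<in> g ` P \<longleftrightarrow> x \<in> P" for x using bij by (simp add: bij_is_inj inj_image_mem_iff)
  interpret I: primeideal P "ring_of_integers UNIV" by (rule primeideal_P)
  have "primeideal (g ` P) (ring_of_integers UNIV)"
  proof (rule primeidealI)
    show "ideal (g ` P) (ring_of_integers UNIV)"
    proof (rule idealI)
      show "subgroup (g ` P) (add_monoid (ring_of_integers UNIV))"
      proof (rule group.subgroupI[OF abelian_group.a_group])
        fix x assume "x \<in> g ` P"
        then obtain y where y: "x = g y" "y \<in> P" by auto
        have "inv\<^bsub>add_monoid (ring_of_integers UNIV)\<^esub> x = g (- y)"
          using I.minus_equality[of "- x" x] P_alg[OF y(2)] Gal_algebraic_int[OF g, of y] y(1)
          by (simp add: a_inv_def Gal_uminus[OF g])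
        then show "inv\<^bsub>add_monoid (ring_of_integers UNIV)\<^esub> x \<in> g ` P"
          using P_uminus[OF y(2)] by simp
      next
        show "abelian_group (ring_of_integers (UNIV :: 'a set))" by (rule I.abelian_group_axioms)
        show "g ` P \<subseteq> carrier (add_monoid (ring_of_integers UNIV))"
          using P_alg Gal_algebraic_int[OF g] by auto
        show "g ` P \<noteq> {}" using P_0 by auto
        fix x y assume "x \<in> g ` P" "y \<in> g ` P"
        then obtain a b where "x = g a" "y = g b" "a \<in> P" "b \<in> P" by auto
        then have "x + y = g (a + b)" "a + b \<in> P" using P_add by (auto simp: Gal_add[OF g])
        then show "x \<otimes>\<^bsub>add_monoid (ring_of_integers UNIV)\<^esub> y \<in> g ` P" by simp
      qed
    next
      fix x y :: 'a
      assume "x \<in> g ` P" "y \<in> carrier (ring_of_integers UNIV)"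
      then obtain a b where "x = g a" "a \<in> P" "y = g b" "algebraic_int b"
        using surj[of y] by (elim imageE) auto
      then show "y \<otimes>\<^bsub>ring_of_integers UNIV\<^esub> x \<in> g ` P" "x \<otimes>\<^bsub>ring_of_integers UNIV\<^esub> y \<in> g ` P"
        using P_mult P_mult' by (auto simp flip: Gal_times[OF g])
    qed (rule I.ring_axioms)
    show "cring (ring_of_integers (UNIV :: 'a set))" by (rule I.is_cring)
    have "1 \<notin> g ` P" using mem[of 1] P_1 by (simp add: Gal_1[OF g])
    then show "carrier (ring_of_integers UNIV) \<noteq> g ` P" by auto
    fix x y :: 'a
    assume "x \<in> carrier (ring_of_integers UNIV)" "y \<in> carrier (ring_of_integers UNIV)"
      and "x \<otimes>\<^bsub>ring_of_integers UNIV\<^esub> y \<in> g ` P"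
    moreover obtain a where a: "x = g a" "algebraic_int a" using surj[of x] calculation by auto
    moreover obtain b where b: "y = g b" "algebraic_int b" using surj[of y] calculation by auto
    ultimately have "g (a * b) \<in> g ` P" by (simp add: Gal_times[OF g])
    then have "a \<in> P \<or> b \<in> P" using P_prime[OF a(2) b(2)] mem by blast
    then show "x \<in> g ` P \<or> y \<in> g ` P" using a b mem by blast
  qed
  moreover have "of_nat p \<in> g ` P" using p_in_P Gal_of_nat[OF g, of p] by (metis imageI)
  ultimately show "g ` P \<in> places_above UNIV p" by (simp add: places_above_def)
qed (rule galois prime_p)+

text \<open>The descending chain \<open>P\<close>, \<open>g P\<close>, \<open>g\<^sup>2 P\<close>, \<open>\<dots>\<close> returns to \<open>P\<close> because \<open>g\<close> has finite order.\<close>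

lemma Gal_image_eqI:
  assumes g: "g \<in> G" and sub: "\<And>x. x \<in> P \<Longrightarrow> g x \<in> P"
  shows "g ` P = P"
proof
  show "P \<subseteq> g ` P"
  proof
    fix x assume x: "x \<in> P"
    interpret group "Gal \<rat> :: ('a \<Rightarrow> 'a) monoid" by simp
    have "g [^]\<^bsub>Gal \<rat>\<^esub> Coset.order (Gal \<rat> :: ('a \<Rightarrow> 'a) monoid) = \<one>\<^bsub>Gal \<rat>\<^esub>"
      using g by (rule pow_order_eq_1)
    moreover have "Coset.order (Gal \<rat> :: ('a \<Rightarrow> 'a) monoid) > 0"
      using finite_G order_gt_0_iff_finite by blast
    ultimately obtain k where k: "g ^^ Suc k = id" by (metis Gal_one Gal_pow g gr0_implies_Suc)
    have "(g ^^ k) x \<in> P" by (induction k) (use x sub in auto)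
    moreover have "g ((g ^^ k) x) = x" using fun_cong[OF k, of x] by simp
    ultimately show "x \<in> g ` P" by (metis imageI)
  qed
qed (use sub in blast)

lemma decomposition_cong:
  assumes "g \<in> G" "g ` P = P" "x \<doteq> y"
  shows "g x \<doteq> g y"
  using assms by (metis Gal_diff imageI)

end

section \<open>Residue fields\<close>

lemma (in ring) card_of_dimension:
  assumes K: "subfield K R" and "finite K" and "dimension n K E"
  shows "card E = card K ^ n"
proof -
  obtain Us where Us: "set Us \<subseteq> carrier R" "independent K Us" "length Us = n" "Span K Us = E"
    using exists_base[OF K assms(3)] by blast
  have "bij_betw (\<lambda>Ks. combine Ks Us) {Ks. set Ks \<subseteq> K \<and> length Ks = n} E"
    unfolding bij_betw_def
  proof
    show "(\<lambda>Ks. combine Ks Us) ` {Ks. set Ks \<subseteq> K \<and> length Ks = n} = E"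
      using Span_eq_combine_set_length_version[OF K Us(1)] Us(3,4) by auto
    then show "inj_on (\<lambda>Ks. combine Ks Us) {Ks. set Ks \<subseteq> K \<and> length Ks = n}"
      using unique_decomposition[OF K Us(2)] Us(3,4) by (intro inj_onI) blast
  qed
  then show ?thesis
    using card_lists_length_eq[OF \<open>finite K\<close>, of n] bij_betw_same_card by fastforce
qed

text \<open>The cosets in \<^term>\<open>residue_field E Q\<close>. Stated without the ring of integers of \<open>E\<close>, they can be compared
  for different \<open>E\<close>.\<close>

definition coset :: "'a::field_char_0 set \<Rightarrow> 'a \<Rightarrow> 'a set" where
  "coset Q x = (\<lambda>q. q + x) ` Q"

lemma r_coset_eq_coset: "a_r_coset (ring_of_integers E) Q x = coset Q x"
  by (auto simp: a_r_coset_def r_coset_def coset_def)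

lemma carrier_residue_field: "carrier (residue_field E Q) = coset Q ` {x \<in> E. algebraic_int x}"
  by (auto simp: residue_field_def FactRing_def A_RCOSETS_defs r_coset_def coset_def)

context galois_place
begin

abbreviation residue_field_P :: "'a set \<Rightarrow> 'a set ring" (\<open>\<kappa>\<close>) where "\<kappa> F \<equiv> residue_field F (P \<inter> F)"

lemma place_under_P: "place_under F P = P \<inter> F"
  using P_alg by (auto simp: place_under_def)

lemma coset_eq:
  assumes F: "subfield F ring_of_type_algebra" and x: "x \<in> F"
  shows "coset (P \<inter> F) x = {y \<in> F. y \<doteq> x}"
proof (intro equalityI subsetI)
  fix y assume y: "y \<in> {y \<in> F. y \<doteq> x}"
  then have "y = (y - x) + x" "y - x \<in> P \<inter> F" using subfield_diff[OF F _ x] by auto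
  then show "y \<in> coset (P \<inter> F) x" unfolding coset_def by blast
qed (use subfield_add[OF F _ x] in \<open>auto simp: coset_def\<close>)

lemma coset_eq_iff:
  assumes "x \<in> F" "y \<in> F" "subfield F ring_of_type_algebra"
  shows "coset (P \<inter> F) x = coset (P \<inter> F) y \<longleftrightarrow> x \<doteq> y"
  unfolding coset_eq[OF assms(3,1)] coset_eq[OF assms(3,2)]
  using assms(1) cong_refl cong_trans cong_sym by blast

lemma inj_on_coset_of_nat:
  assumes F: "subfield F ring_of_type_algebra"
  shows "inj_on (\<lambda>n. coset (P \<inter> F) (of_nat n)) {..<p}"
proof (rule inj_onI)
  fix m n assume mn: "m \<in> {..<p}" "n \<in> {..<p}" and "coset (P \<inter> F) (of_nat m) = coset (P \<inter> F) (of_nat n)"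
  then have "(of_nat m :: 'a) \<doteq> of_nat n" using coset_eq_iff[OF _ _ F] subfield_of_nat[OF F] by blast
  then have "int p dvd int m - int n" using of_int_mem_P[of "int m - int n"] by simp
  then have "int m mod int p = int n mod int p" by (simp add: mod_eq_dvd_iff)
  then show "m = n" using mn by simp
qed

context
  fixes F :: "'a set"
  assumes F: "subfield F ring_of_type_algebra"
begin

lemma cring_integers: "cring (ring_of_integers F)"
proof (rule cringI)
  show "abelian_group (ring_of_integers F)"
  proof (rule abelian_groupI)
    fix x assume "x \<in> carrier (ring_of_integers F)"
    then show "\<exists>y\<in>carrier (ring_of_integers F). y \<oplus>\<^bsub>ring_of_integers F\<^esub> x = \<zero>\<^bsub>ring_of_integers F\<^esub>"
      by (intro bexI[of _ "- x"]) (auto intro: subfield_closed[OF F])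
  qed (auto intro: subfield_closed[OF F] alg_add)
  show "comm_monoid (ring_of_integers F)"
    by (rule comm_monoidI) (auto intro: subfield_closed[OF F] alg_mult)
qed (auto simp: distrib_right)

lemma primeideal_under: "primeideal (P \<inter> F) (ring_of_integers F)"
proof -
  interpret R: cring "ring_of_integers F" by (rule cring_integers)
  show ?thesis
  proof (rule primeidealI)
    show "ideal (P \<inter> F) (ring_of_integers F)"
    proof (rule idealI)
      show "subgroup (P \<inter> F) (add_monoid (ring_of_integers F))"
      proof (rule group.subgroupI)
        show "group (add_monoid (ring_of_integers F))" by (rule R.a_group)
        fix x assume x: "x \<in> P \<inter> F"
        have "\<ominus>\<^bsub>ring_of_integers F\<^esub> x = - x"
          by (rule R.minus_equality) (use x P_alg subfield_uminus[OF F] in auto)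
        then show "inv\<^bsub>add_monoid (ring_of_integers F)\<^esub> x \<in> P \<inter> F"
          using x P_uminus subfield_uminus[OF F] by (simp add: a_inv_def)
      qed (use P_alg P_0 P_add subfield_closed[OF F] in auto)
    qed (use P_mult P_mult' subfield_mult[OF F] R.ring_axioms in auto)
    show "carrier (ring_of_integers F) \<noteq> P \<inter> F" using P_1 subfield_1[OF F] by auto
  qed (use P_prime R.is_cring in auto)
qed

lemma residue_ops:
  assumes "x \<in> F" "algebraic_int x" "y \<in> F" "algebraic_int y"
  shows "coset (P \<inter> F) x \<otimes>\<^bsub>\<kappa> F\<^esub> coset (P \<inter> F) y = coset (P \<inter> F) (x * y)"
    and "coset (P \<inter> F) x \<oplus>\<^bsub>\<kappa> F\<^esub> coset (P \<inter> F) y = coset (P \<inter> F) (x + y)"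
    and "\<one>\<^bsub>\<kappa> F\<^esub> = coset (P \<inter> F) 1"
    and "\<zero>\<^bsub>\<kappa> F\<^esub> = coset (P \<inter> F) 0"
proof -
  interpret I: primeideal "P \<inter> F" "ring_of_integers F" by (rule primeideal_under)
  show "coset (P \<inter> F) x \<otimes>\<^bsub>\<kappa> F\<^esub> coset (P \<inter> F) y = coset (P \<inter> F) (x * y)"
    using I.rcoset_mult_add[of x y] assms
    by (simp add: residue_field_def FactRing_def r_coset_eq_coset)
  show "coset (P \<inter> F) x \<oplus>\<^bsub>\<kappa> F\<^esub> coset (P \<inter> F) y = coset (P \<inter> F) (x + y)"
    using I.a_rcos_sum[of x y] assms
    by (simp add: residue_field_def FactRing_def r_coset_eq_coset)
qed (simp_all add: residue_field_def FactRing_def r_coset_eq_coset coset_def)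

lemma field_residue_field: "field (\<kappa> F)"
proof -
  interpret I: primeideal "P \<inter> F" "ring_of_integers F" by (rule primeideal_under)
  interpret R: cring "\<kappa> F"
    unfolding residue_field_def by (rule I.quotient_is_cring[OF I.is_cring])
  note ops = residue_ops coset_eq_iff[OF _ _ F] carrier_residue_field
    subfield_closed[OF F]
  show ?thesis
  proof (rule R.cring_fieldI2)
    show "\<zero>\<^bsub>\<kappa> F\<^esub> \<noteq> \<one>\<^bsub>\<kappa> F\<^esub>"
      using P_1 P_uminus[of "-1"] by (auto simp add: residue_ops(3,4)[of 0 0] ops)
    fix C assume C: "C \<in> carrier (\<kappa> F)" "C \<noteq> \<zero>\<^bsub>\<kappa> F\<^esub>"
    then obtain x where x: "x \<in> F" "algebraic_int x" "C = coset (P \<inter> F) x"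
      by (auto simp: carrier_residue_field)
    then have "x \<notin> P" using C(2) by (simp add: residue_ops(4)[of 0 0] ops)
    then obtain N where N: "N > 0" "x ^ N \<doteq> 1" using power_cong_1 x(2) by blast
    have "x * x ^ (N - 1) \<doteq> 1" using N by (simp flip: power_Suc)
    then have "C \<otimes>\<^bsub>\<kappa> F\<^esub> coset (P \<inter> F) (x ^ (N - 1)) = \<one>\<^bsub>\<kappa> F\<^esub>"
      using x alg_power subfield_power[OF F] residue_ops(1)[of x "x ^ (N - 1)"] residue_ops(3)[of 0 0] ops
      by simp
    moreover have "coset (P \<inter> F) (x ^ (N - 1)) \<in> carrier (\<kappa> F)"
      using x alg_power subfield_power[OF F] by (auto simp: carrier_residue_field)
    ultimately show "\<exists>D\<in>carrier (\<kappa> F).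
        C \<otimes>\<^bsub>\<kappa> F\<^esub> D = \<one>\<^bsub>\<kappa> F\<^esub>"
      by blast
  qed
qed

lemma residue_pow:
  assumes "x \<in> F" "algebraic_int x"
  shows "coset (P \<inter> F) x [^]\<^bsub>\<kappa> F\<^esub> (n::nat) = coset (P \<inter> F) (x ^ n)"
proof (induction n)
  case (Suc n)
  then show ?case
    using residue_ops(1)[of "x ^ n" x] assms subfield_power[OF F] alg_power
    by (simp add: mult.commute)
qed (simp add: residue_ops(3)[of 0 0] subfield_0[OF F])

lemma finite_residue_field: "finite (carrier (\<kappa> F))"
proof -
  obtain R :: "'a set" where R: "finite R" "\<And>x. algebraic_int x \<Longrightarrow> \<exists>r\<in>R. algebraic_int ((x - r) / of_nat p)"
    using finite_representatives_mod_p by blast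
  have "carrier (\<kappa> F) \<subseteq> (\<lambda>r. {y \<in> F. y \<doteq> r}) ` R"
  proof
    fix C assume "C \<in> carrier (\<kappa> F)"
    then obtain x where x: "x \<in> F" "algebraic_int x" "C = {y \<in> F. y \<doteq> x}"
      using coset_eq[OF F] by (auto simp: carrier_residue_field)
    obtain r where r: "r \<in> R" "x \<doteq> r" using R(2)[OF x(2)] p_multiple_in_P by blast
    then have "C = {y \<in> F. y \<doteq> r}" using x(3) cong_trans cong_sym by blast
    then show "C \<in> (\<lambda>r. {y \<in> F. y \<doteq> r}) ` R" using r(1) by blast
  qed
  then show ?thesis using R(1) finite_surj by blast
qed

text \<open>The multiplicative group of a finite field is cyclic, expressed by representatives.\<close>

lemma residue_generator:
  obtains g where "g \<in> F" "algebraic_int g" "g \<notin> P"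
    and "\<And>x. x \<in> F \<Longrightarrow> algebraic_int x \<Longrightarrow> x \<notin> P \<Longrightarrow> \<exists>k. x \<doteq> g ^ k"
    and "\<And>k. g ^ k \<doteq> 1 \<longleftrightarrow> card (carrier (\<kappa> F)) - 1 dvd k"
proof -
  let ?R = "\<kappa> F"
  interpret R: Ring.field ?R by (rule field_residue_field)
  interpret M: group "Multiplicative_Group.mult_of ?R" by (rule R.field_mult_group)
  have finM: "finite (carrier (Multiplicative_Group.mult_of ?R))" by (rule R.finite_mult_of[OF finite_residue_field])
  obtain a where a: "a \<in> carrier (Multiplicative_Group.mult_of ?R)" "carrier (Multiplicative_Group.mult_of ?R) = {a [^]\<^bsub>?R\<^esub> i | i::nat. i \<in> UNIV}"
    using R.finite_field_mult_group_has_gen[OF finite_residue_field] by blast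
  then obtain g where g: "g \<in> F" "algebraic_int g" "a = coset (P \<inter> F) g"
    by (auto simp: carrier_residue_field)
  have one: "\<one>\<^bsub>?R\<^esub> = coset (P \<inter> F) 1" and zero: "\<zero>\<^bsub>?R\<^esub> = coset (P \<inter> F) 0"
    using residue_ops(3,4)[of 0 0] subfield_0[OF F] by auto
  note ce = coset_eq_iff[OF _ _ F]
  have "M.ord a = card (generate (Multiplicative_Group.mult_of ?R) {a})" using a(1) by (rule M.generate_pow_card)
  also have "generate (Multiplicative_Group.mult_of ?R) {a} = carrier (Multiplicative_Group.mult_of ?R)"
    using M.generate_pow_on_finite_carrier[OF finM a(1)] a(2) by (simp add: Multiplicative_Group.nat_pow_mult_of)
  also have "card \<dots> = card (carrier ?R) - 1"
    using R.order_mult_of[OF finite_residue_field] by (simp add: Coset.order_def)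
  finally have ord: "M.ord a = card (carrier ?R) - 1" .
  show ?thesis
  proof (rule that)
    show "g \<notin> P"
      using a(1) g zero ce[of g 0] subfield_0[OF F] by auto
    show "\<exists>k. x \<doteq> g ^ k" if x: "x \<in> F" "algebraic_int x" "x \<notin> P" for x
    proof -
      have "coset (P \<inter> F) x \<in> carrier (Multiplicative_Group.mult_of ?R)"
        using x zero ce[of x 0] subfield_0[OF F] by (auto simp: carrier_residue_field)
      then obtain k where "coset (P \<inter> F) x = a [^]\<^bsub>?R\<^esub> (k::nat)" using a(2) by blast
      then show ?thesis using g x ce[of x "g ^ k"] subfield_power[OF F] residue_pow by auto
    qed
    show "g ^ k \<doteq> 1 \<longleftrightarrow> card (carrier ?R) - 1 dvd k" for k
    proof -
      have "g ^ k \<doteq> 1 \<longleftrightarrow> a [^]\<^bsub>Multiplicative_Group.mult_of ?R\<^esub> k = \<one>\<^bsub>Multiplicative_Group.mult_of ?R\<^esub>"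
        using ce[of "g ^ k" 1] g subfield_power[OF F] subfield_1[OF F] residue_pow one
        by (simp add: Multiplicative_Group.nat_pow_mult_of)
      then show ?thesis using M.pow_eq_id[OF a(1)] ord by simp
    qed
  qed (use g in auto)
qed

end

lemma residue_embedding_coset:
  assumes L: "subfield L ring_of_type_algebra" and E: "subfield E ring_of_type_algebra"
    and "L \<subseteq> E" "x \<in> L"
  shows "residue_embedding E (P \<inter> E) (coset (P \<inter> L) x) = coset (P \<inter> E) x"
proof -
  have "residue_embedding E (P \<inter> E) (coset (P \<inter> L) x) = (\<Union>h\<in>P \<inter> E. \<Union>k\<in>P \<inter> L. {h + (k + x)})"
    by (auto simp: residue_embedding_def set_add_def set_mult_def coset_def)
  also have "\<dots> = coset (P \<inter> E) x"
  proof
    show "(\<Union>h\<in>P \<inter> E. \<Union>k\<in>P \<inter> L. {h + (k + x)}) \<subseteq> coset (P \<inter> E) x"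
    proof
      fix z assume "z \<in> (\<Union>h\<in>P \<inter> E. \<Union>k\<in>P \<inter> L. {h + (k + x)})"
      then obtain h k where h: "h \<in> P \<inter> E" "k \<in> P \<inter> L" "z = (h + k) + x" by (auto simp: add.assoc)
      then have "h + k \<in> P \<inter> E" using P_add subfield_add[OF E] \<open>L \<subseteq> E\<close> by auto
      then show "z \<in> coset (P \<inter> E) x" unfolding coset_def using h(3) by blast
    qed
    show "coset (P \<inter> E) x \<subseteq> (\<Union>h\<in>P \<inter> E. \<Union>k\<in>P \<inter> L. {h + (k + x)})"
      using P_0 subfield_0[OF L] by (force simp: coset_def)
  qed
  finally show ?thesis .
qed

lemma residue_base_eq:
  assumes L: "subfield L ring_of_type_algebra" and E: "subfield E ring_of_type_algebra"
    and "L \<subseteq> E"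
  shows "residue_base L E (P \<inter> E) = coset (P \<inter> E) ` {x \<in> L. algebraic_int x}"
proof -
  have "place_under L (P \<inter> E) = P \<inter> L" using P_alg \<open>L \<subseteq> E\<close> by (auto simp: place_under_def)
  then show ?thesis
    using residue_embedding_coset[OF assms]
    by (auto simp: residue_base_def carrier_residue_field image_image)
qed

lemma Rats_subfield: "subfield (\<rat> :: 'a set) ring_of_type_algebra"
  using galois by (auto simp: finite_galois_extension_def)

lemma alg_Rats: "{x \<in> \<rat>. algebraic_int x} = (\<int> :: 'a set)"
  using rational_algebraic_int_is_int Ints_subset_Rats by (auto intro: int_imp_algebraic_int)

lemma card_residue_field:
  assumes F: "subfield F ring_of_type_algebra"
  shows "card (carrier (\<kappa> F)) = p ^ residue_degree \<rat> F (P \<inter> F)"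
    and "residue_degree \<rat> F (P \<inter> F) > 0"
proof -
  let ?R = "\<kappa> F" and ?S = "residue_field (\<rat> :: 'a set) (P \<inter> \<rat>)"
  let ?K = "residue_base \<rat> F (P \<inter> F)"
  interpret R: Ring.field ?R by (rule field_residue_field[OF F])
  interpret R0: Ring.field ?S using field_residue_field[OF Rats_subfield] .
  note sub = Rats_subset_subfield[OF F]
  note emb = residue_embedding_coset[OF Rats_subfield F sub]
  have K: "?K = coset (P \<inter> F) ` \<int>"
    using residue_base_eq[OF Rats_subfield F sub] alg_Rats by simp
  have hom: "residue_embedding F (P \<inter> F) \<in> ring_hom ?S ?R"
  proof (rule ring_hom_memI)
    fix C D assume "C \<in> carrier ?S" "D \<in> carrier ?S"
    then obtain x y where x: "C = coset (P \<inter> \<rat>) x" "x \<in> \<rat>" "algebraic_int x"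
      and y: "D = coset (P \<inter> \<rat>) y" "y \<in> \<rat>" "algebraic_int y"
      by (auto simp: carrier_residue_field)
    have xy: "x \<in> F" "y \<in> F" using x y sub by auto
    show "residue_embedding F (P \<inter> F) C \<in> carrier ?R"
      using x xy emb[of x] by (auto simp: carrier_residue_field)
    show "residue_embedding F (P \<inter> F) (C \<otimes>\<^bsub>?S\<^esub> D)
        = residue_embedding F (P \<inter> F) C \<otimes>\<^bsub>?R\<^esub> residue_embedding F (P \<inter> F) D"
      using x y xy emb[of x] emb[of y] emb[of "x * y"]
      by (simp add: residue_ops(1)[OF Rats_subfield] residue_ops(1)[OF F])
    show "residue_embedding F (P \<inter> F) (C \<oplus>\<^bsub>?S\<^esub> D)
        = residue_embedding F (P \<inter> F) C \<oplus>\<^bsub>?R\<^esub> residue_embedding F (P \<inter> F) D"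
      using x y xy emb[of x] emb[of y] emb[of "x + y"]
      by (simp add: residue_ops(2)[OF Rats_subfield] residue_ops(2)[OF F])
  next
    show "residue_embedding F (P \<inter> F) \<one>\<^bsub>?S\<^esub> = \<one>\<^bsub>?R\<^esub>"
      using emb[of 1] residue_ops(3)[OF Rats_subfield, of 0 0] residue_ops(3)[OF F, of 0 0] subfield_0[OF F]
      by simp
  qed
  interpret h: ring_hom_ring ?S ?R "residue_embedding F (P \<inter> F)"
    by (rule ring_hom_ringI2[OF R0.ring_axioms R.ring_axioms hom])
  have "carrier ?S = coset (P \<inter> \<rat>) ` {x \<in> \<rat>. algebraic_int x}" by (rule carrier_residue_field)
  then have "?K = residue_embedding F (P \<inter> F) ` carrier ?S"
    unfolding residue_base_eq[OF Rats_subfield F sub] using emb by (force simp: image_image)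
  then have sf: "subfield ?K ?R"
    using h.img_is_subfield(2)[OF R0.carrier_is_subfield] by simp
  have "?K = coset (P \<inter> F) ` of_nat ` {..<p}"
  proof -
    have "coset (P \<inter> F) (of_int n) = coset (P \<inter> F) (of_nat (nat (n mod int p)))" for n
      using coset_eq_iff[OF _ _ F] subfield_of_int[OF F] subfield_of_nat[OF F] of_int_cong_nat by blast
    moreover have "nat (n mod int p) < p" for n using p_pos by (simp add: nat_less_iff)
    ultimately show ?thesis unfolding K
      by (auto simp: image_image elim!: Ints_cases)
  qed
  moreover note inj_on_coset_of_nat[OF F]
  ultimately have cardK: "card ?K = p" "finite ?K"
    by (auto simp: image_image card_image)
  obtain Us where Us: "set Us = carrier ?R" using finite_list[OF finite_residue_field[OF F]] by blast
  have "R.Span ?K Us = carrier ?R"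
    using R.Span_base_incl[OF sf, of Us] R.Span_in_carrier[of ?K Us] subfieldE(3)[OF sf] Us by auto
  then have "R.finite_dimension ?K (carrier ?R)"
    using R.Span_finite_dimension[OF sf, of Us] Us by simp
  then have dim: "R.dimension (residue_degree \<rat> F (P \<inter> F)) ?K (carrier ?R)"
    using R.finite_dimensionE[OF sf] by (simp add: residue_degree_def over_def)
  show c: "card (carrier ?R) = p ^ residue_degree \<rat> F (P \<inter> F)"
    using R.card_of_dimension[OF sf cardK(2) dim] cardK(1) by simp
  have "{\<zero>\<^bsub>?R\<^esub>, \<one>\<^bsub>?R\<^esub>} \<subseteq> carrier ?R" by auto
  then have "card {\<zero>\<^bsub>?R\<^esub>, \<one>\<^bsub>?R\<^esub>} \<le> card (carrier ?R)"
    by (intro card_mono finite_residue_field[OF F])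
  then show "residue_degree \<rat> F (P \<inter> F) > 0" unfolding c by (intro Nat.gr0I) auto
qed

end

text \<open>Reduce \<open>m\<close> modulo \<open>f\<close> by \<open>p\<^sup>m - 1 = p\<^sup>m\<^sup>-\<^sup>f (p\<^sup>f - 1) + (p\<^sup>m\<^sup>-\<^sup>f - 1)\<close>.\<close>

lemma power_minus_1_dvd:
  fixes p f m :: nat
  assumes "p > 1" "f > 0" "p ^ f - 1 dvd p ^ m - 1"
  shows "f dvd m"
  using assms(3)
proof (induction m rule: less_induct)
  case (less m)
  show ?case
  proof (cases "m < f")
    case True
    then have "p ^ m < p ^ f" using assms(1) by simp
    moreover have "p ^ m \<ge> 1" using assms(1) by simp
    ultimately have "p ^ m - 1 < p ^ f - 1" by linarith
    then have "p ^ m - 1 = 0" using less.prems by (meson dvd_imp_le not_gr0 not_le)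
    then have "p ^ m = 1" using \<open>p ^ m \<ge> 1\<close> by linarith
    then have "m = 0" using assms(1) by simp
    then show ?thesis by simp
  next
    case False
    then have "p ^ m = p ^ (m - f) * p ^ f" by (simp flip: power_add)
    moreover have "p ^ (m - f) \<ge> 1" "p ^ f \<ge> 1" using assms(1) by auto
    ultimately have "p ^ m - 1 = p ^ (m - f) * (p ^ f - 1) + (p ^ (m - f) - 1)"
      by (simp add: diff_mult_distrib2)
    moreover have "p ^ f - 1 dvd p ^ (m - f) * (p ^ f - 1)" by simp
    ultimately have "p ^ f - 1 dvd p ^ (m - f) - 1"
      using less.prems by (simp only: dvd_add_right_iff)
    then have "f dvd m - f" using less.IH[of "m - f"] False assms(2) by simp
    then have "f dvd (m - f) + f" by simp
    then show ?thesis using False by simp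
  qed
qed

context galois_place
begin

section \<open>Lifting residue field endomorphisms\<close>

text \<open>If \<open>\<sigma> e \<in> P\<close> implied \<open>e \<in> P\<close> for all integers \<open>e\<close>, then \<open>\<sigma>\<^sup>-\<^sup>1 P \<subseteq> P\<close> and hence \<open>\<sigma> P = P\<close>. So each of the other \<open>\<sigma>\<close> has an
  \<open>e\<close> that violates this implication, and their product is outside of the prime ideal \<open>P\<close>.\<close>

lemma separating_element:
  assumes HG: "H \<subseteq> G"
  obtains E where "algebraic_int E" "E \<notin> P" "\<And>\<sigma>. \<sigma> \<in> H \<Longrightarrow> \<sigma> ` P \<noteq> P \<Longrightarrow> \<sigma> E \<in> P"
proof -
  define bad where "bad = {\<sigma> \<in> H. \<sigma> ` P \<noteq> P}"
  have ex_e: "\<exists>e. algebraic_int e \<and> e \<notin> P \<and> \<sigma> e \<in> P" if "\<sigma> \<in> bad" for \<sigma>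
  proof (rule ccontr)
    assume c: "\<not> ?thesis"
    have \<sigma>: "\<sigma> \<in> G" using that HG by (auto simp: bad_def)
    have surj: "\<sigma> (inv_into UNIV \<sigma> x) = x" for x
      by (rule Gal_apply_inv[OF \<sigma>])
    have inv: "inv_into UNIV \<sigma> \<in> G" by (rule Gal_inv_closed[OF \<sigma>])
    have "inv_into UNIV \<sigma> ` P = P"
    proof (rule Gal_image_eqI[OF inv])
      fix x assume "x \<in> P"
      then show "inv_into UNIV \<sigma> x \<in> P"
        using c surj[of x] Gal_algebraic_int[OF inv P_alg] by metis
    qed
    then have "\<sigma> ` P = \<sigma> ` inv_into UNIV \<sigma> ` P" by simp
    also have "\<dots> = P" using surj by (simp add: image_image)
    finally show False using that by (simp add: bad_def)
  qed
  define e where "e = (\<lambda>\<sigma>. SOME e. algebraic_int e \<and> e \<notin> P \<and> \<sigma> e \<in> P)"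
  have e: "algebraic_int (e \<sigma>)" "e \<sigma> \<notin> P" "\<sigma> (e \<sigma>) \<in> P" if "\<sigma> \<in> bad" for \<sigma>
    using someI_ex[OF ex_e[OF that]] by (auto simp: e_def)
  have finbad: "finite bad" using finite_subset[OF HG finite_G] by (simp add: bad_def)
  define E where "E = prod e bad"
  have E: "algebraic_int E" "E \<notin> P"
    using P_prod[OF finbad, of e] e by (auto simp: E_def intro: alg_prod)
  have \<sigma>E: "\<sigma> E \<in> P" if "\<sigma> \<in> bad" for \<sigma>
  proof -
    have \<sigma>: "\<sigma> \<in> G" using that HG by (auto simp: bad_def)
    have "\<sigma> E = \<sigma> (e \<sigma>) * \<sigma> (prod e (bad - {\<sigma>}))"
      unfolding E_def prod.remove[OF finbad that] by (rule Gal_times[OF \<sigma>])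
    moreover have "algebraic_int (\<sigma> (prod e (bad - {\<sigma>})))"
      using e by (intro Gal_algebraic_int[OF \<sigma>] alg_prod) auto
    ultimately show ?thesis using e(3)[OF that] P_mult' by simp
  qed
  show ?thesis by (rule that[OF E]) (use \<sigma>E in \<open>auto simp: bad_def\<close>)
qed

text \<open>This is the classical surjectivity of the decomposition group onto the Galois group of the
  residue field extension, for an arbitrary group \<open>H\<close> of automorphisms and a map \<open>t\<close> that induces
  an endomorphism of the residue field. Let \<open>\<alpha>\<close> represent a generator of the multiplicative group
  of the residue field and lie in \<open>\<sigma>\<^sup>-\<^sup>1 P\<close> whenever \<open>\<sigma> P \<noteq> P\<close>. The polynomial \<open>\<Prod>\<^sub>\<sigma> (X - \<sigma> \<alpha>)\<close> has
  invariant coefficients, so \<open>t \<alpha>\<close> is another root of it modulo \<open>P\<close>, hence congruent to some \<open>\<sigma> \<alpha>\<close>. As \<open>t \<alpha>\<close>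
  is a unit modulo \<open>P\<close>, this \<open>\<sigma>\<close> stabilizes \<open>P\<close>; and it agrees with \<open>t\<close> on a generator.\<close>

theorem residue_endomorphism_lifts:
  fixes t :: "'a \<Rightarrow> 'a"
  assumes H: "subgroup H (Gal \<rat>)"
    and t_alg: "\<And>x. algebraic_int x \<Longrightarrow> algebraic_int (t x)"
    and t_cong: "\<And>x y. algebraic_int x \<Longrightarrow> algebraic_int y \<Longrightarrow> x \<doteq> y \<Longrightarrow> t x \<doteq> t y"
    and t_add: "\<And>x y. algebraic_int x \<Longrightarrow> algebraic_int y \<Longrightarrow> t (x + y) \<doteq> t x + t y"
    and t_mult: "\<And>x y. algebraic_int x \<Longrightarrow> algebraic_int y \<Longrightarrow> t (x * y) \<doteq> t x * t y"
    and t_fixed: "\<And>x. algebraic_int x \<Longrightarrow> (\<And>\<sigma>. \<sigma> \<in> H \<Longrightarrow> \<sigma> x = x) \<Longrightarrow> t x \<doteq> x"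
  shows "\<exists>d\<in>H. d ` P = P \<and> (\<forall>x. algebraic_int x \<longrightarrow> d x \<doteq> t x)"
proof -
  interpret H: subgroup H "Gal \<rat>" by fact
  have HG: "H \<subseteq> G" by (rule H.subset)
  have finH: "finite H" using HG finite_G finite_subset by blast
  have HGal: "\<sigma> \<in> H \<Longrightarrow> \<sigma> \<in> G" for \<sigma> using HG by blast
  have t_0: "t 0 \<doteq> 0" and t_1: "t 1 \<doteq> 1"
    by (rule t_fixed; use HGal Gal_0 Gal_1 in blast)+
  have t_power: "t (x ^ n) \<doteq> t x ^ n" if x: "algebraic_int x" for x n
  proof (induction n)
    case (Suc n)
    have "t (x ^ Suc n) \<doteq> t x * t (x ^ n)" using t_mult[OF x alg_power[OF x]] by simp
    moreover have "t x * t (x ^ n) \<doteq> t x * t x ^ n"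
      by (rule cong_mult[OF cong_refl Suc]) (use x t_alg alg_power in auto)
    ultimately show ?case using cong_trans by simp
  qed (use t_1 in simp)
  have t_sum: "t (sum f A) \<doteq> (\<Sum>i\<in>A. t (f i))"
    if "finite A" "\<And>i. i \<in> A \<Longrightarrow> algebraic_int (f i)" for f and A :: "nat set"
    using that
  proof (induction A rule: finite_induct)
    case (insert i A)
    then have "t (f i + sum f A) \<doteq> t (f i) + t (sum f A)" by (intro t_add alg_sum) auto
    moreover have "t (f i) + t (sum f A) \<doteq> t (f i) + (\<Sum>i\<in>A. t (f i))"
      by (rule cong_add[OF cong_refl]) (use insert in auto)
    ultimately show ?case using insert cong_trans by simp
  qed (use t_0 in simp)
  obtain g where g: "algebraic_int g" "g \<notin> P"
      "\<And>x. algebraic_int x \<Longrightarrow> x \<notin> P \<Longrightarrow> \<exists>k. x \<doteq> g ^ k"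
    using residue_generator[OF UNIV_subfield] by (metis UNIV_I)
  define bad where "bad = {\<sigma> \<in> H. \<sigma> ` P \<noteq> P}"
  obtain E where E: "algebraic_int E" "E \<notin> P" and "\<And>\<sigma>. \<sigma> \<in> H \<Longrightarrow> \<sigma> ` P \<noteq> P \<Longrightarrow> \<sigma> E \<in> P"
    using separating_element[OF HG] by blast
  then have \<sigma>E: "\<sigma> E \<in> P" if "\<sigma> \<in> bad" for \<sigma> using that by (simp add: bad_def)
  obtain N where N: "N > 0" "E ^ N \<doteq> 1" using power_cong_1[OF E] .
  \<comment> \<open>Multiplying by \<open>E ^ N\<close> moves the generator into the other conjugates of \<open>P\<close>
     without changing its residue class.\<close>
  define \<alpha> where "\<alpha> = g * E ^ N"
  have \<alpha>: "algebraic_int \<alpha>" unfolding \<alpha>_def using g(1) E(1) alg_mult alg_power by blast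
  have \<alpha>g: "\<alpha> \<doteq> g" using cong_mult[OF cong_refl N(2) g(1) alg_power[OF E(1)]] by (simp add: \<alpha>_def)
  have \<sigma>\<alpha>: "\<sigma> \<alpha> \<in> P" if "\<sigma> \<in> bad" for \<sigma>
  proof -
    have \<sigma>: "\<sigma> \<in> G" using that HG by (auto simp: bad_def)
    have "\<sigma> \<alpha> = \<sigma> E * (\<sigma> g * \<sigma> E ^ (N - 1))"
      unfolding \<alpha>_def Gal_times[OF \<sigma>] Gal_power[OF \<sigma>] using N(1)
      by (cases N) (simp_all add: algebra_simps)
    moreover have "algebraic_int (\<sigma> g * \<sigma> E ^ (N - 1))"
      by (intro alg_mult alg_power Gal_algebraic_int[OF \<sigma>] g(1) E(1))
    ultimately show ?thesis using P_mult'[OF \<sigma>E[OF that]] by simp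
  qed
  have \<alpha>P: "\<alpha> \<notin> P" using cong_mem[OF \<alpha>g] g(2) by simp
  have t\<alpha>P: "t \<alpha> \<notin> P"
  proof
    assume ta: "t \<alpha> \<in> P"
    obtain M where M: "M > 0" "\<alpha> ^ M \<doteq> 1" using power_cong_1[OF \<alpha> \<alpha>P] .
    have "t \<alpha> ^ M \<doteq> t (\<alpha> ^ M)" using t_power[OF \<alpha>] cong_sym by blast
    moreover have "t (\<alpha> ^ M) \<doteq> t 1" using t_cong[OF alg_power[OF \<alpha>] _ M(2)] by simp
    ultimately have "t \<alpha> ^ M \<doteq> 1" using t_1 cong_trans by blast
    moreover have "t \<alpha> * t \<alpha> ^ (M - 1) \<in> P"
      by (rule P_mult'[OF ta alg_power[OF t_alg[OF \<alpha>]]])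
    ultimately show False using M(1) P_1 cong_mem by (simp flip: power_Suc)
  qed
  let ?c = "\<lambda>i. poly.coeff (orbit_poly H \<alpha>) i"
  have c_alg: "algebraic_int (?c i)" for i by (rule coeff_orbit_poly_alg[OF HG \<alpha>])
  have c_fixed: "t (?c i) \<doteq> ?c i" for i
    by (rule t_fixed[OF c_alg]) (rule coeff_orbit_poly_fixed[OF H])
  let ?n = "Polynomial.degree (orbit_poly H \<alpha>)"
  have "poly (orbit_poly H \<alpha>) \<alpha> = 0"
    unfolding poly_orbit_poly using finH H.one_closed by (auto simp: Gal_one intro!: bexI[of _ id])
  then have "t 0 \<doteq> (\<Sum>i\<le>?n. t (?c i * \<alpha> ^ i))"
    using t_sum[of "{..?n}" "\<lambda>i. ?c i * \<alpha> ^ i"] c_alg \<alpha> alg_mult alg_power by (simp add: poly_altdef)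
  moreover have "(\<Sum>i\<le>?n. t (?c i * \<alpha> ^ i)) \<doteq> (\<Sum>i\<le>?n. ?c i * t \<alpha> ^ i)"
  proof -
    have "t (?c i * \<alpha> ^ i) \<doteq> ?c i * t \<alpha> ^ i" for i
    proof -
      have "t (?c i * \<alpha> ^ i) \<doteq> t (?c i) * t (\<alpha> ^ i)" by (rule t_mult[OF c_alg alg_power[OF \<alpha>]])
      moreover have "t (?c i) * t (\<alpha> ^ i) \<doteq> ?c i * t \<alpha> ^ i"
        by (rule cong_mult[OF c_fixed t_power[OF \<alpha>] c_alg t_alg[OF alg_power[OF \<alpha>]]])
      ultimately show ?thesis by (rule cong_trans)
    qed
    then show ?thesis unfolding sum_subtractf[symmetric] by (intro P_sum) auto
  qed
  ultimately have "t 0 \<doteq> poly (orbit_poly H \<alpha>) (t \<alpha>)" unfolding poly_altdef by (rule cong_trans)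
  then have "(\<Prod>\<sigma>\<in>H. t \<alpha> - \<sigma> \<alpha>) \<in> P"
    using t_0 cong_mem[of "t 0" "\<Prod>\<sigma>\<in>H. t \<alpha> - \<sigma> \<alpha>"] by (simp add: poly_orbit_poly)
  moreover have "algebraic_int (t \<alpha> - \<sigma> \<alpha>)" if "\<sigma> \<in> H" for \<sigma>
    by (intro alg_diff t_alg Gal_algebraic_int[OF HGal[OF that]] \<alpha>)
  ultimately obtain d where d: "d \<in> H" "t \<alpha> \<doteq> d \<alpha>"
    using P_prod[OF finH, of "\<lambda>\<sigma>. t \<alpha> - \<sigma> \<alpha>"] by auto
  have dG: "d \<in> G" using d HG by blast
  have "d \<notin> bad" using \<sigma>\<alpha> t\<alpha>P cong_mem[OF d(2)] by blast
  then have dP: "d ` P = P" using d(1) by (simp add: bad_def)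
  have "d x \<doteq> t x" if x: "algebraic_int x" for x
  proof (cases "x \<in> P")
    case True
    then have "d x \<in> P" using dP by blast
    moreover have "t x \<doteq> t 0" using t_cong[OF x] True by simp
    then have "t x \<in> P" using t_0 cong_mem by simp
    ultimately show ?thesis by (rule P_diff)
  next
    case False
    obtain k where "x \<doteq> g ^ k" using g(3)[OF x False] by blast
    moreover have "g ^ k \<doteq> \<alpha> ^ k" by (rule cong_power[OF cong_sym[OF \<alpha>g] \<alpha>])
    ultimately have xk: "x \<doteq> \<alpha> ^ k" by (rule cong_trans)
    have "d x \<doteq> d \<alpha> ^ k" using decomposition_cong[OF dG dP xk] by (simp add: Gal_power[OF dG])
    moreover have "d \<alpha> ^ k \<doteq> t \<alpha> ^ k" by (rule cong_power[OF cong_sym[OF d(2)] t_alg[OF \<alpha>]])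
    moreover have "t \<alpha> ^ k \<doteq> t (\<alpha> ^ k)" using t_power[OF \<alpha>] cong_sym by blast
    moreover have "t (\<alpha> ^ k) \<doteq> t x" using t_cong[OF alg_power[OF \<alpha>] x cong_sym[OF xk]] .
    ultimately show ?thesis using cong_trans by blast
  qed
  then show ?thesis using d(1) dP by blast
qed

lemma decomposition_lifts:
  assumes H: "subgroup H (Gal \<rat>)" and c: "c \<in> G" "c ` P = P"
    and fixed: "\<And>x. algebraic_int x \<Longrightarrow> (\<And>\<sigma>. \<sigma> \<in> H \<Longrightarrow> \<sigma> x = x) \<Longrightarrow> c x \<doteq> x"
  shows "\<exists>d\<in>H. d ` P = P \<and> (\<forall>x. algebraic_int x \<longrightarrow> d x \<doteq> c x)"
proof (rule residue_endomorphism_lifts[OF H])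
  show "c (x + y) \<doteq> c x + c y" "c (x * y) \<doteq> c x * c y" for x y
    by (simp_all add: Gal_add[OF c(1)] Gal_times[OF c(1)] P_0)
qed (rule Gal_algebraic_int[OF c(1)] decomposition_cong[OF c] fixed; assumption)+

section \<open>Frobenius elements\<close>

lemma frobenius_add:
  assumes "algebraic_int x" "algebraic_int y"
  shows "(x + y) ^ p \<doteq> x ^ p + y ^ p"
proof -
  let ?f = "\<lambda>k. of_nat (p choose k) * x ^ k * y ^ (p - k) :: 'a"
  have "(x + y) ^ p = (\<Sum>k\<le>p. ?f k)" by (rule binomial_ring)
  also have "{..p} = insert 0 (insert p {1..<p})" using p_pos by auto
  also have "(\<Sum>k\<in>insert 0 (insert p {1..<p}). ?f k) = y ^ p + (x ^ p + (\<Sum>k\<in>{1..<p}. ?f k))"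
    using p_pos by simp
  finally have "(x + y) ^ p - (x ^ p + y ^ p) = (\<Sum>k\<in>{1..<p}. ?f k)" by simp
  also have "\<dots> \<in> P"
  proof (rule P_sum)
    fix k assume "k \<in> {1..<p}"
    then have "p dvd p choose k" using prime_p by (intro dvd_choose_prime) auto
    then have "of_nat (p choose k) \<in> P" using of_int_mem_P[of "int (p choose k)"] by simp
    then show "?f k \<in> P" using assms alg_mult alg_power P_mult' by (simp add: mult.assoc)
  qed
  finally show ?thesis .
qed

lemma frobenius_of_int: "of_int n ^ p \<doteq> of_int n"
proof -
  have nat: "of_nat n ^ p \<doteq> of_nat n" for n
  proof (induction n)
    case (Suc n)
    have "(of_nat n + 1) ^ p \<doteq> of_nat n ^ p + 1 ^ p" by (rule frobenius_add) auto
    moreover have "of_nat n ^ p + 1 ^ p \<doteq> of_nat n + 1" using Suc by simp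
    ultimately show ?case using cong_trans by (simp add: add.commute)
  qed (use p_pos P_0 in \<open>simp add: power_0_left\<close>)
  note n = of_int_cong_nat[of n]
  have "of_int n ^ p \<doteq> of_nat (nat (n mod int p)) ^ p" by (rule cong_power[OF n]) auto
  then show ?thesis using nat n cong_trans cong_sym by blast
qed

text \<open>The classes of \<open>1, \<dots>, p - 1\<close> already exhaust the solutions of \<open>y\<^sup>p\<^sup>-\<^sup>1 = 1\<close> in the residue field.\<close>

lemma frobenius_fixed_imp_int:
  assumes x: "algebraic_int x" "x ^ p \<doteq> x"
  obtains n where "x \<doteq> of_int n"
proof (cases "x \<in> P")
  case True
  then show ?thesis using that[of 0] by simp
next
  case False
  let ?R = "residue_field UNIV P"
  have field: "field ?R" using field_residue_field[OF UNIV_subfield] by simp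
  interpret R: Ring.field ?R by (rule field)
  note ce = coset_eq_iff[OF UNIV_I UNIV_I UNIV_subfield, simplified]
  have pow: "coset P z [^]\<^bsub>?R\<^esub> n = coset P (z ^ n)" if "algebraic_int z" for z and n :: nat
    using residue_pow[OF UNIV_subfield UNIV_I that] by simp
  have one: "\<one>\<^bsub>?R\<^esub> = coset P 1" using residue_ops(3)[OF UNIV_subfield, of 0 0] by simp
  have carr: "carrier ?R = coset P ` {x. algebraic_int x}" by (simp add: carrier_residue_field)
  let ?A = "{y \<in> carrier ?R. y [^]\<^bsub>?R\<^esub> (p - 1) = \<one>\<^bsub>?R\<^esub>}"
  have inA: "coset P z \<in> ?A" if z: "algebraic_int z" "z \<notin> P" "z ^ p \<doteq> z" for z
  proof -
    have "z * z ^ (p - 1) \<doteq> z * 1" using z(3) p_pos by (simp flip: power_Suc)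
    then have "z ^ (p - 1) \<doteq> 1"
      by (rule cong_cancel) (use z alg_power in auto)
    moreover have "coset P z \<in> carrier ?R" using z(1) by (auto simp: carr)
    ultimately show ?thesis using z(1) pow one ce by simp
  qed
  have fin: "finite (carrier ?R)" using finite_residue_field[OF UNIV_subfield] by simp
  have card: "card ?A \<le> p - 1" using R.num_roots_le_deg[OF fin, of "p - 1"] p_gt_1 by simp
  have sub: "(\<lambda>n. coset P (of_nat n)) ` {1..<p} \<subseteq> ?A"
  proof
    fix y assume "y \<in> (\<lambda>n. coset P (of_nat n)) ` {1..<p}"
    then obtain n where n: "y = coset P (of_nat n)" "0 < n" "n < p" by auto
    have "\<not> int p dvd int n" using n(2,3) by (auto dest: dvd_imp_le)
    then have "of_nat n \<notin> P" using of_int_mem_P[of "int n"] by simp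
    then show "y \<in> ?A" unfolding n(1) using frobenius_of_int[of "int n"] by (intro inA) auto
  qed
  have "inj_on (\<lambda>n. coset P (of_nat n)) {1..<p}"
    using inj_on_coset_of_nat[OF UNIV_subfield] unfolding Int_UNIV_right by (rule inj_on_subset) auto
  then have "card ((\<lambda>n. coset P (of_nat n)) ` {1..<p}) = p - 1" by (simp add: card_image)
  then have "(\<lambda>n. coset P (of_nat n)) ` {1..<p} = ?A"
    using card sub fin by (intro card_seteq) auto
  then have "coset P x \<in> (\<lambda>n. coset P (of_nat n)) ` {1..<p}" using inA[OF x(1) False x(2)] by blast
  then obtain n :: nat where "coset P x = coset P (of_nat n)" by blast
  then show ?thesis using that[of "int n"] ce by simp
qed

lemma exists_frobenius:
  obtains \<Phi> where "\<Phi> \<in> G" "\<Phi> ` P = P" "\<And>x. algebraic_int x \<Longrightarrow> \<Phi> x \<doteq> x ^ p"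
proof -
  have sub: "subgroup G (Gal \<rat>)" by (rule group.subgroup_self) simp
  have fixed: "x ^ p \<doteq> x" if x: "algebraic_int x" "\<And>\<sigma>. \<sigma> \<in> G \<Longrightarrow> \<sigma> x = x" for x
  proof -
    obtain n where "x = of_int n" using algebraic_int_fixed x by blast
    then show ?thesis using frobenius_of_int by simp
  qed
  have "\<exists>d\<in>G. d ` P = P \<and> (\<forall>x. algebraic_int x \<longrightarrow> d x \<doteq> x ^ p)"
  proof (rule residue_endomorphism_lifts[OF sub])
    show "(x * y) ^ p \<doteq> x ^ p * y ^ p" for x y by (simp add: power_mult_distrib P_0)
    show "x ^ p \<doteq> y ^ p" if "algebraic_int x" "algebraic_int y" "x \<doteq> y" for x y
      by (rule cong_power[OF that(3,2)])
  qed (rule alg_power frobenius_add fixed; assumption)+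
  then show ?thesis using that by blast
qed

lemma frobenius_power:
  assumes \<Phi>: "\<Phi> \<in> G" "\<Phi> ` P = P" "\<And>x. algebraic_int x \<Longrightarrow> \<Phi> x \<doteq> x ^ p"
    and x: "algebraic_int x"
  shows "(\<Phi> ^^ k) x \<doteq> x ^ (p ^ k)"
proof (induction k)
  case (Suc k)
  have "\<Phi> ((\<Phi> ^^ k) x) \<doteq> \<Phi> (x ^ (p ^ k))" by (rule decomposition_cong[OF \<Phi>(1,2) Suc])
  moreover have "\<Phi> (x ^ (p ^ k)) \<doteq> (x ^ (p ^ k)) ^ p" by (rule \<Phi>(3)[OF alg_power[OF x]])
  ultimately show ?case using cong_trans by (simp flip: power_mult add: mult.commute)
qed (simp add: P_0)

text \<open>Apply the lifting theorem to the group generated by a Frobenius element \<open>\<Phi>\<close>: an integer fixed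
  by \<open>\<Phi>\<close> is congruent to a rational one, so \<open>c\<close> acts trivially on it modulo \<open>P\<close>.\<close>

lemma decomposition_is_frobenius_power:
  assumes c: "c \<in> G" "c ` P = P"
  obtains k where "\<And>x. algebraic_int x \<Longrightarrow> c x \<doteq> x ^ (p ^ k)"
proof -
  obtain \<Phi> where \<Phi>: "\<Phi> \<in> G" "\<Phi> ` P = P" "\<And>x. algebraic_int x \<Longrightarrow> \<Phi> x \<doteq> x ^ p"
    using exists_frobenius by blast
  interpret GG: group "Gal \<rat> :: ('a \<Rightarrow> 'a) monoid" by simp
  let ?H = "generate (Gal \<rat>) {\<Phi>}"
  have H: "?H = {\<Phi> ^^ k | k. True}"
    using GG.generate_pow_on_finite_carrier[OF finite_G \<Phi>(1)] Gal_pow[OF \<Phi>(1)] by auto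
  have sub: "subgroup ?H (Gal \<rat>)" by (rule GG.generate_is_subgroup) (use \<Phi> in simp)
  have fixed: "c x \<doteq> x" if x: "algebraic_int x" "\<And>\<sigma>. \<sigma> \<in> ?H \<Longrightarrow> \<sigma> x = x" for x
  proof -
    have "\<Phi> x = x" by (rule x(2)) (rule generate.incl, simp)
    then have "x ^ p \<doteq> x" using \<Phi>(3)[OF x(1)] cong_sym by simp
    then obtain n where n: "x \<doteq> of_int n" using frobenius_fixed_imp_int x(1) by blast
    then have "c x \<doteq> of_int n" using decomposition_cong[OF c n] by (simp add: Gal_of_int[OF c(1)])
    then show ?thesis using n cong_trans cong_sym by blast
  qed
  obtain d where d: "d \<in> ?H" "\<And>x. algebraic_int x \<Longrightarrow> d x \<doteq> c x"
    using decomposition_lifts[OF sub c fixed] by blast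
  then obtain k where "d = \<Phi> ^^ k" using H by blast
  then have "c x \<doteq> x ^ (p ^ k)" if "algebraic_int x" for x
    using d(2)[OF that] frobenius_power[OF \<Phi> that] cong_trans cong_sym by blast
  then show ?thesis using that by blast
qed

text \<open>With \<open>f\<close> the residue degree, a generator of the multiplicative group has order \<open>p\<^sup>f - 1\<close>, so it is fixed
  by the \<open>m\<close>-th power of the Frobenius map if and only if \<open>p\<^sup>f - 1\<close> divides \<open>p\<^sup>m - 1\<close>.\<close>

lemma residue_degree_dvd_iff:
  assumes F: "subfield F ring_of_type_algebra"
  shows "(\<forall>x\<in>F. algebraic_int x \<longrightarrow> x ^ (p ^ m) \<doteq> x) \<longleftrightarrow> residue_degree \<rat> F (P \<inter> F) dvd m"
proof -
  let ?f = "residue_degree \<rat> F (P \<inter> F)"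
  obtain g where g: "g \<in> F" "algebraic_int g" "g \<notin> P"
      "\<And>x. x \<in> F \<Longrightarrow> algebraic_int x \<Longrightarrow> x \<notin> P \<Longrightarrow> \<exists>k. x \<doteq> g ^ k"
      "\<And>k. g ^ k \<doteq> 1 \<longleftrightarrow> p ^ ?f - 1 dvd k"
    using residue_generator[OF F] card_residue_field(1)[OF F] by metis
  show ?thesis
  proof
    assume "\<forall>x\<in>F. algebraic_int x \<longrightarrow> x ^ (p ^ m) \<doteq> x"
    then have "g ^ (p ^ m) \<doteq> g" using g by blast
    then have "g * g ^ (p ^ m - 1) \<doteq> g * 1" using p_pos by (simp flip: power_Suc)
    then have "g ^ (p ^ m - 1) \<doteq> 1" by (rule cong_cancel) (use g alg_power in auto)
    then show "?f dvd m"
      using g(5) power_minus_1_dvd[OF p_gt_1 card_residue_field(2)[OF F]] by blast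
  next
    assume "?f dvd m"
    then obtain q where m: "m = ?f * q" by blast
    have step: "x ^ (p ^ ?f) \<doteq> x" if x: "x \<in> F" "algebraic_int x" for x
    proof (cases "x \<in> P")
      case True
      then have "x * x ^ (p ^ ?f - 1) \<in> P" using P_mult' alg_power x by blast
      then show ?thesis using True p_pos P_diff by (simp flip: power_Suc)
    next
      case False
      obtain k where k: "x \<doteq> g ^ k" using g(4)[OF x False] by blast
      have "x ^ (p ^ ?f - 1) \<doteq> (g ^ k) ^ (p ^ ?f - 1)" by (rule cong_power[OF k alg_power[OF g(2)]])
      moreover have "(g ^ k) ^ (p ^ ?f - 1) \<doteq> 1" unfolding power_mult[symmetric] g(5) by simp
      ultimately have "x ^ (p ^ ?f - 1) \<doteq> 1" by (rule cong_trans)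
      then have "x * x ^ (p ^ ?f - 1) \<doteq> x * 1" using x alg_power by (intro cong_mult) (auto simp: P_0)
      then show ?thesis using p_pos by (simp flip: power_Suc)
    qed
    show "\<forall>x\<in>F. algebraic_int x \<longrightarrow> x ^ (p ^ m) \<doteq> x"
    proof (intro ballI impI)
      fix x assume x: "x \<in> F" "algebraic_int x"
      show "x ^ (p ^ m) \<doteq> x" unfolding m
      proof (induction q)
        case (Suc q)
        have "(x ^ (p ^ (?f * q))) ^ (p ^ ?f) \<doteq> x ^ (p ^ ?f)" by (rule cong_power[OF Suc x(2)])
        then have "(x ^ (p ^ (?f * q))) ^ (p ^ ?f) \<doteq> x" using step[OF x] cong_trans by blast
        then show ?case by (simp add: power_add mult.commute flip: power_mult)
      qed (simp add: P_0)
    qed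
  qed
qed

lemma decomposition_inv:
  assumes "c \<in> G" "c ` P = P"
  shows "inv_into UNIV c ` P = P"
  using arg_cong[OF assms(2), of "(`) (inv_into UNIV c)"] by (simp add: image_image Gal_inv_apply[OF assms(1)])

lemma decomposition_power:
  assumes c: "c \<in> G" "c ` P = P"
  shows "(c ^^ m) ` P = P"
proof (induction m)
  case (Suc m)
  have "(c ^^ Suc m) ` P = c ` (c ^^ m) ` P" by (simp add: image_comp)
  then show ?case using Suc c(2) by simp
qed simp

text \<open>On the residue field of \<open>P\<close>, the Frobenius map is a power of \<open>c\<close>, and \<open>c\<close> is a power of the Frobenius
  map. So \<open>c\<^sup>m\<close> is trivial on the residue field of \<open>F\<close> if and only if the \<open>m\<close>-th power of the Frobenius map is.\<close>

lemma fixes_residue_field_iff: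
  assumes F: "subfield F ring_of_type_algebra"
    and c: "c \<in> G" "c ` P = P" and gen: "\<And>x. algebraic_int x \<Longrightarrow> (c ^^ j) x \<doteq> x ^ p"
  shows "(\<forall>x\<in>F. algebraic_int x \<longrightarrow> (c ^^ m) x \<doteq> x) \<longleftrightarrow> residue_degree \<rat> F (P \<inter> F) dvd m"
proof -
  have frobm: "((c ^^ j) ^^ m) x \<doteq> x ^ (p ^ m)" if "algebraic_int x" for x m
    by (rule frobenius_power[OF Gal_pow_closed[OF c(1)] decomposition_power[OF c] gen that])
  obtain k where k: "\<And>x. algebraic_int x \<Longrightarrow> c x \<doteq> x ^ (p ^ k)"
    using decomposition_is_frobenius_power[OF c] by blast
  have ck: "(c ^^ m) x \<doteq> x ^ (p ^ (k * m))" if x: "algebraic_int x" for x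
  proof (induction m)
    case (Suc m)
    have "c ((c ^^ m) x) \<doteq> c (x ^ (p ^ (k * m)))" by (rule decomposition_cong[OF c Suc])
    moreover have "c (x ^ (p ^ (k * m))) \<doteq> (x ^ (p ^ (k * m))) ^ (p ^ k)" by (rule k[OF alg_power[OF x]])
    ultimately have "c ((c ^^ m) x) \<doteq> (x ^ (p ^ (k * m))) ^ (p ^ k)" by (rule cong_trans)
    then show ?case by (simp add: power_add mult.commute flip: power_mult)
  qed (simp add: P_0)
  show ?thesis unfolding residue_degree_dvd_iff[OF F, symmetric]
  proof (intro iffI ballI impI)
    fix x assume triv: "\<forall>x\<in>F. algebraic_int x \<longrightarrow> (c ^^ m) x \<doteq> x" and x: "x \<in> F" "algebraic_int x"
    have "((c ^^ m) ^^ i) x \<doteq> x" for i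
    proof (induction i)
      case (Suc i)
      have "(c ^^ m) (((c ^^ m) ^^ i) x) \<doteq> (c ^^ m) x"
        by (rule decomposition_cong[OF Gal_pow_closed[OF c(1)] decomposition_power[OF c] Suc])
      then show ?case using triv x cong_trans by (simp) 
    qed (simp add: P_0)
    then have "((c ^^ m) ^^ j) x \<doteq> x" .
    moreover have "(c ^^ m) ^^ j = (c ^^ j) ^^ m" by (simp add: funpow_mult mult.commute)
    ultimately show "x ^ (p ^ m) \<doteq> x" using frobm[OF x(2), of m] cong_trans cong_sym by metis
  next
    fix x assume triv: "\<forall>x\<in>F. algebraic_int x \<longrightarrow> x ^ (p ^ m) \<doteq> x" and x: "x \<in> F" "algebraic_int x"
    then have "residue_degree \<rat> F (P \<inter> F) dvd k * m" using residue_degree_dvd_iff[OF F] by (metis dvd_mult)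
    then have "x ^ (p ^ (k * m)) \<doteq> x" using residue_degree_dvd_iff[OF F] x by blast
    then show "(c ^^ m) x \<doteq> x" using ck[OF x(2)] cong_trans by blast
  qed
qed

lemma trivial_on_subfield_lifts:
  assumes F: "subfield F ring_of_type_algebra"
    and c: "c \<in> G" "c ` P = P" and triv: "\<And>x. x \<in> F \<Longrightarrow> algebraic_int x \<Longrightarrow> c x \<doteq> x"
  obtains h where "h \<in> carrier (Gal F)" "h ` P = P" "\<And>x. algebraic_int x \<Longrightarrow> h x \<doteq> c x"
proof -
  have sub: "subgroup (carrier (Gal F)) (Gal \<rat>)"
  proof (rule group.subgroupI)
    fix f g assume "f \<in> carrier (Gal F)" "g \<in> carrier (Gal F)"
    then show "f \<otimes>\<^bsub>Gal \<rat>\<^esub> g \<in> carrier (Gal F)" using Gal_mult Gal_comp by metis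
  next
    fix f assume f: "f \<in> carrier (Gal F)"
    then have "f \<in> G" using Gal_subset_G by blast
    then show "inv\<^bsub>Gal \<rat>\<^esub> f \<in> carrier (Gal F)" using Gal_inv Gal_inv_closed[OF f] by metis
  next
    have "id \<in> carrier (Gal F)" by (simp add: Gal_iff)
    then show "carrier (Gal F) \<noteq> {}" by blast
  qed (use Gal_subset_G in auto)
  have fixed: "c x \<doteq> x" if "algebraic_int x" "\<And>\<sigma>. \<sigma> \<in> carrier (Gal F) \<Longrightarrow> \<sigma> x = x" for x
    using triv fixed_by_Gal_imp_mem[OF galois F] that by blast
  show ?thesis using decomposition_lifts[OF sub c fixed] that by blast
qed

text \<open>An element of \<open>Gal F\<close> is trivial on the residue field of \<open>F\<close>. Conversely, if \<open>c\<^sup>m\<close> is trivial there, it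
  acts on the residue field of \<open>P\<close> like some element of \<open>Gal F\<close>.\<close>

lemma Gal_meets_coset_iff:
  assumes F: "subfield F ring_of_type_algebra"
    and c: "c \<in> G" "c ` P = P" and gen: "\<And>x. algebraic_int x \<Longrightarrow> (c ^^ j) x \<doteq> x ^ p"
  shows "(\<exists>h\<in>carrier (Gal F). h ` P = P \<and> (\<forall>x. algebraic_int x \<longrightarrow> h x \<doteq> (c ^^ m) x))
    \<longleftrightarrow> residue_degree \<rat> F (P \<inter> F) dvd m"
proof
  assume "\<exists>h\<in>carrier (Gal F). h ` P = P \<and> (\<forall>x. algebraic_int x \<longrightarrow> h x \<doteq> (c ^^ m) x)"
  then obtain h where h: "h \<in> carrier (Gal F)" "\<forall>x. algebraic_int x \<longrightarrow> h x \<doteq> (c ^^ m) x" by blast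
  have "(c ^^ m) x \<doteq> x" if "x \<in> F" "algebraic_int x" for x
  proof -
    have "h x = x" using h(1) that(1) by (simp add: Gal_iff)
    then show ?thesis using h(2) that(2) cong_sym by metis
  qed
  then show "residue_degree \<rat> F (P \<inter> F) dvd m" using fixes_residue_field_iff[OF F c gen] by blast
next
  assume "residue_degree \<rat> F (P \<inter> F) dvd m"
  then have "\<And>x. x \<in> F \<Longrightarrow> algebraic_int x \<Longrightarrow> (c ^^ m) x \<doteq> x"
    using fixes_residue_field_iff[OF F c gen] by blast
  from trivial_on_subfield_lifts[OF F Gal_pow_closed[OF c(1)] decomposition_power[OF c] this]
  show "\<exists>h\<in>carrier (Gal F). h ` P = P \<and> (\<forall>x. algebraic_int x \<longrightarrow> h x \<doteq> (c ^^ m) x)" by metis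
qed

end

section \<open>The places of a subfield\<close>

context galois_place
begin

text \<open>The non-leading coefficients of the characteristic polynomial of such an \<open>x\<close> are rational
  integers in \<open>P\<close>, that is, multiples of \<open>p\<close>.\<close>

lemma power_dvd_p_of_conjugates_mem:
  assumes x: "algebraic_int x" "\<And>\<sigma>. \<sigma> \<in> G \<Longrightarrow> \<sigma> x \<in> P"
  shows "algebraic_int (x ^ card G / of_nat p)"
proof -
  have "\<forall>i. poly.coeff (\<Prod>\<sigma>\<in>S. [:- \<sigma> x, 1:]) i - poly.coeff (Polynomial.monom 1 (card S)) i \<in> P"
    if "finite S" "S \<subseteq> G" for S
    using that
  proof (induction S rule: finite_induct)
    case (insert \<sigma> S)
    let ?q = "\<Prod>\<sigma>\<in>S. [:- \<sigma> x, 1:]"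
    have IH: "poly.coeff ?q i - poly.coeff (Polynomial.monom 1 (card S)) i \<in> P" for i
      using insert by auto
    have alg: "algebraic_int (poly.coeff ?q i)" for i
      using coeff_orbit_poly_alg[of S x i] x(1) insert.prems by (simp add: orbit_poly_def)
    have \<sigma>: "\<sigma> x \<in> P" using x(2) insert by auto
    have swap: "a - b - c = a - c - b" for a b c :: 'a by simp
    show ?case
    proof
      fix i
      have eq: "poly.coeff (\<Prod>\<sigma>\<in>insert \<sigma> S. [:- \<sigma> x, 1:]) i
          = (case i of 0 \<Rightarrow> 0 | Suc j \<Rightarrow> poly.coeff ?q j) - \<sigma> x * poly.coeff ?q i"
        using insert by (simp add: coeff_pCons split: nat.split)
      have m1: "\<sigma> x * poly.coeff ?q i \<in> P" by (rule P_mult'[OF \<sigma> alg])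
      have m2: "(case i of 0 \<Rightarrow> 0 | Suc j \<Rightarrow> poly.coeff ?q j)
          - poly.coeff (Polynomial.monom 1 (card (insert \<sigma> S))) i \<in> P"
        using insert(1,2) IH[of "i - 1"] by (cases i) (simp_all add: P_0)
      show "poly.coeff (\<Prod>\<sigma>\<in>insert \<sigma> S. [:- \<sigma> x, 1:]) i
          - poly.coeff (Polynomial.monom 1 (card (insert \<sigma> S))) i \<in> P"
        unfolding eq by (subst swap) (rule P_diff[OF m2 m1])
    qed
  qed (simp add: P_0)
  from this[OF finite_G order.refl]
  have cP: "poly.coeff (orbit_poly G x) i - poly.coeff (Polynomial.monom 1 (card G)) i \<in> P" for i
    by (simp add: orbit_poly_def)
  define r where "r = orbit_poly G x - Polynomial.monom 1 (card G)"
  have sub: "subgroup G (Gal \<rat>)" by (rule group.subgroup_self) simp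
  have r: "algebraic_int (poly.coeff r i / of_nat p)" for i
  proof -
    have rP: "poly.coeff r i \<in> P" using cP by (simp add: r_def)
    have "\<sigma> (poly.coeff r i) = poly.coeff r i" if "\<sigma> \<in> G" for \<sigma>
      using coeff_orbit_poly_fixed[OF sub that, of x i] Gal_0[OF that] Gal_1[OF that]
      by (simp add: r_def Gal_diff[OF that])
    then obtain n where n: "poly.coeff r i = of_int n" using algebraic_int_fixed P_alg[OF rP] by metis
    then obtain m where "n = int p * m" using rP of_int_mem_P by (metis dvdE)
    then show ?thesis using n p_pos by simp
  qed
  have "poly (orbit_poly G x) x = 0"
    unfolding poly_orbit_poly using finite_G by (auto intro!: bexI[of _ id] simp: Gal_iff)
  then have "poly r x = - (x ^ card G)" by (simp add: r_def poly_monom)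
  then have "x ^ card G = - (\<Sum>i\<le>Polynomial.degree r. poly.coeff r i * x ^ i)"
    unfolding poly_altdef by (metis minus_minus)
  then have "x ^ card G / of_nat p = - (\<Sum>i\<le>Polynomial.degree r. poly.coeff r i / of_nat p * x ^ i)"
    by (simp add: sum_divide_distrib)
  moreover have "algebraic_int (\<Sum>i\<le>Polynomial.degree r. poly.coeff r i / of_nat p * x ^ i)"
    using r x(1) by (intro alg_sum alg_mult alg_power) auto
  ultimately show ?thesis by (simp only: algebraic_int_minus_iff)
qed

text \<open>If no conjugate of \<open>P\<close> lay above \<open>Q\<close>, the product of elements witnessing this would lie in
  every conjugate of \<open>P\<close> but not in \<open>Q\<close>, although a power of it is a multiple of \<open>p\<close>.\<close>

theorem places_above_subfield:
  assumes F: "subfield F ring_of_type_algebra"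
  shows "places_above F p = (\<lambda>g. g ` P \<inter> F) ` G"
proof
  show "(\<lambda>g. g ` P \<inter> F) ` G \<subseteq> places_above F p"
  proof
    fix Q assume "Q \<in> (\<lambda>g. g ` P \<inter> F) ` G"
    then obtain g where g: "g \<in> G" "Q = g ` P \<inter> F" by blast
    interpret g: galois_place p "g ` P" by (rule galois_place_image[OF g(1)])
    show "Q \<in> places_above F p"
      unfolding g(2) places_above_def using g.primeideal_under[OF F] g.p_in_P subfield_of_nat[OF F] by blast
  qed
  show "places_above F p \<subseteq> (\<lambda>g. g ` P \<inter> F) ` G"
  proof
    fix Q assume "Q \<in> places_above F p"
    then have "primeideal Q (ring_of_integers F)" and pQ: "of_nat p \<in> Q"
      by (auto simp: places_above_def)
    then interpret I: primeideal Q "ring_of_integers F" by simp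
    have QF: "x \<in> F \<and> algebraic_int x" if "x \<in> Q" for x using I.Icarr[OF that] by simp
    have Q_mult: "y * x \<in> Q" if "x \<in> Q" "y \<in> F" "algebraic_int y" for x y
      using I.I_l_closed[of x y] that by simp
    have Q_prime: "x \<in> Q \<or> y \<in> Q" if "x * y \<in> Q" "x \<in> F" "algebraic_int x" "y \<in> F" "algebraic_int y" for x y
      using I.I_prime[of x y] that by simp
    have Q_diff: "x - y \<in> Q" if "x \<in> Q" "y \<in> Q" for x y
      using additive_subgroup.a_closed[OF I.additive_subgroup_axioms that(1) Q_mult[OF that(2), of "-1"]]
        subfield_uminus[OF F subfield_1[OF F]] by simp
    have Q_1: "1 \<notin> Q"
    proof
      assume "1 \<in> Q"
      then have "Q = carrier (ring_of_integers F)" using Q_mult[of 1] QF by auto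
      then show False using I.I_notcarr by simp
    qed
    have Q_power: "x \<in> Q" if "x ^ n \<in> Q" "x \<in> F" "algebraic_int x" for x n
      using that(1)
    proof (induction n)
      case (Suc n)
      then have "x * x ^ n \<in> Q" by simp
      then show ?case using Suc.IH Q_prime that subfield_power[OF F] alg_power by blast
    qed (use Q_1 in simp)
    have "\<exists>g\<in>G. g ` P \<inter> F \<subseteq> Q"
    proof (rule ccontr)
      assume "\<not> ?thesis"
      then have "\<forall>g\<in>G. \<exists>x. x \<in> g ` P \<and> x \<in> F \<and> x \<notin> Q" by blast
      then obtain w where w: "\<And>g. g \<in> G \<Longrightarrow> w g \<in> g ` P" "\<And>g. g \<in> G \<Longrightarrow> w g \<in> F"
          "\<And>g. g \<in> G \<Longrightarrow> w g \<notin> Q" by metis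
      have w_alg: "algebraic_int (w g)" if "g \<in> G" for g
        using w(1)[OF that] P_alg Gal_algebraic_int[OF that] by auto
      define x where "x = prod w G"
      have x: "algebraic_int x" "x \<in> F"
        unfolding x_def using w w_alg by (auto intro: alg_prod subfield_prod[OF F])
      have "prod w S \<notin> Q" if "finite S" "S \<subseteq> G" for S
        using that
      proof (induction S rule: finite_induct)
        case (insert g S)
        then have "prod w S \<in> F" "algebraic_int (prod w S)"
          using w w_alg by (auto intro!: subfield_prod[OF F] alg_prod)
        then show ?case using Q_prime[of "w g" "prod w S"] insert w w_alg by auto
      qed (use Q_1 in simp)
      then have xQ: "x \<notin> Q" unfolding x_def using finite_G by blast
      have "\<sigma> x \<in> P" if \<sigma>: "\<sigma> \<in> G" for \<sigma>
      proof -
        let ?g = "inv_into UNIV \<sigma>"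
        have g: "?g \<in> G" by (rule Gal_inv_closed[OF \<sigma>])
        have \<sigma>g: "\<sigma> (?g z) = z" for z by (rule Gal_apply_inv[OF \<sigma>])
        have "x = w ?g * prod w (G - {?g})" unfolding x_def by (rule prod.remove[OF finite_G g])
        moreover have "\<sigma> (w ?g) \<in> P" using w(1)[OF g] \<sigma>g by auto
        moreover have "algebraic_int (\<sigma> (prod w (G - {?g})))"
          using w_alg by (intro Gal_algebraic_int[OF \<sigma>] alg_prod) auto
        ultimately show ?thesis using P_mult' by (simp add: Gal_times[OF \<sigma>])
      qed
      then have "algebraic_int (x ^ card G / of_nat p)" using power_dvd_p_of_conjugates_mem x(1) by blast
      then have "x ^ card G / of_nat p * of_nat p \<in> Q"
        using x(2) by (intro Q_mult[OF pQ] subfield_divide[OF F] subfield_power[OF F] subfield_of_nat[OF F])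
      then show False using Q_power x xQ p_pos by simp
    qed
    then obtain g where g: "g \<in> G" "g ` P \<inter> F \<subseteq> Q" by blast
    interpret g: galois_place p "g ` P" by (rule galois_place_image[OF g(1)])
    have "y \<in> g ` P" if y: "y \<in> Q" for y
    proof (rule ccontr)
      assume "y \<notin> g ` P"
      then obtain N where N: "N > 0" "y ^ N - 1 \<in> g ` P" using g.power_cong_1 QF[OF y] by blast
      have "y ^ N - 1 \<in> F"
        using QF[OF y] by (intro subfield_diff[OF F] subfield_power[OF F] subfield_1[OF F]) auto
      then have "y ^ N - 1 \<in> Q" using N g(2) by blast
      moreover have "y ^ (N - 1) * y \<in> Q"
        using QF[OF y] by (intro Q_mult[OF y] subfield_power[OF F] alg_power) auto
      then have "y ^ N \<in> Q" using N(1) by (metis power_minus_mult)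
      ultimately show False using Q_diff[of "y ^ N" "y ^ N - 1"] Q_1 by simp
    qed
    then have "Q = g ` P \<inter> F" using g(2) QF by blast
    then show "Q \<in> (\<lambda>g. g ` P \<inter> F) ` G" using g(1) by blast
  qed
qed

lemma mem_splitting_type_iff:
  assumes F: "subfield F ring_of_type_algebra"
  shows "f \<in># splitting_type F p \<longleftrightarrow> (\<exists>g\<in>G. f = residue_degree \<rat> F (g ` P \<inter> F))"
  using finite_G by (auto simp: splitting_type_def places_above_subfield[OF F])

section \<open>Decomposition and inertia groups\<close>

lemma decomposition_group_iff: "\<sigma> \<in> decomposition_group L P \<longleftrightarrow> \<sigma> \<in> carrier (Gal L) \<and> \<sigma> ` P = P"
  by (simp add: decomposition_group_def)

lemma reduction_coset:
  assumes "\<sigma> \<in> G" "\<sigma> ` P = P" "algebraic_int x"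
  shows "reduction P \<sigma> (coset P x) = coset P (\<sigma> x)"
proof -
  have "coset P x \<in> carrier (residue_field UNIV P)" using assms(3) by (simp add: carrier_residue_field)
  moreover have "\<sigma> ` coset P x = (\<lambda>q. q + \<sigma> x) ` \<sigma> ` P"
    by (simp add: coset_def image_image Gal_add[OF assms(1)])
  ultimately show ?thesis using assms(2) by (simp add: reduction_def coset_def)
qed

lemma coset_P_eq_iff: "coset P x = coset P y \<longleftrightarrow> x \<doteq> y"
  using coset_eq_iff[OF UNIV_I UNIV_I UNIV_subfield] by simp

lemma residue_galois_group_one:
  "\<one>\<^bsub>residue_galois_group L E Q\<^esub> = (\<lambda>C\<in>carrier (residue_field E Q). C)"
  by (simp add: residue_galois_group_def galois_group_def BijGroup_def)

lemma inertia_group_iff: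
  "\<sigma> \<in> inertia_group \<rat> P \<longleftrightarrow> \<sigma> \<in> G \<and> \<sigma> ` P = P \<and> (\<forall>x. algebraic_int x \<longrightarrow> \<sigma> x \<doteq> x)"
proof (cases "\<sigma> \<in> G \<and> \<sigma> ` P = P")
  case True
  have "reduction P \<sigma> = (\<lambda>C\<in>carrier (residue_field UNIV P). C)
      \<longleftrightarrow> (\<forall>C\<in>carrier (residue_field UNIV P). reduction P \<sigma> C = C)"
    by (auto simp: fun_eq_iff reduction_def restrict_def)
  also have "\<dots> \<longleftrightarrow> (\<forall>x. algebraic_int x \<longrightarrow> \<sigma> x \<doteq> x)"
    using reduction_coset True coset_P_eq_iff by (auto simp: carrier_residue_field)
  finally show ?thesis
    using True by (simp add: inertia_group_def kernel_def residue_galois_group_one decomposition_group_iff)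
next
  case False
  then show ?thesis by (auto simp: inertia_group_def kernel_def decomposition_group_iff)
qed

lemma reduction_closed:
  assumes \<sigma>: "\<sigma> \<in> G" "\<sigma> ` P = P"
  shows "reduction P \<sigma> \<in> carrier (residue_galois_group \<rat> UNIV P)"
proof -
  let ?R = "residue_field UNIV P"
  have carr: "carrier ?R = coset P ` {x. algebraic_int x}" by (simp add: carrier_residue_field)
  note red = reduction_coset[OF \<sigma>]
  have iff: "\<sigma> x \<doteq> \<sigma> y \<longleftrightarrow> x \<doteq> y" for x y
    using \<sigma>(2) Gal_bij[OF \<sigma>(1)] inj_image_mem_iff[of \<sigma> "x - y" P]
    by (simp add: Gal_diff[OF \<sigma>(1)] bij_is_inj)
  have inj: "inj_on (reduction P \<sigma>) (carrier ?R)" by (simp add: inj_on_def carr red coset_P_eq_iff iff)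
  have "reduction P \<sigma> ` carrier ?R \<subseteq> carrier ?R"
    using Gal_algebraic_int[OF \<sigma>(1)] by (auto simp: carr red)
  then have "bij_betw (reduction P \<sigma>) (carrier ?R) (carrier ?R)"
    using finite_residue_field[OF UNIV_subfield] endo_inj_surj[OF _ _ inj] inj by (simp add: bij_betw_def)
  moreover have "reduction P \<sigma> \<in> ring_hom ?R ?R"
  proof (rule ring_hom_memI)
    fix C D assume "C \<in> carrier ?R" "D \<in> carrier ?R"
    then obtain x y where x: "C = coset P x" "algebraic_int x" and y: "D = coset P y" "algebraic_int y"
      by (auto simp: carr)
    note ops = residue_ops[OF UNIV_subfield, simplified]
    note alg = Gal_algebraic_int[OF \<sigma>(1)] alg_mult alg_add
    show "reduction P \<sigma> C \<in> carrier ?R" using x alg by (simp add: red carr)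
    show "reduction P \<sigma> (C \<otimes>\<^bsub>?R\<^esub> D) = reduction P \<sigma> C \<otimes>\<^bsub>?R\<^esub> reduction P \<sigma> D"
      using x y alg by (simp add: red ops(1) Gal_times[OF \<sigma>(1)])
    show "reduction P \<sigma> (C \<oplus>\<^bsub>?R\<^esub> D) = reduction P \<sigma> C \<oplus>\<^bsub>?R\<^esub> reduction P \<sigma> D"
      using x y alg by (simp add: red ops(2) Gal_add[OF \<sigma>(1)])
  next
    show "reduction P \<sigma> \<one>\<^bsub>?R\<^esub> = \<one>\<^bsub>?R\<^esub>"
      using residue_ops(3)[OF UNIV_subfield, of 0 0] red[of 1] by (simp add: Gal_1[OF \<sigma>(1)])
  qed
  moreover have "\<forall>C\<in>residue_base \<rat> UNIV P. reduction P \<sigma> C = C"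
  proof -
    have "residue_base \<rat> UNIV P = coset P ` {x \<in> \<rat>. algebraic_int x}"
      using residue_base_eq[OF Rats_subfield UNIV_subfield] by simp
    then show ?thesis using red Gal_Rats[OF \<sigma>(1)] by auto
  qed
  ultimately show ?thesis
    by (simp add: residue_galois_group_def galois_group_def Bij_def) (simp add: reduction_def)
qed

lemma Frobenius_in_powers_of_generator:
  assumes c: "c \<in> G" "c ` P = P"
    and gen: "generate (residue_galois_group \<rat> UNIV P) {reduction P c}
      = carrier (residue_galois_group \<rat> UNIV P)"
  obtains j where "\<And>x. algebraic_int x \<Longrightarrow> (c ^^ j) x \<doteq> x ^ p"
proof -
  let ?R = "residue_field UNIV P" and ?A = "residue_galois_group \<rat> UNIV P"
  have "field ?R" using field_residue_field[OF UNIV_subfield] by simp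
  then interpret R: Ring.field ?R .
  have base: "residue_base \<rat> UNIV P \<subseteq> carrier ?R"
    using residue_base_eq[OF Rats_subfield UNIV_subfield] by (auto simp: carrier_residue_field)
  interpret A: group ?A
    unfolding residue_galois_group_def by (rule group_galois_group[OF R.ring_axioms base])
  have "finite (carrier ?R)" using finite_residue_field[OF UNIV_subfield] by simp
  then have "finite (carrier ?R \<rightarrow>\<^sub>E carrier ?R)" by (intro finite_PiE) auto
  moreover have "carrier ?A \<subseteq> carrier ?R \<rightarrow>\<^sub>E carrier ?R"
    by (auto simp: residue_galois_group_def galois_group_def Bij_def PiE_def bij_betw_def)
  ultimately have fin: "finite (carrier ?A)" using finite_subset by blast
  obtain \<Phi> where \<Phi>: "\<Phi> \<in> G" "\<Phi> ` P = P" "\<And>x. algebraic_int x \<Longrightarrow> \<Phi> x \<doteq> x ^ p"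
    using exists_frobenius by blast
  have rc: "reduction P c \<in> carrier ?A" by (rule reduction_closed[OF c])
  have "reduction P \<Phi> \<in> generate ?A {reduction P c}" using gen reduction_closed[OF \<Phi>(1,2)] by simp
  then obtain j :: nat where j: "reduction P \<Phi> = reduction P c [^]\<^bsub>?A\<^esub> j"
    using A.generate_pow_on_finite_carrier[OF fin rc] by blast
  have pow: "(reduction P c [^]\<^bsub>?A\<^esub> n) (coset P x) = coset P ((c ^^ n) x)" if "algebraic_int x"
    for x and n :: nat
  proof (induction n)
    case 0
    show ?case using that by (simp add: residue_galois_group_one carrier_residue_field)
  next
    case (Suc n)
    have mult: "f \<otimes>\<^bsub>?A\<^esub> g = compose (carrier ?R) f g" if "f \<in> carrier ?A" "g \<in> carrier ?A" for f g
      using that by (simp add: residue_galois_group_def galois_group_def BijGroup_def)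
    have comm: "reduction P c [^]\<^bsub>?A\<^esub> Suc n = reduction P c \<otimes>\<^bsub>?A\<^esub> reduction P c [^]\<^bsub>?A\<^esub> n"
      using rc A.nat_pow_Suc2 by blast
    have "coset P x \<in> carrier ?R" using that by (simp add: carrier_residue_field)
    then show ?case
      using Suc rc reduction_coset[OF c Gal_algebraic_int[OF Gal_pow_closed[OF c(1)] that]]
      unfolding comm mult[OF rc A.nat_pow_closed[OF rc]] by (simp add: compose_def)
  qed
  have "(c ^^ j) x \<doteq> x ^ p" if x: "algebraic_int x" for x
  proof -
    have "coset P ((c ^^ j) x) = coset P (\<Phi> x)"
      using pow[OF x, of j] reduction_coset[OF \<Phi>(1,2) x] j by simp
    then have "(c ^^ j) x \<doteq> \<Phi> x" by (simp add: coset_P_eq_iff)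
    then show ?thesis using \<Phi>(3)[OF x] cong_trans by blast
  qed
  then show ?thesis using that by blast
qed

text \<open>As automorphisms of finite fields are powers of the Frobenius map, they preserve the residue
  field of \<open>F\<close>; so the chosen preimage in \<^const>\<open>residue_restriction\<close> is the actual one.\<close>

lemma kernel_residue_restriction:
  assumes F: "subfield F ring_of_type_algebra"
  shows "kernel (Gal \<rat>\<lparr>carrier := decomposition_group \<rat> P\<rparr>)
      (residue_galois_group \<rat> F (place_under F P))
      (\<lambda>\<sigma>. residue_restriction F P (reduction P \<sigma>))
    = {\<sigma> \<in> G. \<sigma> ` P = P \<and> (\<forall>x\<in>F. algebraic_int x \<longrightarrow> \<sigma> x \<doteq> x)}"
proof -
  let ?R = "\<kappa> F" and ?e = "residue_embedding UNIV P"
  have emb: "?e (coset (P \<inter> F) x) = coset P x" if "x \<in> F" for x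
    using residue_embedding_coset[OF F UNIV_subfield subset_UNIV that] by simp
  note ce = coset_eq_iff[OF _ _ F]
  have restrict_eq: "restrict f A = (\<lambda>C\<in>A. C) \<longleftrightarrow> (\<forall>C\<in>A. f C = C)" for f :: "'a set \<Rightarrow> 'a set" and A
    by (auto simp: restrict_def fun_eq_iff split: if_splits)
  have inj: "inj_on ?e (carrier ?R)"
    by (simp add: inj_on_def carrier_residue_field emb coset_P_eq_iff ce)
  have "residue_restriction F P (reduction P \<sigma>) = (\<lambda>C\<in>carrier ?R. C)
      \<longleftrightarrow> (\<forall>x\<in>F. algebraic_int x \<longrightarrow> \<sigma> x \<doteq> x)" if \<sigma>: "\<sigma> \<in> G" "\<sigma> ` P = P" for \<sigma>
  proof -
    obtain k where k: "\<And>x. algebraic_int x \<Longrightarrow> \<sigma> x \<doteq> x ^ (p ^ k)"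
      using decomposition_is_frobenius_power[OF \<sigma>] by blast
    have *: "inv_into (carrier ?R) ?e (reduction P \<sigma> (?e (coset (P \<inter> F) x))) = coset (P \<inter> F) (x ^ (p ^ k))"
      if x: "x \<in> F" "algebraic_int x" for x
    proof -
      have "reduction P \<sigma> (?e (coset (P \<inter> F) x)) = coset P (x ^ (p ^ k))"
        using emb[OF x(1)] reduction_coset[OF \<sigma> x(2)] k[OF x(2)] by (simp add: coset_P_eq_iff)
      also have "\<dots> = ?e (coset (P \<inter> F) (x ^ (p ^ k)))" using emb subfield_power[OF F x(1)] by simp
      finally show ?thesis
        using inv_into_f_f[OF inj, of "coset (P \<inter> F) (x ^ (p ^ k))"] subfield_power[OF F x(1)]
          alg_power[OF x(2)] by (simp add: carrier_residue_field)
    qed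
    have "residue_restriction F P (reduction P \<sigma>) = (\<lambda>C\<in>carrier ?R. C) \<longleftrightarrow>
        (\<forall>x\<in>F. algebraic_int x \<longrightarrow> coset (P \<inter> F) (x ^ (p ^ k)) = coset (P \<inter> F) x)"
      unfolding residue_restriction_def place_under_P restrict_eq
      unfolding carrier_residue_field ball_simps using *[unfolded carrier_residue_field]
      by (simp add: Ball_def imp_conjL)
    also have "\<dots> \<longleftrightarrow> (\<forall>x\<in>F. algebraic_int x \<longrightarrow> x ^ (p ^ k) \<doteq> x)"
      using ce subfield_power[OF F] by simp
    also have "\<dots> \<longleftrightarrow> (\<forall>x\<in>F. algebraic_int x \<longrightarrow> \<sigma> x \<doteq> x)"
      using k cong_trans cong_sym by blast
    finally show ?thesis .
  qed
  then show ?thesis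
    by (auto simp: kernel_def residue_galois_group_one place_under_P decomposition_group_iff)
qed

text \<open>If \<open>\<sigma>\<close> is trivial on the residue field of \<open>F\<close>, some \<open>h \<in> Gal F\<close> with \<open>h P = P\<close> acts on the residue field of \<open>P\<close>
  like \<open>\<sigma>\<close>; then \<open>\<sigma> h\<^sup>-\<^sup>1\<close> is in the inertia group.\<close>

theorem kernel_eq_inertia_times_decomposition:
  assumes F: "subfield F ring_of_type_algebra"
  shows "kernel (Gal \<rat>\<lparr>carrier := decomposition_group \<rat> P\<rparr>)
      (residue_galois_group \<rat> F (place_under F P))
      (\<lambda>\<sigma>. residue_restriction F P (reduction P \<sigma>))
    = inertia_group \<rat> P <#>\<^bsub>Gal \<rat>\<^esub> decomposition_group F P"
  unfolding kernel_residue_restriction[OF F]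
proof (intro equalityI subsetI)
  fix \<sigma> assume "\<sigma> \<in> {\<sigma> \<in> G. \<sigma> ` P = P \<and> (\<forall>x\<in>F. algebraic_int x \<longrightarrow> \<sigma> x \<doteq> x)}"
  then have \<sigma>: "\<sigma> \<in> G" "\<sigma> ` P = P" "\<And>x. x \<in> F \<Longrightarrow> algebraic_int x \<Longrightarrow> \<sigma> x \<doteq> x" by auto
  obtain h where h: "h \<in> carrier (Gal F)" "h ` P = P" "\<And>x. algebraic_int x \<Longrightarrow> h x \<doteq> \<sigma> x"
    using trivial_on_subfield_lifts[OF F \<sigma>] by blast
  have hG: "h \<in> G" using h(1) Gal_subset_G by blast
  let ?i = "\<sigma> \<circ> inv_into UNIV h"
  have h': "h (inv_into UNIV h x) = x" "inv_into UNIV h (h x) = x" for x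
    by (rule Gal_apply_inv[OF hG] Gal_inv_apply[OF hG])+
  have inv: "inv_into UNIV h \<in> G" by (rule Gal_inv_closed[OF hG])
  have i: "?i \<in> inertia_group \<rat> P"
    unfolding inertia_group_iff
  proof (intro conjI allI impI)
    show "?i \<in> G" by (rule Gal_comp[OF \<sigma>(1) inv])
    show "?i ` P = P" using \<sigma>(2) decomposition_inv[OF hG h(2)] unfolding image_comp[symmetric] by simp
    fix x :: 'a assume x: "algebraic_int x"
    show "?i x \<doteq> x"
      using h(3)[OF Gal_algebraic_int[OF inv x]] h'(1)[of x] cong_sym by simp
  qed
  have "?i \<otimes>\<^bsub>Gal \<rat>\<^esub> h = \<sigma>"
    using Gal_mult[OF Gal_comp[OF \<sigma>(1) inv] hG] h' by (simp add: fun_eq_iff)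
  moreover have "h \<in> decomposition_group F P" using h(1,2) by (simp add: decomposition_group_iff)
  then have "?i \<otimes>\<^bsub>Gal \<rat>\<^esub> h \<in> inertia_group \<rat> P <#>\<^bsub>Gal \<rat>\<^esub> decomposition_group F P"
    using i unfolding set_mult_def by blast
  ultimately show "\<sigma> \<in> inertia_group \<rat> P <#>\<^bsub>Gal \<rat>\<^esub> decomposition_group F P" by simp
next
  fix \<sigma> assume "\<sigma> \<in> inertia_group \<rat> P <#>\<^bsub>Gal \<rat>\<^esub> decomposition_group F P"
  then obtain i h where i: "i \<in> inertia_group \<rat> P" and h: "h \<in> carrier (Gal F)" "h ` P = P"
    and \<sigma>: "\<sigma> = i \<otimes>\<^bsub>Gal \<rat>\<^esub> h"
    by (auto simp: set_mult_def decomposition_group_iff)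
  have iG: "i \<in> G" "i ` P = P" "\<And>x. algebraic_int x \<Longrightarrow> i x \<doteq> x" using i by (auto simp: inertia_group_iff)
  have hG: "h \<in> G" using h(1) Gal_subset_G by blast
  have \<sigma>': "\<sigma> = i \<circ> h" using Gal_mult[OF iG(1) hG] \<sigma> by simp
  have "\<sigma> \<in> G" unfolding \<sigma>' by (rule Gal_comp[OF iG(1) hG])
  moreover have "\<sigma> ` P = P" unfolding \<sigma>' image_comp[symmetric] using iG(2) h(2) by simp
  moreover have "\<sigma> x \<doteq> x" if "x \<in> F" "algebraic_int x" for x
    using h(1) iG(3) that by (simp add: \<sigma>' Gal_iff)
  ultimately show "\<sigma> \<in> {\<sigma> \<in> G. \<sigma> ` P = P \<and> (\<forall>x\<in>F. algebraic_int x \<longrightarrow> \<sigma> x \<doteq> x)}" by blast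
qed

text \<open>Conjugation by \<open>g\<close> moves the whole situation to the place \<open>g P\<close>.\<close>

theorem conjugate_inertia_coset_meets_Gal_iff:
  assumes F: "subfield F ring_of_type_algebra"
    and c: "c \<in> G" "c ` P = P" and gen: "\<And>x. algebraic_int x \<Longrightarrow> (c ^^ j) x \<doteq> x ^ p"
  shows "(\<exists>g\<in>G. \<exists>i\<in>inertia_group \<rat> P. g \<circ> i \<circ> c ^^ m \<circ> inv_into UNIV g \<in> carrier (Gal F))
    \<longleftrightarrow> (\<exists>f. f \<in># splitting_type F p \<and> f dvd m)"
proof -
  have "(\<exists>i\<in>inertia_group \<rat> P. g \<circ> i \<circ> c ^^ m \<circ> inv_into UNIV g \<in> carrier (Gal F))
      \<longleftrightarrow> residue_degree \<rat> F (g ` P \<inter> F) dvd m" if g: "g \<in> G" for g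
  proof -
    interpret g: galois_place p "g ` P" by (rule galois_place_image[OF g])
    let ?g' = "inv_into UNIV g"
    let ?c = "g \<circ> c \<circ> ?g'"
    have g': "?g' \<in> G" by (rule Gal_inv_closed[OF g])
    have gg: "g (?g' x) = x" "?g' (g x) = x" for x
      by (rule Gal_apply_inv[OF g] Gal_inv_apply[OF g])+
    have pow: "(?c ^^ n) x = g ((c ^^ n) (?g' x))" for n x by (induction n) (simp_all add: gg)
    have mem: "g x \<in> g ` P \<longleftrightarrow> x \<in> P" for x
      using Gal_bij[OF g] by (simp add: bij_is_inj inj_image_mem_iff)
    have cG: "?c \<in> G" using Gal_comp[OF Gal_comp[OF g c(1)] g'] .
    have cP: "?c ` g ` P = g ` P"
      using c(2) by (metis (no_types, lifting) comp_apply gg(2) image_cong image_image)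
    have gen': "(?c ^^ j) x - x ^ p \<in> g ` P" if x: "algebraic_int x" for x
    proof -
      have "(?c ^^ j) x - x ^ p = g ((c ^^ j) (?g' x) - (?g' x) ^ p)"
        by (simp add: pow Gal_diff[OF g] Gal_power[OF g] gg)
      then show ?thesis using gen[OF Gal_algebraic_int[OF g' x]] by simp
    qed
    have "(\<exists>i\<in>inertia_group \<rat> P. g \<circ> i \<circ> c ^^ m \<circ> ?g' \<in> carrier (Gal F)) \<longleftrightarrow>
       (\<exists>h\<in>carrier (Gal F). h ` g ` P = g ` P \<and> (\<forall>x. algebraic_int x \<longrightarrow> h x - (?c ^^ m) x \<in> g ` P))" (is "?L \<longleftrightarrow> ?R")
    proof
      assume ?L
      then obtain i where i: "i \<in> G" "i ` P = P" "\<And>x. algebraic_int x \<Longrightarrow> i x \<doteq> x"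
        and h: "g \<circ> i \<circ> c ^^ m \<circ> ?g' \<in> carrier (Gal F)"
        by (auto simp: inertia_group_iff)
      let ?h = "g \<circ> i \<circ> c ^^ m \<circ> ?g'"
      have "?h ` g ` P = g ` i ` (c ^^ m) ` P" by (simp add: image_image gg)
      then have "?h ` g ` P = g ` P" using i(2) decomposition_power[OF c] by simp
      moreover have "?h x - (?c ^^ m) x \<in> g ` P" if x: "algebraic_int x" for x
      proof -
        have "?h x - (?c ^^ m) x = g (i ((c ^^ m) (?g' x)) - (c ^^ m) (?g' x))"
          by (simp add: pow Gal_diff[OF g])
        then show ?thesis
          using i(3)[OF Gal_algebraic_int[OF Gal_pow_closed[OF c(1)] Gal_algebraic_int[OF g' x]]] by simp
      qed
      ultimately show ?R using h by blast
    next
      assume ?R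
      then obtain h where h: "h \<in> carrier (Gal F)" "h ` g ` P = g ` P"
          "\<And>x. algebraic_int x \<Longrightarrow> h x - (?c ^^ m) x \<in> g ` P" by blast
      have hG: "h \<in> G" using h(1) Gal_subset_G by blast
      let ?b = "c ^^ m"
      have bG: "?b \<in> G" by (rule Gal_pow_closed[OF c(1)])
      let ?b' = "inv_into UNIV ?b"
      have b': "?b' \<in> G" by (rule Gal_inv_closed[OF bG])
      have bb: "?b (?b' x) = x" "?b' (?b x) = x" for x
        by (rule Gal_apply_inv[OF bG] Gal_inv_apply[OF bG])+
      let ?i = "?g' \<circ> h \<circ> g \<circ> ?b'"
      have "?i \<in> inertia_group \<rat> P"
        unfolding inertia_group_iff
      proof (intro conjI allI impI)
        show "?i \<in> G" by (intro Gal_comp g' hG g b')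
        have b'P: "?b' ` P = P" by (rule decomposition_inv[OF bG decomposition_power[OF c]])
        have "?i ` P = ?g' ` h ` g ` ?b' ` P" by (simp add: image_image)
        also have "\<dots> = ?g' ` g ` P" by (simp only: b'P h(2))
        also have "\<dots> = P" by (simp add: image_image gg)
        finally show "?i ` P = P" .
        fix x :: 'a assume x: "algebraic_int x"
        have "g (?i x - x) = h (g (?b' x)) - (?c ^^ m) (g (?b' x))"
          by (simp add: pow Gal_diff[OF g] gg bb)
        also have "\<dots> \<in> g ` P"
          by (rule h(3)) (rule Gal_algebraic_int[OF g Gal_algebraic_int[OF b' x]])
        finally show "?i x \<doteq> x" using mem by blast
      qed
      moreover have "g \<circ> ?i \<circ> ?b \<circ> ?g' = h" by (simp add: fun_eq_iff gg bb)
      ultimately show ?L using h(1) by metis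
    qed
    then show ?thesis using g.Gal_meets_coset_iff[OF F cG cP gen'] by blast
  qed
  then have "(\<exists>g\<in>G. \<exists>i\<in>inertia_group \<rat> P. g \<circ> i \<circ> c ^^ m \<circ> inv_into UNIV g \<in> carrier (Gal F))
      \<longleftrightarrow> (\<exists>g\<in>G. residue_degree \<rat> F (g ` P \<inter> F) dvd m)"
    by (rule bex_cong[OF refl])
  then show ?thesis by (auto simp: mem_splitting_type_iff[OF F])
qed

end

section \<open>Unramified places\<close>

text \<open>With \<open>a\<close> the leading coefficient and \<open>n\<close> the degree of \<open>q\<close>, multiplying \<open>q(x) = 0\<close> by \<open>a\<^sup>n\<^sup>-\<^sup>1\<close> gives a monic
  equation for \<open>a x\<close>.\<close>

lemma algebraic_int_multiple:
  fixes q :: "'a::field_char_0 poly"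
  assumes "q \<noteq> 0" "\<And>i. poly.coeff q i \<in> \<int>" "poly q x = 0"
  obtains a where "a \<in> \<int>" "a \<noteq> 0" "algebraic_int (a * x)"
proof -
  define n where "n = Polynomial.degree q"
  define a where "a = lead_coeff q"
  have "n > 0"
  proof (rule Nat.gr0I)
    assume "n = 0"
    then obtain b where "q = [:b:]" unfolding n_def by (rule degree_eq_zeroE)
    then show False using assms(1,3) by simp
  qed
  define r where "r = Polynomial.monom 1 n + (\<Sum>i<n. Polynomial.monom (poly.coeff q i * a ^ (n - 1 - i)) i)"
  have cr: "poly.coeff r i = (if i = n then 1 else if i < n then poly.coeff q i * a ^ (n - 1 - i) else 0)" for i
    by (auto simp: r_def coeff_sum)
  have "Polynomial.degree r = n"
    by (rule antisym[OF degree_le le_degree]) (auto simp: cr)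
  then have "lead_coeff r = 1" by (simp add: cr)
  moreover have "\<forall>i. poly.coeff r i \<in> \<int>"
    using assms(2) by (auto simp: cr a_def intro!: Ints_mult Ints_power)
  moreover have "poly r (a * x) = 0"
  proof -
    have "poly.coeff q i * a ^ (n - 1 - i) * (a * x) ^ i = a ^ (n - 1) * (poly.coeff q i * x ^ i)" if "i < n" for i
    proof -
      have "a ^ (n - 1 - i) * a ^ i = a ^ (n - 1)" using that by (simp flip: power_add)
      then show ?thesis by (simp add: power_mult_distrib algebra_simps)
    qed
    then have "(\<Sum>i<n. poly.coeff q i * a ^ (n - 1 - i) * (a * x) ^ i)
        = (\<Sum>i<n. a ^ (n - 1) * (poly.coeff q i * x ^ i))" by (intro sum.cong) auto
    then have "poly r (a * x) = (a * x) ^ n + (\<Sum>i<n. a ^ (n - 1) * (poly.coeff q i * x ^ i))"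
      unfolding r_def by (simp only: poly_add poly_sum poly_monom mult_1)
    also have "(a * x) ^ n = a ^ (n - 1) * (poly.coeff q n * x ^ n)"
      using \<open>n > 0\<close> power_minus_mult[of n a] by (simp add: power_mult_distrib a_def n_def mult.assoc[symmetric])
    also have "a ^ (n - 1) * (poly.coeff q n * x ^ n) + (\<Sum>i<n. a ^ (n - 1) * (poly.coeff q i * x ^ i))
        = a ^ (n - 1) * (\<Sum>i\<le>n. poly.coeff q i * x ^ i)"
      by (simp add: sum_distrib_left distrib_left flip: lessThan_Suc_atMost)
    also have "\<dots> = 0" using assms(3) by (simp add: poly_altdef n_def)
    finally show ?thesis .
  qed
  ultimately have "algebraic_int (a * x)" by (intro algebraic_int.intros)
  then show ?thesis using that[of a] assms(1,2) by (simp add: a_def)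
qed

context galois_place
begin

abbreviation Ppow :: "nat \<Rightarrow> 'a set" where
  "Ppow e \<equiv> P [^]\<^bsub>ideals_set (ring_of_integers UNIV)\<^esub> e"

lemma Ppow_0: "Ppow 0 = {x. algebraic_int x}"
  and Ppow_Suc: "Ppow (Suc e) = ideal_prod (ring_of_integers UNIV) (Ppow e) P"
  and Ppow_add: "Ppow (d + e) = ideal_prod (ring_of_integers UNIV) (Ppow d) (Ppow e)"
  and Ppow_ideal: "ideal (Ppow e) (ring_of_integers UNIV)"
proof -
  interpret R: cring "ring_of_integers (UNIV :: 'a set)" by (rule cring_integers[OF UNIV_subfield])
  interpret M: comm_monoid "ideals_set (ring_of_integers (UNIV :: 'a set))"
    by (rule R.ideals_set_is_comm_monoid)
  interpret I: primeideal P "ring_of_integers UNIV" by (rule primeideal_P)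
  have P: "P \<in> carrier (ideals_set (ring_of_integers UNIV))"
    using I.is_ideal by (simp add: ideals_set_def)
  show "Ppow 0 = {x. algebraic_int x}" by (simp add: ideals_set_def)
  show "Ppow (Suc e) = ideal_prod (ring_of_integers UNIV) (Ppow e) P"
    by (simp add: ideals_set_def)
  show "Ppow (d + e) = ideal_prod (ring_of_integers UNIV) (Ppow d) (Ppow e)"
    using M.nat_pow_mult[OF P, of d e] by (simp add: ideals_set_def)
  show "ideal (Ppow e) (ring_of_integers UNIV)"
    using M.nat_pow_closed[OF P, of e] by (simp add: ideals_set_def)
qed

lemma Ppow_alg: "x \<in> Ppow e \<Longrightarrow> algebraic_int x"
  using ideal.Icarr[OF Ppow_ideal] by fastforce

lemma Ppow_antimono: "d \<le> e \<Longrightarrow> Ppow e \<subseteq> Ppow d"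
proof (induction e rule: dec_induct)
  case (step e)
  interpret R: cring "ring_of_integers (UNIV :: 'a set)" by (rule cring_integers[OF UNIV_subfield])
  interpret I: primeideal P "ring_of_integers UNIV" by (rule primeideal_P)
  show ?case using R.ideal_prod_inter[OF Ppow_ideal[of e] I.is_ideal] step.IH unfolding Ppow_Suc by blast
qed simp

lemma p_dvd_add: "algebraic_int (x / of_nat p ^ k) \<Longrightarrow> algebraic_int (y / of_nat p ^ k)
    \<Longrightarrow> algebraic_int ((x + y) / of_nat p ^ k)" for x y :: 'a
  using alg_add by (simp add: add_divide_distrib)

text \<open>Induction on \<open>N\<close> with one factor absorbed into \<open>s\<close>, as elements of an ideal product are sums of
  products.\<close>

lemma Ppow_mult_p_dvdI:
  assumes "algebraic_int s" "\<And>xs. length xs = N \<Longrightarrow> set xs \<subseteq> P \<Longrightarrow> algebraic_int (s * prod_list xs / of_nat p)"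
    and "x \<in> Ppow N"
  shows "algebraic_int (s * x / of_nat p)"
  using assms
proof (induction N arbitrary: s x)
  case 0
  then have "algebraic_int (s / of_nat p)" using 0(2)[of "[]"] by simp
  moreover have "algebraic_int x" by (rule Ppow_alg[OF 0(3)])
  ultimately show ?case using alg_mult[of "s / of_nat p" x] by simp
next
  case (Suc N)
  from Suc.prems(3) show ?case unfolding Ppow_Suc
  proof (induction rule: ideal_prod.induct)
    case (prod i j)
    have "algebraic_int (s * j * prod_list xs / of_nat p)" if "length xs = N" "set xs \<subseteq> P" for xs
      using Suc.prems(2)[of "j # xs"] that prod(2) by (simp add: mult.assoc)
    then have "algebraic_int (s * j * i / of_nat p)"
      using Suc.IH[of "s * j" i] prod Suc.prems(1) P_alg alg_mult by blast
    then show ?case by (simp add: mult.assoc mult.commute[of j])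
  next
    case (sum x y)
    then show ?case using p_dvd_add[of "s * x" 1 "s * y"] by (simp add: distrib_left)
  qed
qed

text \<open>With \<open>E\<close> in all the other conjugates of \<open>P\<close> but not in \<open>P\<close>, the elements of \<open>E P\<close> are nilpotent modulo
  \<open>p\<close>; and among sufficiently many of them, some residue class modulo \<open>p\<close> is repeated so often that
  their product is divisible by \<open>p\<close>.\<close>

lemma power_of_P_locally_in_p:
  obtains s N where "algebraic_int s" "s \<notin> P" "\<And>x. x \<in> Ppow N \<Longrightarrow> algebraic_int (s * x / of_nat p)"
proof -
  obtain E where E: "algebraic_int E" "E \<notin> P" "\<And>\<sigma>. \<sigma> \<in> G \<Longrightarrow> \<sigma> ` P \<noteq> P \<Longrightarrow> \<sigma> E \<in> P"
    using separating_element[OF order.refl] by blast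
  obtain R :: "'a set" where R: "finite R" "\<And>x. algebraic_int x \<Longrightarrow> \<exists>r\<in>R. algebraic_int ((x - r) / of_nat p)"
    using finite_representatives_mod_p by blast
  define \<rho> where "\<rho> = (\<lambda>x. SOME r. r \<in> R \<and> algebraic_int ((x - r) / of_nat p))"
  have \<rho>: "\<rho> x \<in> R \<and> algebraic_int ((x - \<rho> x) / of_nat p)" if "algebraic_int x" for x
    unfolding \<rho>_def by (rule someI_ex) (use R(2)[OF that] in blast)
  define n where "n = card G"
  define N where "N = card R * n + 1"
  have nil: "algebraic_int ((E * x) ^ n / of_nat p)" if x: "x \<in> P" for x
    unfolding n_def
  proof (rule power_dvd_p_of_conjugates_mem)
    show "algebraic_int (E * x)" using E(1) P_alg[OF x] by (rule alg_mult)
    fix \<sigma> assume \<sigma>: "\<sigma> \<in> G"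
    have a: "algebraic_int (\<sigma> E)" "algebraic_int (\<sigma> x)" using Gal_algebraic_int[OF \<sigma>] E(1) P_alg[OF x] by auto
    show "\<sigma> (E * x) \<in> P"
    proof (cases "\<sigma> ` P = P")
      case True
      then have "\<sigma> x \<in> P" using x by blast
      then show ?thesis using P_mult a by (simp add: Gal_times[OF \<sigma>])
    next
      case False
      then show ?thesis using P_mult'[OF E(3)[OF \<sigma>]] a by (simp add: Gal_times[OF \<sigma>])
    qed
  qed
  have cong_prod: "algebraic_int ((prod f J - y ^ card J) / of_nat p)"
    if "finite J" "\<And>i. i \<in> J \<Longrightarrow> algebraic_int (f i)" "algebraic_int y"
      "\<And>i. i \<in> J \<Longrightarrow> algebraic_int ((f i - y) / of_nat p)" for f and J :: "nat set" and y :: 'a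
    using that
  proof (induction J rule: finite_induct)
    case (insert i J)
    have "(prod f (insert i J) - y ^ card (insert i J)) / of_nat p
        = (f i - y) / of_nat p * prod f J + y * ((prod f J - y ^ card J) / of_nat p)"
      using insert(1,2) p_pos by (simp add: field_simps)
    also have "algebraic_int \<dots>" using insert by (intro alg_add alg_mult alg_prod) auto
    finally show ?case .
  qed simp
  have main: "algebraic_int (E ^ N * prod_list xs / of_nat p)" if len: "length xs = N" and xs: "set xs \<subseteq> P" for xs
  proof -
    define z where "z = (\<lambda>i. E * xs ! i)"
    have xsi: "xs ! i \<in> P" if "i < N" for i using that len xs by auto
    have zalg: "algebraic_int (z i)" if "i < N" for i
      unfolding z_def by (rule alg_mult[OF E(1) P_alg[OF xsi[OF that]]])
    have "E ^ N * prod_list xs = (\<Prod>i<N. z i)"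
      by (simp add: z_def prod.distrib prod.list_conv_set_nth len atLeast0LessThan)
    \<comment> \<open>More than \<open>n\<close> of the factors lie in one class modulo \<open>p\<close>.\<close>
    have "\<exists>r\<in>R. n < card {i \<in> {..<N}. \<rho> (z i) = r}"
    proof (rule ccontr)
      assume "\<not> ?thesis"
      then have le: "card {i \<in> {..<N}. \<rho> (z i) = r} \<le> n" if "r \<in> R" for r using that by force
      have "{..<N} = (\<Union>r\<in>R. {i \<in> {..<N}. \<rho> (z i) = r})" using \<rho> zalg by auto
      then have "N = card (\<Union>r\<in>R. {i \<in> {..<N}. \<rho> (z i) = r})" by (metis card_lessThan)
      also have "\<dots> \<le> (\<Sum>r\<in>R. card {i \<in> {..<N}. \<rho> (z i) = r})" by (rule card_UN_le[OF R(1)])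
      also have "\<dots> \<le> card R * n" using sum_bounded_above[of R _ n] le by simp
      finally show False by (simp add: N_def)
    qed
    then obtain r where r: "r \<in> R" "n < card {i \<in> {..<N}. \<rho> (z i) = r}" by blast
    define J where "J = {i \<in> {..<N}. \<rho> (z i) = r}"
    have J: "finite J" "J \<subseteq> {..<N}" "n < card J" using r by (auto simp: J_def)
    then obtain i0 where i0: "i0 \<in> J" by (metis card.empty ex_in_conv not_less_zero)
    have eq: "algebraic_int ((z i - z i0) / of_nat p)" if "i \<in> J" for i
    proof -
      have "(z i - z i0) / of_nat p = (z i - \<rho> (z i)) / of_nat p - (z i0 - \<rho> (z i0)) / of_nat p"
        using that i0 by (simp add: J_def flip: diff_divide_distrib)
      moreover have "i < N" "i0 < N" using that i0 by (auto simp: J_def)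
      ultimately show ?thesis using \<rho> zalg alg_diff by metis
    qed
    have i0N: "i0 < N" using i0 J(2) by auto
    have nil0: "algebraic_int (z i0 ^ n / of_nat p)" using nil[OF xsi[OF i0N]] by (simp add: z_def)
    have "z i0 ^ card J / of_nat p = z i0 ^ n / of_nat p * z i0 ^ (card J - n)"
      using J(3) by (simp flip: power_add)
    then have "algebraic_int (z i0 ^ card J / of_nat p)"
      using alg_mult[OF nil0 alg_power[OF zalg[OF i0N]]] by (simp only:)
    moreover have "algebraic_int ((prod z J - z i0 ^ card J) / of_nat p)"
      by (rule cong_prod[OF J(1) _ zalg[OF i0N] eq]) (use J(2) zalg in auto)
    ultimately have "algebraic_int (prod z J / of_nat p)"
      using alg_add[of "(prod z J - z i0 ^ card J) / of_nat p" "z i0 ^ card J / of_nat p"]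
      by (simp flip: add_divide_distrib)
    moreover have "algebraic_int (prod z ({..<N} - J))" using zalg by (intro alg_prod) auto
    ultimately have "algebraic_int (prod z J / of_nat p * prod z ({..<N} - J))" by (rule alg_mult)
    then show ?thesis
      using prod.subset_diff[OF J(2), of z] \<open>E ^ N * prod_list xs = (\<Prod>i<N. z i)\<close> by (simp add: mult.commute)
  qed
  show ?thesis
  proof (rule that)
    show "algebraic_int (E ^ N)" by (rule alg_power[OF E(1)])
    show "E ^ N \<notin> P" using P_power E by blast
    show "algebraic_int (E ^ N * x / of_nat p)" if "x \<in> Ppow N" for x
      by (rule Ppow_mult_p_dvdI[OF alg_power[OF E(1)] main that])
  qed
qed

text \<open>If \<open>y P \<subseteq> P\<close> then all \<open>p y\<^sup>k\<close> are integers; two of them are congruent modulo \<open>p\<close>, which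
  is a monic equation for \<open>y\<close>.\<close>

lemma integral_of_stabilizes_P:
  assumes "\<And>x. x \<in> P \<Longrightarrow> y * x \<in> P"
  shows "algebraic_int y"
proof -
  have y: "y ^ k * of_nat p \<in> P" for k
    by (induction k) (use p_in_P assms in \<open>auto simp: mult.assoc\<close>)
  obtain i j where ij: "i < j" "algebraic_int ((y ^ j * of_nat p - y ^ i * of_nat p) / of_nat p)"
    using repeated_residue[of "\<lambda>k. y ^ k * of_nat p"] P_alg[OF y] by blast
  then have alg: "algebraic_int (y ^ j - y ^ i)" using p_pos by (simp flip: left_diff_distrib)
  define q :: "'a poly" where "q = Polynomial.monom 1 j - Polynomial.monom 1 i"
  have cq: "poly.coeff q k = (if k = j then 1 else 0) - (if k = i then 1 else 0)" for k
    by (simp add: q_def)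
  have deg: "Polynomial.degree q = j"
    by (rule antisym[OF degree_le le_degree]) (use ij(1) in \<open>auto simp: cq\<close>)
  show ?thesis
  proof (rule algebraic_int_root[OF alg])
    show "poly q y = y ^ j - y ^ i" by (simp add: q_def poly_monom)
    show "lead_coeff q = 1" "Polynomial.degree q > 0" using ij(1) by (auto simp: deg cq)
    show "\<forall>k. poly.coeff q k \<in> \<int>" by (auto simp: cq)
  qed
qed

text \<open>Take \<open>N\<close> minimal in \<open>power_of_P_locally_in_p\<close>. This gives a \<open>b\<close> with \<open>b P \<subseteq> p O\<close> that is not itself
  divisible by \<open>p\<close>. As \<open>b/p\<close> is not integral, it does not map \<open>P\<close> into \<open>P\<close>, so that \<open>(b/p) \<pi>\<close> is a local
  unit for some \<open>\<pi> \<in> P\<close>. If \<open>b\<close> were in \<open>P\<close>, then \<open>p\<close> would be in \<open>P\<^sup>2\<close>.\<close>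

lemma P_locally_generated_by_p:
  assumes "of_nat p \<notin> Ppow 2"
  obtains s where "algebraic_int s" "s \<notin> P" "\<And>x. x \<in> P \<Longrightarrow> algebraic_int (s * x / of_nat p)"
proof -
  define T where "T = (\<lambda>N. \<exists>s. algebraic_int s \<and> s \<notin> P \<and> (\<forall>x\<in>Ppow N. algebraic_int (s * x / of_nat p)))"
  obtain s0 N0 where "algebraic_int s0" "s0 \<notin> P" "\<And>x. x \<in> Ppow N0 \<Longrightarrow> algebraic_int (s0 * x / of_nat p)"
    using power_of_P_locally_in_p by blast
  then have "T N0" unfolding T_def by blast
  define N where "N = (LEAST N. T N)"
  have "T N" unfolding N_def using LeastI[of T, OF \<open>T N0\<close>] .
  have min: "\<not> T M" if "M < N" for M using that not_less_Least unfolding N_def by blast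
  obtain s where s: "algebraic_int s" "s \<notin> P" "\<And>x. x \<in> Ppow N \<Longrightarrow> algebraic_int (s * x / of_nat p)"
    using \<open>T N\<close> unfolding T_def by blast
  have "N \<noteq> 0"
  proof
    assume "N = 0"
    have "1 \<in> Ppow N" unfolding \<open>N = 0\<close> Ppow_0 by simp
    then have "algebraic_int (s * 1 / of_nat p)" by (rule s(3))
    then show False using s(2) p_multiple_in_P by simp
  qed
  then obtain M where M: "N = Suc M" using not0_implies_Suc by blast
  then have "\<not> T M" using min by simp
  then obtain z where z: "z \<in> Ppow M" "\<not> algebraic_int (s * z / of_nat p)"
    using s(1,2) unfolding T_def by blast
  define b where "b = s * z"
  have b_alg: "algebraic_int b" unfolding b_def using s(1) Ppow_alg[OF z(1)] by (rule alg_mult)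
  have bP: "algebraic_int (b * x / of_nat p)" if "x \<in> P" for x
    using s(3)[of "z * x"] ideal_prod.prod[OF z(1) that, of "ring_of_integers UNIV"]
    unfolding M Ppow_Suc by (simp add: b_def mult.assoc)
  have "\<exists>\<pi>\<in>P. b / of_nat p * \<pi> \<notin> P"
    using integral_of_stabilizes_P[of "b / of_nat p"] z(2) by (auto simp: b_def)
  then obtain \<pi> where \<pi>: "\<pi> \<in> P" "b / of_nat p * \<pi> \<notin> P" by blast
  define u where "u = b / of_nat p * \<pi>"
  have u: "algebraic_int u" "u \<notin> P" "u * of_nat p = b * \<pi>"
    using bP[OF \<pi>(1)] \<pi>(2) p_pos by (auto simp: u_def)
  have "b \<notin> P"
  proof
    assume "b \<in> P"
    interpret I2: ideal "Ppow 2" "ring_of_integers UNIV" by (rule Ppow_ideal)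
    have PP: "x * y \<in> Ppow 2" if "x \<in> P" "y \<in> P" for x y
    proof -
      have P1: "Ppow 1 = ideal_prod (ring_of_integers UNIV) {x. algebraic_int x} P"
        using Ppow_Suc[of 0] unfolding Ppow_0 One_nat_def[symmetric] .
      have "1 * x \<in> Ppow 1"
        unfolding P1 using ideal_prod.prod[of 1 "{x. algebraic_int x}" x P "ring_of_integers UNIV"] that by simp
      then show ?thesis
        using Ppow_Suc[of 1] ideal_prod.prod[of x "Ppow 1" y P "ring_of_integers UNIV"] that
        by (simp add: numeral_2_eq_2)
    qed
    \<comment> \<open>\<open>P\<^sup>2\<close> contains \<open>u p = b \<pi>\<close>, and \<open>u\<close> is invertible modulo \<open>P\<close>, where \<open>P p \<subseteq> P\<^sup>2\<close>.\<close>
    obtain k where k: "k > 0" "u ^ k \<doteq> 1" using power_cong_1[OF u(1,2)] .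
    have "u ^ k * of_nat p = u ^ (k - 1) * (b * \<pi>)"
      using k(1) u(3) by (metis mult.assoc power_minus_mult)
    also have "\<dots> \<in> Ppow 2"
      using I2.I_l_closed[OF PP[OF \<open>b \<in> P\<close> \<pi>(1)], of "u ^ (k - 1)"] alg_power[OF u(1)] by simp
    finally have m1: "u ^ k * of_nat p \<in> Ppow 2" .
    have "(1 - u ^ k) * of_nat p \<in> Ppow 2" by (rule PP[OF cong_sym[OF k(2)] p_in_P])
    from additive_subgroup.a_closed[OF I2.additive_subgroup_axioms m1 this]
    have "of_nat p \<in> Ppow 2" by (simp add: algebra_simps)
    then show False using assms by simp
  qed
  then show ?thesis using that b_alg bP by blast
qed

text \<open>This bound makes the ramification index an actual maximum. If \<open>s P\<^sup>N \<subseteq> p O\<close> then \<open>s\<^sup>2 P\<^sup>2\<^sup>N \<subseteq> p\<^sup>2 O\<close>, and \<open>p \<in> P\<^sup>2\<^sup>N\<close> would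
  give \<open>s\<^sup>2 \<in> p O \<subseteq> P\<close>.\<close>

lemma p_notin_high_Ppow:
  obtains B where "\<And>e. of_nat p \<in> Ppow e \<Longrightarrow> e \<le> B"
proof -
  obtain s N where s: "algebraic_int s" "s \<notin> P" "\<And>x. x \<in> Ppow N \<Longrightarrow> algebraic_int (s * x / of_nat p)"
    using power_of_P_locally_in_p by blast
  have sq: "algebraic_int (s ^ 2 * x / of_nat p ^ 2)" if "x \<in> Ppow (N + N)" for x
    using that unfolding Ppow_add
  proof (induction rule: ideal_prod.induct)
    case (prod i j)
    then show ?case using alg_mult[OF s(3)[OF prod(1)] s(3)[OF prod(2)]]
      by (simp add: power2_eq_square mult_ac)
  next
    case (sum x y)
    then show ?case using p_dvd_add[of "s ^ 2 * x" 2 "s ^ 2 * y"] by (simp add: distrib_left)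
  qed
  have "e \<le> N + N" if e: "of_nat p \<in> Ppow e" for e
  proof (rule ccontr)
    assume "\<not> e \<le> N + N"
    then have "of_nat p \<in> Ppow (N + N)" using e Ppow_antimono[of "N + N" e] by auto
    then have "algebraic_int (s ^ 2 / of_nat p)" using sq[of "of_nat p"] p_pos by (simp add: power2_eq_square)
    then have "s ^ 2 \<in> P" by (rule p_multiple_in_P)
    then show False using P_power s by blast
  qed
  then show ?thesis using that by blast
qed

lemma unramified_imp_p_notin_Ppow_2:
  assumes "ramification_index UNIV P p = 1"
  shows "of_nat p \<notin> Ppow 2"
proof
  assume p2: "of_nat p \<in> Ppow 2"
  interpret R: cring "ring_of_integers (UNIV :: 'a set)" by (rule cring_integers[OF UNIV_subfield])
  have iff: "PIdl\<^bsub>ring_of_integers UNIV\<^esub> (of_nat p) \<subseteq> Ppow e \<longleftrightarrow> of_nat p \<in> Ppow e" for e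
  proof
    assume "PIdl\<^bsub>ring_of_integers UNIV\<^esub> (of_nat p) \<subseteq> Ppow e"
    then show "of_nat p \<in> Ppow e" using R.cgenideal_self[of "of_nat p"] by auto
  next
    assume "of_nat p \<in> Ppow e"
    then show "PIdl\<^bsub>ring_of_integers UNIV\<^esub> (of_nat p) \<subseteq> Ppow e"
      by (rule R.cgenideal_minimal[OF Ppow_ideal])
  qed
  obtain B where "\<And>e. of_nat p \<in> Ppow e \<Longrightarrow> e \<le> B" using p_notin_high_Ppow by blast
  then have "2 \<le> (GREATEST e. of_nat p \<in> Ppow e)" using Greatest_le_nat[of "\<lambda>e. of_nat p \<in> Ppow e" 2 B] p2 by blast
  then show False using assms by (simp add: ramification_index_def iff)
qed

lemma power_add_expansion:
  fixes x d :: 'a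
  assumes "algebraic_int x" "algebraic_int d"
  obtains w where "algebraic_int w" "(x + d) ^ n = x ^ n + of_nat n * x ^ (n - 1) * d + d ^ 2 * w"
proof -
  have "\<exists>w. algebraic_int w \<and> (x + d) ^ n = x ^ n + of_nat n * x ^ (n - 1) * d + d ^ 2 * w"
  proof (induction n)
    case (Suc n)
    then obtain w where w: "algebraic_int w" "(x + d) ^ n = x ^ n + of_nat n * x ^ (n - 1) * d + d ^ 2 * w"
      by blast
    let ?v = "of_nat n * x ^ (n - 1) + x * w + d * w"
    have "of_nat n * (x * x ^ (n - 1)) = of_nat n * x ^ n" by (cases n) auto
    then have "(x + d) ^ Suc n = x ^ Suc n + of_nat (Suc n) * x ^ (Suc n - 1) * d + d ^ 2 * ?v"
      using w(2) by (simp add: algebra_simps power2_eq_square)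
    moreover have "algebraic_int ?v" using assms w(1) by (intro alg_add alg_mult alg_power) auto
    ultimately show ?case by blast
  qed (auto intro!: exI[of _ 0])
  then show ?thesis using that by blast
qed

text \<open>The induction that makes \<open>\<sigma> x - x\<close> divisible by every power of \<open>p\<close> at \<open>P\<close>: with \<open>q\<close> the order of the
  residue field, \<open>x - x\<^sup>q\<close> is locally a multiple of \<open>p\<close>, and \<open>\<sigma> - 1\<close> gains a factor \<open>p\<close> on \<open>x\<^sup>q\<close>, where \<open>p\<close>
  divides \<open>q\<close>, as well as on the multiple of \<open>p\<close>.\<close>

lemma inertia_close_to_identity:
  assumes s: "algebraic_int s" "s \<notin> P" "\<And>x. x \<in> P \<Longrightarrow> algebraic_int (s * x / of_nat p)"
    and \<sigma>: "\<sigma> \<in> inertia_group \<rat> P"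
  shows "\<exists>r. algebraic_int r \<and> r \<notin> P \<and>
    (\<forall>x. algebraic_int x \<longrightarrow> algebraic_int (r * (\<sigma> x - x) / of_nat p ^ Suc k))"
proof (induction k)
  case 0
  have "algebraic_int (s * (\<sigma> x - x) / of_nat p ^ Suc 0)" if "algebraic_int x" for x
    using s(3)[of "\<sigma> x - x"] \<sigma> that by (simp add: inertia_group_iff)
  then show ?case using s(1,2) by blast
next
  case (Suc k)
  then obtain r where r: "algebraic_int r" "r \<notin> P"
      "\<And>x. algebraic_int x \<Longrightarrow> algebraic_int (r * (\<sigma> x - x) / of_nat p ^ Suc k)" by blast
  have \<sigma>G: "\<sigma> \<in> G" and \<sigma>P: "\<sigma> ` P = P" using \<sigma> by (auto simp: inertia_group_iff)
  define f where "f = residue_degree \<rat> UNIV P"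
  have f: "f > 0" using card_residue_field(2)[OF UNIV_subfield] by (simp add: f_def)
  define q where "q = p ^ f"
  have q: "x ^ q \<doteq> x" if "algebraic_int x" for x
    using residue_degree_dvd_iff[OF UNIV_subfield, of f] that by (simp add: f_def q_def)
  obtain q' where q': "q = p * q'" using f unfolding q_def by (cases f) auto
  have \<sigma>s: "algebraic_int (\<sigma> s)" "\<sigma> s \<notin> P"
    using Gal_algebraic_int[OF \<sigma>G s(1)] inj_image_mem_iff[OF bij_is_inj[OF Gal_bij[OF \<sigma>G]], of s P] \<sigma>P s(2)
    by simp_all
  define r' where "r' = r * (r * (s * \<sigma> s))"
  have r'_alg: "algebraic_int r'" unfolding r'_def by (intro alg_mult r(1) s(1) \<sigma>s(1))
  have r'P: "r' \<notin> P" unfolding r'_def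
    using P_prime r(1,2) s(1,2) \<sigma>s alg_mult by metis
  have "algebraic_int (r' * (\<sigma> x - x) / of_nat p ^ Suc (Suc k))" if x: "algebraic_int x" for x
  proof -
    let ?\<pi> = "of_nat p :: 'a"
    have \<pi>: "?\<pi> \<noteq> 0" using p_pos by simp
    define d where "d = \<sigma> x - x"
    define d' where "d' = r * d / ?\<pi> ^ Suc k"
    have d'_alg: "algebraic_int d'" unfolding d'_def d_def by (rule r(3)[OF x])
    have rd: "r * d = ?\<pi> ^ Suc k * d'" using \<pi> by (simp add: d'_def)
    have d_alg: "algebraic_int d" unfolding d_def by (rule alg_diff[OF Gal_algebraic_int[OF \<sigma>G x] x])
    obtain w where w: "algebraic_int w" "(x + d) ^ q = x ^ q + of_nat q * x ^ (q - 1) * d + d ^ 2 * w"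
      using power_add_expansion[OF x d_alg] by blast
    define z where "z = s * (x - x ^ q) / ?\<pi>"
    have z: "algebraic_int z" "s * (x - x ^ q) = ?\<pi> * z"
      using s(3)[OF cong_sym[OF q[OF x]]] \<pi> by (auto simp: z_def)
    have \<sigma>z: "\<sigma> s * (\<sigma> x - \<sigma> x ^ q) = ?\<pi> * \<sigma> z"
      using arg_cong[OF z(2), of \<sigma>]
      by (simp add: Gal_times[OF \<sigma>G] Gal_diff[OF \<sigma>G] Gal_power[OF \<sigma>G] Gal_of_nat[OF \<sigma>G])
    define zd where "zd = r * (\<sigma> z - z) / ?\<pi> ^ Suc k"
    define sd where "sd = r * (\<sigma> s - s) / ?\<pi> ^ Suc k"
    have zd: "algebraic_int zd" "r * (\<sigma> z - z) = ?\<pi> ^ Suc k * zd"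
      using r(3)[OF z(1)] \<pi> by (auto simp: zd_def)
    have sd: "algebraic_int sd" "r * (\<sigma> s - s) = ?\<pi> ^ Suc k * sd"
      using r(3)[OF s(1)] \<pi> by (auto simp: sd_def)
    have "s * \<sigma> s * d = s * (\<sigma> s * (\<sigma> x - \<sigma> x ^ q)) - \<sigma> s * (s * (x - x ^ q)) + s * \<sigma> s * (\<sigma> x ^ q - x ^ q)"
      by (simp add: d_def algebra_simps)
    also have "\<sigma> x ^ q - x ^ q = of_nat q * x ^ (q - 1) * d + d ^ 2 * w"
      using w(2) by (simp add: d_def)
    also have "s * (\<sigma> s * (\<sigma> x - \<sigma> x ^ q)) - \<sigma> s * (s * (x - x ^ q))
        = ?\<pi> * (s * (\<sigma> z - z) - z * (\<sigma> s - s))"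
      unfolding \<sigma>z z(2) by (simp add: algebra_simps)
    finally have base: "s * \<sigma> s * d = ?\<pi> * (s * (\<sigma> z - z) - z * (\<sigma> s - s))
        + s * \<sigma> s * (of_nat q * x ^ (q - 1) * d + d ^ 2 * w)" .
    have "r' * d = r * r * (s * \<sigma> s * d)" by (simp add: r'_def)
    also have "\<dots> = ?\<pi> * r * (s * (r * (\<sigma> z - z)) - z * (r * (\<sigma> s - s)))
        + s * \<sigma> s * (r * of_nat q * x ^ (q - 1) * (r * d) + (r * d) * (r * d) * w)"
      unfolding base by (simp add: algebra_simps power2_eq_square)
    also have "\<dots> = ?\<pi> ^ Suc (Suc k) * (r * (s * zd - z * sd)
        + s * \<sigma> s * (r * of_nat q' * x ^ (q - 1) * d' + ?\<pi> ^ k * d' * d' * w))"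
      unfolding zd(2) sd(2) rd q' by (simp add: algebra_simps)
    finally have "r' * d / ?\<pi> ^ Suc (Suc k) = r * (s * zd - z * sd)
        + s * \<sigma> s * (r * of_nat q' * x ^ (q - 1) * d' + ?\<pi> ^ k * d' * d' * w)"
      using \<pi> by simp
    also have "algebraic_int \<dots>"
      using r(1) s(1) zd(1) z(1) sd(1) \<sigma>s(1) x d'_alg w(1)
      by (intro alg_add alg_mult alg_diff alg_power) auto
    finally show ?thesis by (simp add: d_def)
  qed
  then show ?case using r'_alg r'P by blast
qed

text \<open>The norm of a non-zero integer is a non-zero rational integer, which has only finitely many
  factors \<open>p\<close>.\<close>

lemma zero_of_divisible_by_all_powers:
  assumes \<delta>: "algebraic_int \<delta>"
    and div: "\<And>k. \<exists>r. algebraic_int r \<and> r \<notin> P \<and> algebraic_int (r * \<delta> / of_nat p ^ Suc k)"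
  shows "\<delta> = 0"
proof (rule ccontr)
  assume "\<delta> \<noteq> 0"
  let ?N = "\<Prod>\<tau>\<in>G. \<tau> \<delta>"
  have id: "id \<in> G" by (simp add: Gal_iff)
  have sub: "subgroup G (Gal \<rat>)" by (rule group.subgroup_self) simp
  have N_alg: "algebraic_int ?N" by (rule alg_prod) (rule Gal_algebraic_int[OF _ \<delta>])
  have "\<sigma> ?N = ?N" if \<sigma>: "\<sigma> \<in> G" for \<sigma>
  proof -
    have "\<sigma> ?N = (\<Prod>\<tau>\<in>(\<lambda>\<tau>. \<sigma> \<circ> \<tau>) ` G. \<tau> \<delta>)"
      by (simp add: Gal_prod[OF \<sigma>] prod.reindex[OF subgroup_comp_image(2)[OF sub \<sigma>]])
    then show ?thesis by (simp add: subgroup_comp_image(1)[OF sub \<sigma>])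
  qed
  then obtain n where n: "?N = of_int n" using algebraic_int_fixed[OF N_alg] by blast
  have "?N \<noteq> 0" using finite_G \<open>\<delta> \<noteq> 0\<close> by (simp add: Gal_eq_0_iff)
  then have "n \<noteq> 0" using n by auto
  moreover have "\<not> is_unit (int p)" using p_gt_1 by simp
  ultimately obtain m where m: "n = int p ^ multiplicity (int p) n * m" "\<not> int p dvd m"
    by (rule multiplicity_decompose')
  define k where "k = multiplicity (int p) n"
  obtain r where r: "algebraic_int r" "r \<notin> P" "algebraic_int (r * \<delta> / of_nat p ^ Suc k)" using div by blast
  have "?N = \<delta> * (\<Prod>\<tau>\<in>G - {id}. \<tau> \<delta>)" using prod.remove[OF finite_G id, of "\<lambda>\<tau>. \<tau> \<delta>"] by simp
  then have "r * ?N / of_nat p ^ Suc k = r * \<delta> / of_nat p ^ Suc k * (\<Prod>\<tau>\<in>G - {id}. \<tau> \<delta>)" by simp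
  also have "algebraic_int \<dots>"
    by (intro alg_mult[OF r(3)] alg_prod) (auto intro: Gal_algebraic_int[OF _ \<delta>])
  finally have "algebraic_int (r * ?N / of_nat p ^ Suc k)" .
  moreover have "?N = of_nat p ^ k * of_int m"
    unfolding n using arg_cong[OF m(1), of "of_int :: int \<Rightarrow> 'a"] by (simp add: k_def)
  ultimately have "algebraic_int (r * of_int m / of_nat p)" using p_pos by simp
  then have "r * of_int m \<in> P" by (rule p_multiple_in_P)
  then have "of_int m \<in> P" using P_prime r(1,2) by blast
  then show False using m(2) of_int_mem_P by blast
qed

text \<open>An automorphism in the inertia group fixes the integers, as \<open>\<sigma> x - x\<close> is divisible by every power of
  \<open>p\<close> at \<open>P\<close>, and every element of the field is the quotient of an integer by a rational integer.\<close>

theorem unramified_imp_trivial_inertia: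
  assumes "ramification_index UNIV P p = 1"
  shows "inertia_group \<rat> P = {id}"
proof
  show "{id} \<subseteq> inertia_group \<rat> P" by (simp add: inertia_group_iff Gal_iff P_0)
  show "inertia_group \<rat> P \<subseteq> {id}"
  proof
    fix \<sigma> assume \<sigma>: "\<sigma> \<in> inertia_group \<rat> P"
    then have \<sigma>G: "\<sigma> \<in> G" by (simp add: inertia_group_iff)
    obtain s where s: "algebraic_int s" "s \<notin> P" "\<And>x. x \<in> P \<Longrightarrow> algebraic_int (s * x / of_nat p)"
      using P_locally_generated_by_p[OF unramified_imp_p_notin_Ppow_2[OF assms]] by blast
    have int: "\<sigma> x = x" if x: "algebraic_int x" for x
    proof -
      have "\<sigma> x - x = 0"
      proof (rule zero_of_divisible_by_all_powers)
        show "algebraic_int (\<sigma> x - x)" using alg_diff Gal_algebraic_int[OF \<sigma>G x] x by blast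
        show "\<exists>r. algebraic_int r \<and> r \<notin> P \<and> algebraic_int (r * (\<sigma> x - x) / of_nat p ^ Suc k)" for k
          using inertia_close_to_identity[OF s \<sigma>, of k] x by blast
      qed
      then show ?thesis by simp
    qed
    have "\<sigma> x = x" for x
    proof -
      obtain B :: "'a set" where "finite B" "ratspace.span B = UNIV"
        using finite_galois_extensionD(1)[OF galois] by blast
      from algebraic_of_spanning_set[OF this, of x]
      obtain q :: "'a poly" where "q \<noteq> 0" "\<And>i. poly.coeff q i \<in> \<int>" "poly q x = 0" by blast
      then obtain a where a: "a \<in> \<int>" "a \<noteq> 0" "algebraic_int (a * x)"
        by (rule algebraic_int_multiple)
      have "\<sigma> a = a" using Gal_Rats[OF \<sigma>G] a(1) Ints_subset_Rats by blast
      then have "a * \<sigma> x = a * x" using int[OF a(3)] by (simp add: Gal_times[OF \<sigma>G])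
      then show ?thesis using a(2) by simp
    qed
    then show "\<sigma> \<in> {id}" by auto
  qed
qed

end

section \<open>The permutation character\<close>

lemma (in group) induced_character_conjugate:
  assumes g: "g \<in> carrier G" and a: "a \<in> carrier G"
  shows "induced_character G H \<psi> (g \<otimes> a \<otimes> inv g) = induced_character G H \<psi> a"
proof -
  let ?t = "\<lambda>a x. if inv x \<otimes> a \<otimes> x \<in> H then \<psi> (inv x \<otimes> a \<otimes> x) else 0"
  have bij: "bij_betw (\<lambda>x. g \<otimes> x) (carrier G) (carrier G)"
    by (rule bij_betwI[where g = "\<lambda>x. inv g \<otimes> x"]) (use g in \<open>auto simp: m_assoc[symmetric]\<close>)
  have "(\<Sum>x\<in>carrier G. ?t (g \<otimes> a \<otimes> inv g) x) = (\<Sum>x\<in>carrier G. ?t (g \<otimes> a \<otimes> inv g) (g \<otimes> x))"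
    by (rule sum.reindex_bij_betw[OF bij, symmetric])
  also have "\<dots> = (\<Sum>x\<in>carrier G. ?t a x)"
  proof (rule sum.cong[OF refl])
    fix x assume x: "x \<in> carrier G"
    have "inv g \<otimes> (g \<otimes> y) = y" if "y \<in> carrier G" for y
      using g that by (simp add: m_assoc[symmetric])
    then have "inv (g \<otimes> x) \<otimes> (g \<otimes> a \<otimes> inv g) \<otimes> (g \<otimes> x) = inv x \<otimes> a \<otimes> x"
      using g a x by (simp add: inv_mult_group m_assoc)
    then show "?t (g \<otimes> a \<otimes> inv g) (g \<otimes> x) = ?t a x" by simp
  qed
  finally show ?thesis by (simp add: induced_character_def)
qed

lemma induced_trivial_character_eq_0_iff:
  assumes "finite (carrier G)" "finite H" "H \<noteq> {}"
  shows "induced_character G H (\<lambda>_. 1) a \<noteq> 0 \<longleftrightarrow> (\<exists>x\<in>carrier G. inv\<^bsub>G\<^esub> x \<otimes>\<^bsub>G\<^esub> a \<otimes>\<^bsub>G\<^esub> x \<in> H)"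
proof -
  have "induced_character G H (\<lambda>_. 1) a = of_nat (card {x \<in> carrier G. inv\<^bsub>G\<^esub> x \<otimes>\<^bsub>G\<^esub> a \<otimes>\<^bsub>G\<^esub> x \<in> H}) / of_nat (card H)"
    using assms(1) by (simp add: induced_character_def sum.If_cases Int_def)
  then show ?thesis using assms by (auto simp: card_eq_0_iff)
qed

context galois_place
begin

lemma frobenius_class_iff:
  "\<sigma> \<in> frobenius_class p \<longleftrightarrow> (\<exists>Q\<in>places_above UNIV p. \<sigma> \<in> G \<and> \<sigma> ` Q = Q \<and>
     (\<forall>x. algebraic_int x \<longrightarrow> \<sigma> x - x ^ p \<in> Q))"
proof -
  have "\<sigma> \<in> decomposition_group \<rat> Q \<and>
       (\<forall>C\<in>carrier (residue_field UNIV Q). reduction Q \<sigma> C = C [^]\<^bsub>residue_field UNIV Q\<^esub> p)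
     \<longleftrightarrow> \<sigma> \<in> G \<and> \<sigma> ` Q = Q \<and> (\<forall>x. algebraic_int x \<longrightarrow> \<sigma> x - x ^ p \<in> Q)"
    if Q: "Q \<in> places_above UNIV p" for Q
  proof -
    interpret Q: galois_place p Q by unfold_locales (rule galois prime_p Q)+
    have "(\<forall>C\<in>carrier (residue_field UNIV Q). reduction Q \<sigma> C = C [^]\<^bsub>residue_field UNIV Q\<^esub> p)
      \<longleftrightarrow> (\<forall>x. algebraic_int x \<longrightarrow> \<sigma> x - x ^ p \<in> Q)" if \<sigma>: "\<sigma> \<in> G" "\<sigma> ` Q = Q"
    proof -
      have "reduction Q \<sigma> (coset Q x) = coset Q x [^]\<^bsub>residue_field UNIV Q\<^esub> p \<longleftrightarrow> \<sigma> x - x ^ p \<in> Q"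
        if x: "algebraic_int x" for x
        using Q.reduction_coset[OF \<sigma> x] Q.residue_pow[OF UNIV_subfield UNIV_I x, of p] Q.coset_P_eq_iff
        by simp
      then show ?thesis by (simp add: carrier_residue_field)
    qed
    then show ?thesis by (auto simp: Q.decomposition_group_iff)
  qed
  then show ?thesis by (auto simp: frobenius_class_def)
qed

text \<open>All places above \<open>p\<close> are conjugate, and two Frobenius elements of one place differ by an
  element of its inertia group.\<close>

lemma frobenius_class_conjugates:
  assumes inertia: "inertia_group \<rat> P = {id}"
    and \<Phi>: "\<Phi> \<in> G" "\<Phi> ` P = P" "\<And>x. algebraic_int x \<Longrightarrow> \<Phi> x \<doteq> x ^ p"
  shows "frobenius_class p \<subseteq> (\<lambda>g. g \<circ> \<Phi> \<circ> inv_into UNIV g) ` G"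
proof
  fix \<sigma> :: "'a \<Rightarrow> 'a"
  assume \<sigma>p: "\<sigma> \<in> frobenius_class p"
  have inv1: "g (inv_into UNIV g x) = x" "inv_into UNIV g (g x) = x" if "g \<in> G" for g :: "'a \<Rightarrow> 'a" and x
    by (rule Gal_apply_inv[OF that] Gal_inv_apply[OF that])+
  have places: "places_above UNIV p = (\<lambda>g. g ` P) ` G"
    using places_above_subfield[OF UNIV_subfield] by simp
  obtain g where g: "g \<in> G" and \<sigma>: "\<sigma> \<in> G" "\<sigma> ` g ` P = g ` P"
    "\<And>x. algebraic_int x \<Longrightarrow> \<sigma> x - x ^ p \<in> g ` P"
    using \<sigma>p unfolding frobenius_class_iff places by blast
  let ?g' = "inv_into UNIV g" and ?\<Phi>' = "inv_into UNIV \<Phi>"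
  have g': "?g' \<in> G" and \<Phi>': "?\<Phi>' \<in> G" using Gal_inv_closed g \<Phi>(1) by auto
  let ?i = "?\<Phi>' \<circ> (?g' \<circ> \<sigma> \<circ> g)"
  have \<Phi>'P: "?\<Phi>' ` P = P" by (rule decomposition_inv[OF \<Phi>(1,2)])
  have "?i \<in> inertia_group \<rat> P"
    unfolding inertia_group_iff
  proof (intro conjI allI impI)
    show "?i \<in> G" by (intro Gal_comp \<Phi>' g' \<sigma>(1) g)
    have "?i ` P = ?\<Phi>' ` ?g' ` \<sigma> ` g ` P" by (simp add: image_image)
    also have "\<dots> = ?\<Phi>' ` ?g' ` g ` P" by (simp only: \<sigma>(2))
    also have "\<dots> = ?\<Phi>' ` P" by (simp add: image_image inv1[OF g])
    finally show "?i ` P = P" using \<Phi>'P by simp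
    fix x :: 'a assume x: "algebraic_int x"
    have "g (?g' (\<sigma> (g x)) - x ^ p) \<in> g ` P"
      using \<sigma>(3)[OF Gal_algebraic_int[OF g x]] by (simp add: Gal_diff[OF g] inv1[OF g] Gal_power[OF g])
    then have "?g' (\<sigma> (g x)) \<doteq> x ^ p" using Gal_bij[OF g] by (simp add: bij_is_inj inj_image_mem_iff)
    then have "?g' (\<sigma> (g x)) \<doteq> \<Phi> x" using \<Phi>(3)[OF x] cong_trans cong_sym by blast
    from decomposition_cong[OF \<Phi>' \<Phi>'P this]
    show "?i x \<doteq> x" by (simp add: inv1[OF \<Phi>(1)])
  qed
  then have i: "?i = id" using inertia by blast
  have "\<sigma> x = (g \<circ> \<Phi> \<circ> ?g') x" for x
    using fun_cong[OF i, of "?g' x"] inv1[OF g] inv1[OF \<Phi>(1)] by (metis comp_apply id_apply)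
  then show "\<sigma> \<in> (\<lambda>g. g \<circ> \<Phi> \<circ> inv_into UNIV g) ` G" using g by blast
qed

text \<open>The character has the same value at all the conjugates of \<open>\<Phi>\<^sup>m\<close>, which is non-zero if and only if one of them is in
  \<open>Gal F\<close>. As the inertia group is trivial, \<open>conjugate_inertia_coset_meets_Gal_iff\<close> for \<open>c = \<Phi>\<close> decides this.\<close>

theorem frobenius_class_value_iff:
  fixes F :: "'a set"
  assumes F: "subfield F ring_of_type_algebra" and "unramified (UNIV :: 'a set) p"
  shows "class_value (induced_character (Gal \<rat>) (carrier (Gal F)) (\<lambda>_. 1))
      ((\<lambda>\<sigma>. \<sigma> [^]\<^bsub>Gal \<rat>\<^esub> m) ` frobenius_class p) \<noteq> 0
    \<longleftrightarrow> (\<exists>f. f \<in># splitting_type F p \<and> f dvd m)"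
proof -
  let ?\<chi> = "induced_character (Gal (\<rat> :: 'a set)) (carrier (Gal F)) (\<lambda>_. 1)"
  interpret GG: group "Gal \<rat> :: ('a \<Rightarrow> 'a) monoid" by simp
  have inertia: "inertia_group \<rat> P = {id}"
    using assms(2) place unramified_imp_trivial_inertia by (simp add: unramified_def)
  obtain \<Phi> where \<Phi>: "\<Phi> \<in> G" "\<Phi> ` P = P" "\<And>x. algebraic_int x \<Longrightarrow> \<Phi> x \<doteq> x ^ p"
    using exists_frobenius by blast
  have pow: "(g \<circ> \<Phi> \<circ> inv_into UNIV g) [^]\<^bsub>Gal \<rat>\<^esub> m = g \<circ> \<Phi> ^^ m \<circ> inv_into UNIV g" if g: "g \<in> G" for g
  proof -
    have "g \<circ> \<Phi> \<circ> inv_into UNIV g \<in> G" by (intro Gal_comp g \<Phi>(1) Gal_inv_closed[OF g])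
    moreover have "((g \<circ> \<Phi> \<circ> inv_into UNIV g) ^^ m) x = (g \<circ> \<Phi> ^^ m \<circ> inv_into UNIV g) x" for x
      by (induction m) (simp_all add: Gal_apply_inv[OF g] Gal_inv_apply[OF g])
    ultimately show ?thesis using Gal_pow[of _ \<rat> m] by (metis ext)
  qed
  have conj: "g \<circ> \<Phi> ^^ m \<circ> inv_into UNIV g = g \<otimes>\<^bsub>Gal \<rat>\<^esub> (\<Phi> ^^ m) \<otimes>\<^bsub>Gal \<rat>\<^esub> inv\<^bsub>Gal \<rat>\<^esub> g" if g: "g \<in> G" for g
    using g Gal_pow_closed[OF \<Phi>(1)] Gal_inv_closed[OF g] Gal_comp[OF g Gal_pow_closed[OF \<Phi>(1)]]
    by (simp add: Gal_inv Gal_mult[where L = \<rat>])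
  have "?\<chi> ((g \<circ> \<Phi> \<circ> inv_into UNIV g) [^]\<^bsub>Gal \<rat>\<^esub> m) = ?\<chi> (\<Phi> ^^ m)" if g: "g \<in> G" for g
    unfolding pow[OF g] conj[OF g]
    by (rule GG.induced_character_conjugate[OF g Gal_pow_closed[OF \<Phi>(1)]])
  then have "?\<chi> (\<sigma> [^]\<^bsub>Gal \<rat>\<^esub> m) = ?\<chi> (\<Phi> ^^ m)" if "\<sigma> \<in> frobenius_class p" for \<sigma>
    using frobenius_class_conjugates[OF inertia \<Phi>] that by blast
  moreover have "\<Phi> \<in> frobenius_class p" unfolding frobenius_class_iff using place \<Phi> by blast
  ultimately have "?\<chi> ` (\<lambda>\<sigma>. \<sigma> [^]\<^bsub>Gal \<rat>\<^esub> m) ` frobenius_class p = {?\<chi> (\<Phi> ^^ m)}"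
    by (auto simp: image_image)
  then have "class_value ?\<chi> ((\<lambda>\<sigma>. \<sigma> [^]\<^bsub>Gal \<rat>\<^esub> m) ` frobenius_class p) = ?\<chi> (\<Phi> ^^ m)"
    by (simp add: class_value_def)
  moreover have "?\<chi> (\<Phi> ^^ m) \<noteq> 0 \<longleftrightarrow>
      (\<exists>x\<in>G. inv\<^bsub>Gal \<rat>\<^esub> x \<otimes>\<^bsub>Gal \<rat>\<^esub> (\<Phi> ^^ m) \<otimes>\<^bsub>Gal \<rat>\<^esub> x \<in> carrier (Gal F))"
    using group.is_monoid[OF group_Gal, THEN monoid.one_closed, of F]
    by (intro induced_trivial_character_eq_0_iff finite_G) blast
  moreover have "(\<exists>x\<in>G. inv\<^bsub>Gal \<rat>\<^esub> x \<otimes>\<^bsub>Gal \<rat>\<^esub> (\<Phi> ^^ m) \<otimes>\<^bsub>Gal \<rat>\<^esub> x \<in> carrier (Gal F)) \<longleftrightarrow>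
      (\<exists>g\<in>G. g \<circ> \<Phi> ^^ m \<circ> inv_into UNIV g \<in> carrier (Gal F))"
  proof safe
    fix x assume "x \<in> G" "inv\<^bsub>Gal \<rat>\<^esub> x \<otimes>\<^bsub>Gal \<rat>\<^esub> (\<Phi> ^^ m) \<otimes>\<^bsub>Gal \<rat>\<^esub> x \<in> carrier (Gal F)"
    then show "\<exists>g\<in>G. g \<circ> \<Phi> ^^ m \<circ> inv_into UNIV g \<in> carrier (Gal F)"
      using conj[OF GG.inv_closed] by (intro bexI[of _ "inv\<^bsub>Gal \<rat>\<^esub> x"]) auto
  next
    fix g assume "g \<in> G" "g \<circ> \<Phi> ^^ m \<circ> inv_into UNIV g \<in> carrier (Gal F)"
    then show "\<exists>x\<in>G. inv\<^bsub>Gal \<rat>\<^esub> x \<otimes>\<^bsub>Gal \<rat>\<^esub> (\<Phi> ^^ m) \<otimes>\<^bsub>Gal \<rat>\<^esub> x \<in> carrier (Gal F)"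
      using conj by (intro bexI[of _ "inv\<^bsub>Gal \<rat>\<^esub> g"]) auto
  qed
  moreover have "(\<exists>g\<in>G. g \<circ> \<Phi> ^^ m \<circ> inv_into UNIV g \<in> carrier (Gal F))
      \<longleftrightarrow> (\<exists>f. f \<in># splitting_type F p \<and> f dvd m)"
    using conjugate_inertia_coset_meets_Gal_iff[OF F \<Phi>(1,2), of 1 m] \<Phi>(3) inertia by simp
  ultimately show ?thesis by simp
qed

lemma conjugate_coset_eq:
  assumes g: "g \<in> G" and c: "c \<in> G"
  shows "g <#\<^bsub>Gal \<rat>\<^esub> (inertia_group \<rat> P #>\<^bsub>Gal \<rat>\<^esub> (c [^]\<^bsub>Gal \<rat>\<^esub> (m::nat))) #>\<^bsub>Gal \<rat>\<^esub> inv\<^bsub>Gal \<rat>\<^esub> g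
    = (\<lambda>i. g \<circ> i \<circ> c ^^ m \<circ> inv_into UNIV g) ` inertia_group \<rat> P"
proof -
  have "(g \<otimes>\<^bsub>Gal \<rat>\<^esub> (i \<otimes>\<^bsub>Gal \<rat>\<^esub> (c ^^ m))) \<otimes>\<^bsub>Gal \<rat>\<^esub> inv_into UNIV g = g \<circ> i \<circ> c ^^ m \<circ> inv_into UNIV g"
    if "i \<in> inertia_group \<rat> P" for i
  proof -
    have i: "i \<in> G" using that by (simp add: inertia_group_iff)
    note cl = Gal_pow_closed[OF c, of m] Gal_inv_closed[OF g] g
    show ?thesis
      using cl Gal_mult[OF i cl(1)] Gal_comp[OF i cl(1)] Gal_mult[OF g Gal_comp[OF i cl(1)]]
        Gal_mult[OF Gal_comp[OF g Gal_comp[OF i cl(1)]] cl(2)]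
      by (simp add: comp_assoc)
  qed
  then show ?thesis
    by (auto simp: l_coset_def r_coset_def Gal_pow[OF c] Gal_inv[OF g])
qed

end

theorem lemma3p1:
  fixes F \<omega> :: "'a::field_char_0 set" and p :: nat and c :: "'a \<Rightarrow> 'a"
  assumes "finite_galois_extension (ring_of_type_algebra :: 'a ring) \<rat>"
    and "Factorial_Ring.prime p"
    and "\<omega> \<in> places_above UNIV p"
    and "c \<in> decomposition_group \<rat> \<omega>"
    and "generate (residue_galois_group \<rat> UNIV \<omega>) {reduction \<omega> c}
           = carrier (residue_galois_group \<rat> UNIV \<omega>)"
    and "subfield F ring_of_type_algebra"
  shows "kernel (Gal \<rat>\<lparr>carrier := decomposition_group \<rat> \<omega>\<rparr>)
             (residue_galois_group \<rat> F (place_under F \<omega>))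
             (\<lambda>\<sigma>. residue_restriction F \<omega> (reduction \<omega> \<sigma>))
           = inertia_group \<rat> \<omega> <#>\<^bsub>Gal \<rat>\<^esub> decomposition_group F \<omega>
    \<and> (\<forall>m::nat. m > 0 \<longrightarrow>
           ((\<exists>g \<in> carrier (Gal \<rat>).
              (g <#\<^bsub>Gal \<rat>\<^esub> (inertia_group \<rat> \<omega> #>\<^bsub>Gal \<rat>\<^esub> (c [^]\<^bsub>Gal \<rat>\<^esub> m))
                 #>\<^bsub>Gal \<rat>\<^esub> inv\<^bsub>Gal \<rat>\<^esub> g) \<inter> carrier (Gal F) \<noteq> {})
           \<longleftrightarrow> (\<exists>f. f \<in># splitting_type F p \<and> f dvd m)))
    \<and> (\<forall>m::nat. unramified (UNIV :: 'a set) p \<and> m > 0 \<longrightarrow>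
           ((class_value (induced_character (Gal \<rat>) (carrier (Gal F)) (\<lambda>_. 1))
              ((\<lambda>\<sigma>. \<sigma> [^]\<^bsub>Gal \<rat>\<^esub> m) ` frobenius_class p) \<noteq> 0)
           \<longleftrightarrow> (\<exists>f. f \<in># splitting_type F p \<and> f dvd m)))"
proof -
  interpret galois_place p \<omega> by unfold_locales (rule assms)+
  note F = assms(6)
  have c: "c \<in> G" "c ` \<omega> = \<omega>" using assms(4) by (auto simp: decomposition_group_iff)
  obtain j where j: "\<And>x. algebraic_int x \<Longrightarrow> (c ^^ j) x - x ^ p \<in> \<omega>"
    using Frobenius_in_powers_of_generator[OF c assms(5)] by blast
  have "(\<exists>g \<in> G. (g <#\<^bsub>Gal \<rat>\<^esub> (inertia_group \<rat> \<omega> #>\<^bsub>Gal \<rat>\<^esub> (c [^]\<^bsub>Gal \<rat>\<^esub> m))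
            #>\<^bsub>Gal \<rat>\<^esub> inv\<^bsub>Gal \<rat>\<^esub> g) \<inter> carrier (Gal F) \<noteq> {})
      \<longleftrightarrow> (\<exists>f. f \<in># splitting_type F p \<and> f dvd m)" for m :: nat
  proof -
    have "(g <#\<^bsub>Gal \<rat>\<^esub> (inertia_group \<rat> \<omega> #>\<^bsub>Gal \<rat>\<^esub> (c [^]\<^bsub>Gal \<rat>\<^esub> m))
            #>\<^bsub>Gal \<rat>\<^esub> inv\<^bsub>Gal \<rat>\<^esub> g) \<inter> carrier (Gal F) \<noteq> {}
        \<longleftrightarrow> (\<exists>i\<in>inertia_group \<rat> \<omega>. g \<circ> i \<circ> c ^^ m \<circ> inv_into UNIV g \<in> carrier (Gal F))"
      if "g \<in> G" for g
      unfolding conjugate_coset_eq[OF that c(1)] by blast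
    then show ?thesis
      using conjugate_inertia_coset_meets_Gal_iff[OF F c j, of m] by simp
  qed
  then show ?thesis
    using kernel_eq_inertia_times_decomposition[OF F] frobenius_class_value_iff[OF F] by blast
qed

end
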